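(* Let $\Omega$ be a domain in $\mathbb R^2$. Then the conformal capacitary distance $\rho_{(F,V)}$ is a metric on $\Omega$.
   Context: For disjoint sets $F_0,F_1\subset\Omega$, the conformal capacity is $\mathrm{cap}(F_0,F_1;\Omega)=\inf\int_\Omega|\nabla v|^2dx$, where the infimum is over nonnegative $v\in C(\Omega)$ with square integrable weak gradient, $v=0$ in a neighborhood of $F_0$, and $v\ge1$ in a neighborhood of $F_1$. Fix a continuum $F\subset\Omega$ and a domain $V$ with $F\subset V\subset\overline V\subset\Omega$, $\overline V$ compact, and $\partial V$ the image of the unit circle under a quasiconformal homeomorphism of $\mathbb R^2$. For $x,y\in\Omega$, $$\rho_{(F,V)}(x,y)=\inf_{l(x,y)}\big\{\mathrm{cap}^{1/2}(F,l(x,y)\setminus V;\Omega)+\mathrm{cap}^{1/2}(\partial\Omega,l(x,y)\cap V;\Omega)\big\},$$ where the infimum is over rectifiable curves $l(x,y)$ in $\Omega$ joining $x$ and $y$.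
   Formalization: Assumes that cap(∂Ω,K;Ω)>0 for some compact K⊂Ω (otherwise, e.g. for Ω=ℝ², the distance vanishes between distinct points of V) and that the continuum F has more than one point (otherwise it vanishes between distinct points outside V). *)

theory Defs
  imports "HOL-Analysis.Analysis"
begin

fun C_k :: "nat \<Rightarrow> (real^2 \<Rightarrow> real) \<Rightarrow> bool" where
  "C_k 0 f = continuous_on UNIV f"
| "C_k (Suc k) f = (\<exists>f'. (\<forall>x. (f has_derivative f' x) (at x)) \<and>
                       (\<forall>b\<in>(Basis :: (real^2) set). C_k k (\<lambda>x. f' x b)))"

definition smooth_fun :: "(real^2 \<Rightarrow> real) \<Rightarrow> bool" where
  "smooth_fun f \<longleftrightarrow> (\<forall>k. C_k k f)"

definition test_fun :: "(real^2) set \<Rightarrow> (real^2 \<Rightarrow> real) \<Rightarrow> bool" where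
  "test_fun \<Omega> \<phi> \<longleftrightarrow> smooth_fun \<phi> \<and> compact (closure {x. \<phi> x \<noteq> 0})
                      \<and> closure {x. \<phi> x \<noteq> 0} \<subseteq> \<Omega>"

definition weak_gradient :: "(real^2) set \<Rightarrow> (real^2 \<Rightarrow> real) \<Rightarrow> (real^2 \<Rightarrow> real^2) \<Rightarrow> bool" where
  "weak_gradient \<Omega> v g \<longleftrightarrow>
     (\<forall>K. compact K \<and> K \<subseteq> \<Omega> \<longrightarrow> integrable lborel (\<lambda>x. indicator K x *\<^sub>R g x)) \<and>
     (\<forall>\<phi> b. test_fun \<Omega> \<phi> \<and> b \<in> Basis \<longrightarrow>
        integrable lborel (\<lambda>x. v x * frechet_derivative \<phi> (at x) b) \<and>
        integrable lborel (\<lambda>x. (g x \<bullet> b) * \<phi> x) \<and>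
        (\<integral>x. v x * frechet_derivative \<phi> (at x) b \<partial>lborel) = - (\<integral>x. (g x \<bullet> b) * \<phi> x \<partial>lborel))"

definition cap_admissible ::
  "(real^2) set \<Rightarrow> (real^2) set \<Rightarrow> (real^2) set \<Rightarrow> (real^2 \<Rightarrow> real) \<Rightarrow> (real^2 \<Rightarrow> real^2) \<Rightarrow> bool" where
  "cap_admissible F0 F1 \<Omega> v g \<longleftrightarrow>
     continuous_on \<Omega> v \<and> (\<forall>x\<in>\<Omega>. 0 \<le> v x) \<and>
     weak_gradient \<Omega> v g \<and> set_integrable lborel \<Omega> (\<lambda>x. (norm (g x))\<^sup>2) \<and>
     (\<exists>U. open U \<and> F0 \<subseteq> U \<and> (\<forall>x\<in>U \<inter> \<Omega>. v x = 0)) \<and>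
     (\<exists>U. open U \<and> F1 \<subseteq> U \<and> (\<forall>x\<in>U \<inter> \<Omega>. 1 \<le> v x))"

definition conf_cap :: "(real^2) set \<Rightarrow> (real^2) set \<Rightarrow> (real^2) set \<Rightarrow> real" where
  "conf_cap F0 F1 \<Omega> =
     Inf {(LINT x:\<Omega>|lborel. (norm (g x))\<^sup>2) | v g. cap_admissible F0 F1 \<Omega> v g}"

definition rectifiable_path :: "(real \<Rightarrow> real^2) \<Rightarrow> bool" where
  "rectifiable_path p \<longleftrightarrow> path p \<and>
     (\<exists>B. \<forall>(n::nat) t. t 0 = 0 \<and> t n = 1 \<and> (\<forall>i<n. t i \<le> t (Suc i)) \<longrightarrow>
            (\<Sum>i<n. dist (p (t (Suc i))) (p (t i))) \<le> B)"

definition qc_dilatation :: "(real^2 \<Rightarrow> real^2) \<Rightarrow> real^2 \<Rightarrow> ereal" where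
  "qc_dilatation h x = Limsup (at_right 0)
     (\<lambda>r. ereal ((SUP y\<in>sphere x r. norm (h y - h x)) / (INF y\<in>sphere x r. norm (h y - h x))))"

definition quasiconformal :: "(real^2 \<Rightarrow> real^2) \<Rightarrow> bool" where
  "quasiconformal h \<longleftrightarrow> (\<exists>h'. homeomorphism UNIV UNIV h h') \<and>
                        (\<exists>K::real. \<forall>x. qc_dilatation h x \<le> ereal K)"

definition cap_dist :: "(real^2) set \<Rightarrow> (real^2) set \<Rightarrow> (real^2) set \<Rightarrow> real^2 \<Rightarrow> real^2 \<Rightarrow> real" where
  "cap_dist F V \<Omega> x y =
     Inf {sqrt (conf_cap F (path_image l - V) \<Omega>) + sqrt (conf_cap (frontier \<Omega>) (path_image l \<inter> V) \<Omega>)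
          | l. rectifiable_path l \<and> path_image l \<subseteq> \<Omega> \<and> pathstart l = x \<and> pathfinish l = y}"

end

theory Submission
  imports Defs "HOL-Computational_Algebra.Polynomial"
begin

text \<open>
  Subadditivity of the square root of the capacity (Minkowski's inequality for the gradients of
  \<open>v + w\<close>) gives the triangle inequality, and \<open>cap_dist F V \<Omega> x x = 0\<close> because points have zero
  capacity: average \<open>n\<close> bump functions on nested scales.

  For \<open>x \<noteq> y\<close> let \<open>v\<close>, \<open>w\<close> be competitors of energy at most \<open>e\<close> for the two capacities of a curve
  \<open>l\<close>. A function of energy \<open>e\<close> is \<open>O(e)\<close>-close in \<open>L\<^sup>2\<close> to one constant on any given compact subset
  of \<open>\<Omega>\<close>, and on a small square it is \<open>O(\<surd>e)\<close>-close to that constant on the whole boundary of some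
  concentric square. Such a boundary around \<open>x\<close> meets \<open>l\<close>, say at \<open>p\<close>; one around a point of the
  continuum \<open>F\<close> meets \<open>F\<close>, where \<open>v = 0\<close>. Hence \<open>v\<close> is close to \<open>0\<close> at \<open>p\<close>, which excludes
  \<open>p \<notin> V\<close>. If \<open>p \<in> V\<close>, the constant \<open>k\<close> of \<open>w\<close> is at least \<open>1/2\<close>, and pasting \<open>k\<close> into \<open>w\<close> on a
  neighbourhood of a compact set \<open>K\<close> bounds the capacity between \<open>\<partial>\<Omega>\<close> and \<open>K\<close> by \<open>O(e)\<close>.
\<close>

subsection \<open>Smooth functions and cutoffs\<close>

text \<open>In the plane a small energy says nothing about the value of a competitor at a prescribed
  point, since points have capacity zero. This shapes the proof of positivity: the endpoints of a
  curve carry no information, and the curve has to be intercepted on a whole family of square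
  boundaries, of which the energy makes at least one good. For the same reason \<open>F\<close>
  enters through two distinct points, so that it crosses such boundaries too. Squares replace discs
  because their boundaries consist of segments parallel to the axes: Tonelli in Cartesian
  coordinates and the fundamental theorem of calculus on lines then suffice. As competitors are
  merely continuous with a weak gradient, this calculus is done on mollifications, whose energy is
  no larger. The closeness to one constant is a Poincare inequality. It is proved on squares and
  carried through \<open>\<Omega>\<close> by gluing overlapping sets; it ties the values near
  \<open>x\<close>, near \<open>F\<close> and near \<open>K\<close> to the same number.\<close>

lemma C_k_SucD: "C_k (Suc k) f \<Longrightarrow> C_k k f"
proof (induction k arbitrary: f)
  case 0
  then obtain f' where "\<And>x. (f has_derivative f' x) (at x)" by auto
  then show ?case
    using continuous_at_imp_continuous_on has_derivative_continuous by (metis C_k.simps(1))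
next
  case (Suc k)
  then show ?case by (metis C_k.simps(2))
qed

lemma C_k_0D: "C_k k f \<Longrightarrow> C_k 0 f"
  by (induction k) (auto dest: C_k_SucD simp del: C_k.simps)

lemma C_k_const [simp]: "C_k k (\<lambda>x. c)"
proof (induction k arbitrary: c)
  case (Suc k)
  show ?case unfolding C_k.simps
    by (rule exI[of _ "\<lambda>x h. 0"]) (use Suc in auto)
qed auto

lemma C_k_add: "C_k k f \<Longrightarrow> C_k k g \<Longrightarrow> C_k k (\<lambda>x. f x + g x)"
proof (induction k arbitrary: f g)
  case (Suc k)
  obtain f' where f': "\<And>x. (f has_derivative f' x) (at x)" "\<forall>b\<in>Basis. C_k k (\<lambda>x. f' x b)"
    using Suc.prems by auto
  obtain g' where g': "\<And>x. (g has_derivative g' x) (at x)" "\<forall>b\<in>Basis. C_k k (\<lambda>x. g' x b)"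
    using Suc.prems by auto
  show ?case unfolding C_k.simps
    by (rule exI[of _ "\<lambda>x h. f' x h + g' x h"])
       (use f' g' Suc.IH in \<open>auto intro!: has_derivative_add\<close>)
qed (auto intro: continuous_intros)

lemma C_k_mult: "C_k k f \<Longrightarrow> C_k k g \<Longrightarrow> C_k k (\<lambda>x. f x * g x)"
proof (induction k arbitrary: f g)
  case (Suc k)
  obtain f' where f': "\<And>x. (f has_derivative f' x) (at x)" "\<forall>b\<in>Basis. C_k k (\<lambda>x. f' x b)"
    using Suc.prems by auto
  obtain g' where g': "\<And>x. (g has_derivative g' x) (at x)" "\<forall>b\<in>Basis. C_k k (\<lambda>x. g' x b)"
    using Suc.prems by auto
  have "C_k k f" "C_k k g" using Suc.prems C_k_SucD by blast+
  then show ?case unfolding C_k.simps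
    by (intro exI[of _ "\<lambda>x h. f x * g' x h + f' x h * g x"])
       (use f' g' Suc.IH in \<open>auto intro!: has_derivative_mult C_k_add\<close>)
qed (auto intro: continuous_intros)

lemma C_k_diff: "C_k k f \<Longrightarrow> C_k k g \<Longrightarrow> C_k k (\<lambda>x. f x - g x)"
  using C_k_add[of k f "\<lambda>x. -1 * g x"] C_k_mult[of k "\<lambda>x. -1" g] by simp

lemma C_k_prod:
  "finite I \<Longrightarrow> (\<And>i. i \<in> I \<Longrightarrow> C_k k (f i)) \<Longrightarrow> C_k k (\<lambda>x. \<Prod>i\<in>I. f i x)"
  by (induction I rule: finite_induct) (simp_all add: C_k_mult)

lemma C_k_inner_left: "C_k k (\<lambda>x. x \<bullet> a)"
proof (cases k)
  case (Suc m)
  show ?thesis unfolding Suc C_k.simps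
    by (rule exI[of _ "\<lambda>x h. h \<bullet> a"]) (auto intro!: derivative_eq_intros)
qed (auto intro: continuous_intros)

lemma C_k_affine: "C_k k f \<Longrightarrow> C_k k (\<lambda>x. f (s *\<^sub>R x + a))"
proof (induction k arbitrary: f)
  case 0
  then show ?case
    by (auto intro!: continuous_intros continuous_on_compose2[of UNIV f])
next
  case (Suc k)
  obtain f' where f': "\<And>x. (f has_derivative f' x) (at x)" "\<forall>b\<in>Basis. C_k k (\<lambda>x. f' x b)"
    using Suc.prems by auto
  have "((\<lambda>x. f (s *\<^sub>R x + a)) has_derivative (\<lambda>h. s * f' (s *\<^sub>R x + a) h)) (at x)" for x
  proof -
    have "((\<lambda>x. f (s *\<^sub>R x + a)) has_derivative (\<lambda>h. f' (s *\<^sub>R x + a) (s *\<^sub>R h))) (at x)"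
      by (rule has_derivative_compose[OF _ f'(1), where f = "\<lambda>x. s *\<^sub>R x + a", simplified])
         (auto intro!: derivative_eq_intros)
    moreover have "f' y (s *\<^sub>R h) = s * f' y h" for y h
      using linear_scale[OF has_derivative_linear[OF f'(1)]] by simp
    ultimately show ?thesis by simp
  qed
  moreover have "C_k k (\<lambda>x. s * f' (s *\<^sub>R x + a) b)" if "b \<in> Basis" for b
    using Suc.IH[of "\<lambda>x. f' x b"] f'(2) that by (intro C_k_mult) auto
  ultimately show ?case unfolding C_k.simps by (intro exI[of _ "\<lambda>x h. s * f' (s *\<^sub>R x + a) h"]) auto
qed

text \<open>The whole sequence \<open>F n\<close> of successive derivatives is carried along:
  differentiating \<open>F n (q x)\<close> produces \<open>F (Suc n) (q x)\<close> times a
  derivative of \<open>q\<close>, so the induction on \<open>k\<close> closes because it is uniform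
  in \<open>n\<close>.\<close>

lemma C_k_compose:
  assumes F: "\<And>n t. (F n has_real_derivative F (Suc n) t) (at t)" and q: "\<And>k. C_k k q"
  shows "C_k k (\<lambda>x. F n (q x))"
proof (induction k arbitrary: n)
  case 0
  have "continuous_on UNIV (F n)" using F DERIV_continuous_on by blast
  then show ?case using q[of 0] by (auto intro: continuous_on_compose2)
next
  case (Suc k)
  obtain q' where q': "\<And>x. (q has_derivative q' x) (at x)" "\<forall>b\<in>Basis. C_k k (\<lambda>x. q' x b)"
    using q[of "Suc k"] by auto
  have "((\<lambda>x. F n (q x)) has_derivative (\<lambda>h. F (Suc n) (q x) * q' x h)) (at x)" for x
    using has_derivative_compose[OF q'(1) F[unfolded has_field_derivative_def]] by simp
  then show ?case unfolding C_k.simps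
    by (intro exI[of _ "\<lambda>x h. F (Suc n) (q x) * q' x h"]) (use Suc.IH q' in \<open>auto intro!: C_k_mult\<close>)
qed

text \<open>Polynomials in \<open>1 / t\<close> times \<open>exp (- (1 / t))\<close>, continued by
  zero. The class contains the standard flat function (\<open>p = 1\<close>) and is closed under
  differentiation, hence contains all its derivatives.\<close>

definition flat :: "real poly \<Rightarrow> real \<Rightarrow> real" where
  "flat p t = (if t > 0 then poly p (1 / t) * exp (- (1 / t)) else 0)"

text \<open>With \<open>x = 1 / t\<close> this is the decay of powers against the exponential at
  infinity.\<close>

lemma flat_tendsto_0: "(flat p \<longlongrightarrow> 0) (at_right 0)"
proof -
  have "((\<lambda>x::real. \<Sum>i\<le>degree p. coeff p i * (x ^ i / exp x)) \<longlongrightarrow> (\<Sum>i\<le>degree p. coeff p i * 0)) at_top"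
    by (intro tendsto_intros tendsto_power_div_exp_0)
  moreover have "(\<lambda>x::real. \<Sum>i\<le>degree p. coeff p i * (x ^ i / exp x)) = (\<lambda>x. poly p x * exp (- x))"
    by (simp add: poly_altdef sum_divide_distrib exp_minus field_simps)
  ultimately have "((\<lambda>x. poly p x * exp (- x)) \<longlongrightarrow> 0) at_top" by simp
  then have "((\<lambda>t. poly p (inverse t) * exp (- inverse t)) \<longlongrightarrow> 0) (at_right 0)"
    using filterlim_compose filterlim_inverse_at_top_right by blast
  then show ?thesis
    by (rule Lim_transform_eventually)
       (auto simp: eventually_at_right_field flat_def field_simps intro!: exI[of _ 1])
qed

lemma flat_has_derivative:
  "(flat p has_real_derivative flat ([:0, 0, 1:] * (p - pderiv p)) t) (at t)"
proof -
  consider "t > 0" | "t < 0" | "t = 0" by linarith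
  then show ?thesis
  proof cases
    case 1
    have "((\<lambda>t. poly p (1 / t) * exp (- (1 / t))) has_real_derivative
        flat ([:0, 0, 1:] * (p - pderiv p)) t) (at t)"
      using 1 by (auto intro!: derivative_eq_intros DERIV_chain'[OF _ poly_DERIV]
          simp: flat_def power2_eq_square divide_simps) (simp add: algebra_simps)
    moreover have "eventually (\<lambda>x. flat p x = poly p (1 / x) * exp (- (1 / x))) (nhds t)"
      using eventually_nhds_in_open[of "{0<..}" t] 1 by (auto elim!: eventually_mono simp: flat_def)
    ultimately show ?thesis by (subst DERIV_cong_ev[OF refl _ refl]) 
  next
    case 2
    have "eventually (\<lambda>x. flat p x = 0) (nhds t)"
      using eventually_nhds_in_open[of "{..<0}" t] 2 by (auto elim!: eventually_mono simp: flat_def)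
    then show ?thesis using 2 DERIV_cong_ev[of t t "flat p" "\<lambda>_. 0" 0 0] by (simp add: flat_def)
  next
    case 3
    \<comment> \<open>For \<open>h > 0\<close> the difference quotient at zero stays in the class:
      it is \<open>flat ([:0, 1:] * p) h\<close>.\<close>
    have "((\<lambda>h. flat p h / h) \<longlongrightarrow> 0) (at_right 0)"
      by (rule Lim_transform_eventually[OF flat_tendsto_0[of "[:0, 1:] * p"]])
         (auto simp: eventually_at_right_field flat_def field_simps intro!: exI[of _ 1])
    moreover have "((\<lambda>h. flat p h / h) \<longlongrightarrow> 0) (at_left 0)"
      by (rule Lim_transform_eventually[OF tendsto_const])
         (auto simp: eventually_at_left_field flat_def intro!: exI[of _ "-1"])
    ultimately show ?thesis using 3
      by (simp add: DERIV_def flat_def filterlim_split_at)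
  qed
qed

lemma flat_C_k:
  assumes "\<And>k. C_k k q"
  shows "C_k k (\<lambda>x. flat 1 (q x))"
  using C_k_compose[of "\<lambda>n. flat (((\<lambda>p. [:0, 0, 1:] * (p - pderiv p)) ^^ n) 1)" q k 0]
    flat_has_derivative assms by auto

lemma flat_1_mono: "s \<le> t \<Longrightarrow> flat 1 s \<le> flat 1 t"
  by (auto simp: flat_def frac_le)

lemma flat_1_nonneg: "0 \<le> flat 1 t"
  by (simp add: flat_def)

text \<open>With \<open>f = flat 1\<close>, the function \<open>t \<mapsto> f (f 1 - f t) / f (f 1)\<close> is a smooth step: it equals
  \<open>1\<close> for \<open>t \<le> 0\<close> and \<open>0\<close> for \<open>t \<ge> 1\<close>.\<close>

lemma unit_bump_exists:
  obtains \<psi> :: "real^2 \<Rightarrow> real"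
  where "smooth_fun \<psi>" "\<And>x. 0 \<le> \<psi> x" "\<And>x. \<psi> x \<le> 1"
    "\<And>x. norm x \<le> 1 \<Longrightarrow> \<psi> x = 1" "\<And>x. 2 \<le> norm x \<Longrightarrow> \<psi> x = 0" "\<And>x. \<psi> (- x) = \<psi> x"
proof
  let ?f = "flat 1"
  define c where "c = ?f 1"
  have c: "c > 0" and fc: "?f c > 0" by (auto simp: c_def flat_def)
  let ?q = "\<lambda>x::real^2. x \<bullet> x - 1"
  let ?\<psi> = "\<lambda>x::real^2. ?f (c - ?f (?q x)) * (1 / ?f c)"
  have sq: "C_k k (\<lambda>x::real^2. x \<bullet> x)" for k
  proof -
    have "C_k k (\<lambda>x::real^2. (x \<bullet> axis 1 1) * (x \<bullet> axis 1 1) + (x \<bullet> axis 2 1) * (x \<bullet> axis 2 1))"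
      by (intro C_k_add C_k_mult C_k_inner_left)
    moreover have "(\<lambda>x::real^2. (x \<bullet> axis 1 1) * (x \<bullet> axis 1 1) + (x \<bullet> axis 2 1) * (x \<bullet> axis 2 1)) = (\<lambda>x. x \<bullet> x)"
      by (auto simp: inner_axis) (auto simp: inner_vec_def sum_2)
    ultimately show ?thesis by simp
  qed
  show "smooth_fun ?\<psi>" unfolding smooth_fun_def
    by (intro allI C_k_mult flat_C_k C_k_diff sq C_k_const)
  show "0 \<le> ?\<psi> x" for x using fc by (simp add: flat_1_nonneg)
  show "?\<psi> x \<le> 1" for x using fc flat_1_mono[of "c - ?f (?q x)" c] flat_1_nonneg[of "?q x"] by simp
  show "?\<psi> x = 1" if "norm x \<le> 1" for x
  proof -
    have "?q x \<le> 0" using that by (simp add: dot_square_norm power_le_one)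
    then show ?thesis using fc by (simp add: flat_def)
  qed
  show "?\<psi> x = 0" if "2 \<le> norm x" for x
  proof -
    \<comment> \<open>Here \<open>x \<bullet> x - 1\<close> is at least 3, beyond the value 1 at
      which the step has come down to zero.\<close>
    have "2\<^sup>2 \<le> (norm x)\<^sup>2" using that by (intro power_mono) auto
    then have "c \<le> ?f (?q x)" unfolding c_def by (intro flat_1_mono) (simp add: dot_square_norm)
    then show ?thesis by (simp add: flat_def)
  qed
qed auto

text \<open>The unit bump, translated and rescaled. The symmetry about \<open>a\<close> is recorded
  for the mollifier, where the two arguments of the kernel have to be exchanged.\<close>

lemma bump_exists:
  fixes a :: "real^2"
  assumes "r > 0"
  obtains \<psi> where "smooth_fun \<psi>" "\<And>x. 0 \<le> \<psi> x" "\<And>x. \<psi> x \<le> 1"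
    "\<And>x. x \<in> cball a r \<Longrightarrow> \<psi> x = 1" "\<And>x. x \<notin> ball a (2 * r) \<Longrightarrow> \<psi> x = 0"
    "\<And>z. \<psi> (a - z) = \<psi> (a + z)"
proof -
  obtain \<psi> :: "real^2 \<Rightarrow> real" where \<psi>: "smooth_fun \<psi>" "\<And>x. 0 \<le> \<psi> x" "\<And>x. \<psi> x \<le> 1"
    "\<And>x. norm x \<le> 1 \<Longrightarrow> \<psi> x = 1" "\<And>x. 2 \<le> norm x \<Longrightarrow> \<psi> x = 0" "\<And>x. \<psi> (- x) = \<psi> x"
    using unit_bump_exists by blast
  let ?A = "\<lambda>x. (1 / r) *\<^sub>R x + (- (1 / r) *\<^sub>R a)"
  have n: "norm (?A x) = dist a x / r" for x
  proof -
    have "?A x = (1 / r) *\<^sub>R (x - a)" by (simp add: algebra_simps)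
    then show ?thesis using assms by (simp add: dist_norm norm_minus_commute)
  qed
  show thesis
  proof (rule that[of "\<lambda>x. \<psi> (?A x)"])
    show "smooth_fun (\<lambda>x. \<psi> (?A x))" using \<psi>(1) unfolding smooth_fun_def by (blast intro: C_k_affine)
    show "\<psi> (?A x) = 1" if "x \<in> cball a r" for x
      using that assms by (intro \<psi>(4), subst n) (simp add: field_simps)
    show "\<psi> (?A x) = 0" if "x \<notin> ball a (2 * r)" for x
      using that assms by (intro \<psi>(5), subst n) (simp add: field_simps)
    show "\<psi> (?A (a - z)) = \<psi> (?A (a + z))" for z
      using \<psi>(6)[of "(1 / r) *\<^sub>R z"] by (simp add: algebra_simps)
  qed (use \<psi> in auto)
qed

text \<open>Cover \<open>K\<close> by finitely many balls whose doubles lie in \<open>U\<close>.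
  Combining their bumps as one minus the product of \<open>1 - \<psi> x y\<close> keeps smoothness
  and values between 0 and 1, and gives 1 wherever a single bump is 1. The open set \<open>W\<close>
  is part of the conclusion because competitors are constrained on neighbourhoods.\<close>

lemma cutoff_exists:
  fixes K U :: "(real^2) set"
  assumes K: "compact K" and U: "open U" "K \<subseteq> U"
  obtains \<theta> W where "test_fun U \<theta>" "\<And>x. 0 \<le> \<theta> x" "\<And>x. \<theta> x \<le> 1"
    "open W" "K \<subseteq> W" "\<And>x. x \<in> W \<Longrightarrow> \<theta> x = 1"
proof -
  have "\<exists>r>0. cball x (2 * r) \<subseteq> U" if "x \<in> K" for x
  proof -
    have "x \<in> U" using U(2) that by blast
    then obtain e where "e > 0" "cball x e \<subseteq> U" using open_contains_cball_eq[OF U(1)] by blast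
    then show ?thesis by (intro exI[of _ "e / 2"]) simp
  qed
  then have "\<forall>x. \<exists>r. x \<in> K \<longrightarrow> r > 0 \<and> cball x (2 * r) \<subseteq> U" by blast
  from choice[OF this] obtain r where r: "\<And>x. x \<in> K \<Longrightarrow> r x > 0 \<and> cball x (2 * r x) \<subseteq> U" by blast
  define P where "P x \<psi> \<longleftrightarrow> smooth_fun \<psi> \<and> (\<forall>y. 0 \<le> \<psi> y \<and> \<psi> y \<le> 1) \<and> (\<forall>y\<in>cball x (r x). \<psi> y = 1) \<and>
      (\<forall>y. y \<notin> ball x (2 * r x) \<longrightarrow> \<psi> y = 0)" for x and \<psi> :: "real^2 \<Rightarrow> real"
  have "\<exists>\<psi>. x \<in> K \<longrightarrow> P x \<psi>" for x
  proof (cases "x \<in> K")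
    case True
    then have "r x > 0" using r by simp
    then obtain \<psi> where "smooth_fun \<psi>" "\<And>y. 0 \<le> \<psi> y" "\<And>y. \<psi> y \<le> 1"
        "\<And>y. y \<in> cball x (r x) \<Longrightarrow> \<psi> y = 1" "\<And>y. y \<notin> ball x (2 * r x) \<Longrightarrow> \<psi> y = 0"
      using bump_exists[where a = x and r = "r x"] by metis
    then have "P x \<psi>" unfolding P_def by simp
    then show ?thesis by blast
  qed simp
  then have "\<exists>\<psi>. \<forall>x. x \<in> K \<longrightarrow> P x (\<psi> x)" by (intro choice) simp
  then obtain \<psi> where \<psi>: "\<And>x. x \<in> K \<Longrightarrow> P x (\<psi> x)" by blast
  obtain T where T: "T \<subseteq> K" "finite T" "K \<subseteq> (\<Union>x\<in>T. ball x (r x))"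
  proof (rule compactE_image[OF K, of K "\<lambda>x. ball x (r x)"])
    show "K \<subseteq> (\<Union>x\<in>K. ball x (r x))" using r by force
  qed (use that in auto)
  let ?\<theta> = "\<lambda>y. 1 - (\<Prod>x\<in>T. (1 - \<psi> x y))"
  let ?S = "\<Union>x\<in>T. cball x (2 * r x)"
  have supp: "{y. ?\<theta> y \<noteq> 0} \<subseteq> ?S"
  proof
    fix y assume y: "y \<in> {y. ?\<theta> y \<noteq> 0}"
    show "y \<in> ?S"
    proof (rule ccontr)
      assume "y \<notin> ?S"
      then have "\<psi> x y = 0" if "x \<in> T" for x
        using that \<psi>[of x] T(1) ball_subset_cball[of x "2 * r x"] unfolding P_def by blast
      then show False using y by simp
    qed
  qed
  have cS: "compact ?S" using T(2) by (intro compact_UN) auto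
  have SU: "?S \<subseteq> U" using r T(1) by blast
  have cl: "closure {y. ?\<theta> y \<noteq> 0} \<subseteq> ?S" using supp cS compact_imp_closed closure_minimal by blast
  show thesis
  proof (rule that[of ?\<theta> "\<Union>x\<in>T. ball x (r x)"])
    have "smooth_fun ?\<theta>" unfolding smooth_fun_def
      using \<psi> T unfolding P_def smooth_fun_def by (intro allI C_k_diff C_k_prod C_k_const) blast+
    moreover have "compact (closure {y. ?\<theta> y \<noteq> 0})"
      using cl cS by (meson bounded_subset closed_closure compact_eq_bounded_closed)
    ultimately show "test_fun U ?\<theta>" using cl SU unfolding test_fun_def by blast
    show "0 \<le> ?\<theta> y" for y using prod_le_1[of T "\<lambda>x. 1 - \<psi> x y"] \<psi> T(1) by (auto simp: P_def)
    show "?\<theta> y \<le> 1" for y using prod_nonneg[of T "\<lambda>x. 1 - \<psi> x y"] \<psi> T(1) by (auto simp: P_def)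
    show "?\<theta> y = 1" if y: "y \<in> (\<Union>x\<in>T. ball x (r x))" for y
    proof -
      obtain x where "x \<in> T" "y \<in> ball x (r x)" using y by blast
      then have "x \<in> T" "1 - \<psi> x y = 0" using \<psi> T(1) by (auto simp: P_def)
      then have "(\<Prod>x\<in>T. (1 - \<psi> x y)) = 0" using T(2) by (meson prod_zero)
      then show ?thesis by simp
    qed
  qed (use T in auto)
qed

subsection \<open>Weak gradients\<close>

definition grad :: "(real^2 \<Rightarrow> real) \<Rightarrow> real^2 \<Rightarrow> real^2" where
  "grad f x = (\<Sum>b\<in>Basis. frechet_derivative f (at x) b *\<^sub>R b)"

lemma grad_inner_Basis: "b \<in> Basis \<Longrightarrow> grad f x \<bullet> b = frechet_derivative f (at x) b"
  unfolding grad_def by (simp add: inner_sum_left inner_Basis if_distrib sum.delta' cong: if_cong)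

lemma C_1_has_derivative:
  assumes "C_k (Suc k) f"
  shows "(f has_derivative frechet_derivative f (at x)) (at x)"
proof -
  obtain f' where "(f has_derivative f' x) (at x)" using assms by auto
  then show ?thesis using frechet_derivative_at by fastforce
qed

lemma C_k_frechet_derivative:
  assumes "C_k (Suc k) f" "b \<in> Basis"
  shows "C_k k (\<lambda>x. frechet_derivative f (at x) b)"
proof -
  obtain f' where f': "\<And>x. (f has_derivative f' x) (at x)" "\<forall>b\<in>Basis. C_k k (\<lambda>x. f' x b)"
    using assms by auto
  have "(\<lambda>x. frechet_derivative f (at x) b) = (\<lambda>x. f' x b)"
    using frechet_derivative_at[OF f'(1)] by simp
  then show ?thesis using f'(2) assms(2) by simp
qed

lemma continuous_on_C_k:
  assumes "C_k k f"
  shows "continuous_on S f"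
proof -
  have "continuous_on UNIV f" using C_k_0D[OF assms] by simp
  then show ?thesis by (rule continuous_on_subset) simp
qed

lemma continuous_on_partial:
  "C_k 1 f \<Longrightarrow> b \<in> Basis \<Longrightarrow> continuous_on S (\<lambda>x. frechet_derivative f (at x) b)"
  unfolding One_nat_def by (rule continuous_on_C_k[OF C_k_frechet_derivative])

lemma continuous_on_grad: "C_k 1 f \<Longrightarrow> continuous_on S (grad f)"
  unfolding grad_def by (intro continuous_on_sum continuous_on_scaleR continuous_on_partial continuous_on_const)

lemma frechet_derivative_mult:
  assumes "C_k 1 f" "C_k 1 g"
  shows "frechet_derivative (\<lambda>x. f x * g x) (at x) b
    = f x * frechet_derivative g (at x) b + frechet_derivative f (at x) b * g x"
proof -
  have "(f has_derivative frechet_derivative f (at x)) (at x)" "(g has_derivative frechet_derivative g (at x)) (at x)"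
    using assms unfolding One_nat_def by (auto intro: C_1_has_derivative simp del: C_k.simps)
  from frechet_derivative_at[OF has_derivative_mult[OF this]] show ?thesis by (rule fun_cong[symmetric])
qed

lemma frechet_derivative_locally_const:
  assumes "open U" "x \<in> U" "\<And>y. y \<in> U \<Longrightarrow> f y = c"
  shows "frechet_derivative f (at x) b = 0"
proof -
  have "((\<lambda>_. c) has_derivative (\<lambda>_. 0)) (at x)" by simp
  then have "(f has_derivative (\<lambda>_. 0)) (at x)"
    by (rule has_derivative_transform_within_open[OF _ assms(1,2)]) (simp add: assms(3))
  from fun_cong[OF frechet_derivative_at[OF this], of b] show ?thesis by simp
qed

lemma grad_locally_const:
  assumes "open U" "x \<in> U" "\<And>y. y \<in> U \<Longrightarrow> f y = c"
  shows "grad f x = 0"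
  using frechet_derivative_locally_const[OF assms] by (simp add: grad_def)

lemma frechet_derivative_outside_support:
  assumes "closed K" "\<And>x. x \<notin> K \<Longrightarrow> f x = 0" "x \<notin> K"
  shows "frechet_derivative f (at x) b = 0"
  using assms by (intro frechet_derivative_locally_const[of "- K" x f 0]) auto

text \<open>Continuity is required on \<open>K\<close> only: competitors are continuous on
  \<open>\<Omega>\<close> and their values elsewhere are arbitrary.\<close>

lemma integrable_compact_support:
  fixes f :: "real^2 \<Rightarrow> real"
  assumes "compact K" "continuous_on K f" "\<And>x. x \<notin> K \<Longrightarrow> f x = 0"
  shows "integrable lborel f"
proof -
  have "(\<lambda>x. indicator K x *\<^sub>R f x) = f" using assms(3) by (intro ext) (auto simp: indicator_def)
  then show ?thesis using borel_integrable_compact[OF assms(1,2)] by simp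
qed

text \<open>Bridge between the gauge integral over a box, to which the Leibniz rule applies, and the
  Lebesgue integral occurring in \<open>weak_gradient\<close>.\<close>

lemma integral_cbox_eq_lborel:
  fixes f :: "real^2 \<Rightarrow> real"
  assumes "integrable lborel f" "\<And>x. x \<notin> cbox a b \<Longrightarrow> f x = 0"
  shows "integral (cbox a b) f = (\<integral>x. f x \<partial>lborel)"
proof -
  have "(\<lambda>x. if x \<in> cbox a b then f x else 0) = f" using assms(2) by auto
  then show ?thesis using integral_restrict_UNIV[of "cbox a b" f] integral_lborel[OF assms(1)] by simp
qed

lemma lborel_integral_translation:
  fixes f :: "real^2 \<Rightarrow> real"
  assumes "f \<in> borel_measurable borel"
  shows "(\<integral>x. f (a + x) \<partial>lborel) = (\<integral>x. f x \<partial>lborel)"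
  using integral_distr[of "(+) a" lborel borel f] assms lborel_distr_plus[of a] by simp

text \<open>The integral of a translate does not depend on the translation; differentiate it.\<close>

lemma integral_partial_eq_0:
  assumes f: "C_k 1 f" and K: "compact K" "\<And>x. x \<notin> K \<Longrightarrow> f x = 0" and b: "b \<in> Basis"
  shows "(\<integral>x. frechet_derivative f (at x) b \<partial>lborel) = 0"
proof -
  let ?D = "\<lambda>x. frechet_derivative f (at x) b"
  have contf: "continuous_on S f" for S by (rule continuous_on_C_k[OF f])
  have contD: "continuous_on S ?D" for S by (rule continuous_on_partial[OF f b])
  have D0: "?D x = 0" if "x \<notin> K" for x
    using frechet_derivative_outside_support[of K f x b] K compact_imp_closed[OF K(1)] that by simp
  obtain R where R: "\<And>x. x \<in> K \<Longrightarrow> norm x \<le> R" using compact_imp_bounded[OF K(1)] bounded_iff by blast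
  \<comment> \<open>The margin 1 keeps every translate by \<open>t *\<^sub>R b\<close> with
    \<open>\<bar>t\<bar> \<le> 1\<close> supported in one fixed box.\<close>
  obtain c where c: "cball (0::real^2) (R + 1) \<subseteq> cbox (-c) c"
    using bounded_subset_cbox_symmetric[OF bounded_cball] by blast
  have supp: "f (t *\<^sub>R b + x) = 0" "?D (t *\<^sub>R b + x) = 0" if "x \<notin> cbox (-c) c" "\<bar>t\<bar> \<le> 1" for t x
  proof -
    have "norm x > R + 1" using c that by force
    moreover have "norm (t *\<^sub>R b) \<le> 1" using that b by simp
    ultimately have "norm (t *\<^sub>R b + x) > R" using norm_diff_ineq[of x "t *\<^sub>R b"] by (simp add: add.commute)
    then have "t *\<^sub>R b + x \<notin> K" using R by fastforce
    then show "f (t *\<^sub>R b + x) = 0" "?D (t *\<^sub>R b + x) = 0" using K D0 by auto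
  qed
  define J where "J = (\<integral>x. f x \<partial>lborel)"
  let ?U = "{-1<..<1::real}"
  have const: "integral (cbox (-c) c) (\<lambda>x. f (t *\<^sub>R b + x)) = J" if "t \<in> ?U" for t
  proof -
    have "continuous_on (cbox (-c) c) (\<lambda>x. f (t *\<^sub>R b + x))"
      by (intro continuous_on_compose2[OF contf[of UNIV]] continuous_intros) auto
    then have "integrable lborel (\<lambda>x. f (t *\<^sub>R b + x))"
      using integrable_compact_support[of "cbox (-c) c"] supp that by auto
    then have "integral (cbox (-c) c) (\<lambda>x. f (t *\<^sub>R b + x)) = (\<integral>x. f (t *\<^sub>R b + x) \<partial>lborel)"
      using supp that by (intro integral_cbox_eq_lborel) auto
    also have "\<dots> = J" unfolding J_def
      using contf[of UNIV] by (intro lborel_integral_translation borel_measurable_continuous_onI)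
    finally show ?thesis .
  qed
  have "((\<lambda>t. integral (cbox (-c) c) (\<lambda>x. f (t *\<^sub>R b + x))) has_field_derivative
      integral (cbox (-c) c) (\<lambda>x. ?D (0 *\<^sub>R b + x))) (at 0 within ?U)"
  proof (rule leibniz_rule_field_derivative)
    fix t :: real and x :: "real^2"
    have "((\<lambda>t. t *\<^sub>R b + x) has_derivative (\<lambda>h. h *\<^sub>R b)) (at t within ?U)"
      by (auto intro!: derivative_eq_intros)
    from has_derivative_compose[OF this C_1_has_derivative[OF f[unfolded One_nat_def]]]
    have "((\<lambda>t. f (t *\<^sub>R b + x)) has_derivative (\<lambda>h. frechet_derivative f (at (t *\<^sub>R b + x)) (h *\<^sub>R b))) (at t within ?U)"
      by simp
    moreover have "frechet_derivative f (at y) (h *\<^sub>R b) = ?D y * h" for y h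
      using linear_scale[OF has_derivative_linear[OF C_1_has_derivative[OF f[unfolded One_nat_def]]]] by (simp add: mult.commute)
    ultimately show "((\<lambda>t. f (t *\<^sub>R b + x)) has_field_derivative ?D (t *\<^sub>R b + x)) (at t within ?U)"
      by (simp add: has_field_derivative_def)
  next
    fix t :: real
    show "(\<lambda>x. f (t *\<^sub>R b + x)) integrable_on cbox (-c) c"
      by (intro integrable_continuous continuous_on_compose2[OF contf[of UNIV]] continuous_intros) auto
  next
    show "continuous_on (?U \<times> cbox (-c) c) (\<lambda>(t, x). ?D (t *\<^sub>R b + x))"
      unfolding split_beta by (intro continuous_on_compose2[OF contD[of UNIV]] continuous_intros) auto
  qed auto
  moreover have "((\<lambda>t. integral (cbox (-c) c) (\<lambda>x. f (t *\<^sub>R b + x))) has_field_derivative 0) (at 0 within ?U)"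
    by (rule has_field_derivative_transform_within[of "\<lambda>_. J" _ _ _ 1]) (use const in auto)
  ultimately have "integral (cbox (-c) c) ?D = 0"
    using DERIV_unique at_within_open[of 0 ?U] by fastforce
  moreover have "integrable lborel ?D"
    using integrable_compact_support[OF K(1) contD] D0 by blast
  ultimately show ?thesis using integral_cbox_eq_lborel[of ?D "-c" c] supp(2)[of _ 0] by simp
qed

lemma test_fun_support:
  assumes "test_fun \<Omega> \<phi>"
  shows "\<exists>K. compact K \<and> K \<subseteq> \<Omega> \<and> (\<forall>x. x \<notin> K \<longrightarrow> \<phi> x = 0) \<and>
    (\<forall>x b. x \<notin> K \<longrightarrow> frechet_derivative \<phi> (at x) b = 0)"
proof (intro exI[of _ "closure {x. \<phi> x \<noteq> 0}"] conjI allI impI)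
  let ?K = "closure {x. \<phi> x \<noteq> 0}"
  show "compact ?K" "?K \<subseteq> \<Omega>" using assms by (auto simp: test_fun_def)
  show 0: "\<phi> x = 0" if "x \<notin> ?K" for x using that closure_subset[of "{x. \<phi> x \<noteq> 0}"] by auto
  show "frechet_derivative \<phi> (at x) b = 0" if "x \<notin> ?K" for x b
    by (rule frechet_derivative_outside_support[OF closed_closure 0 that])
qed

lemma test_fun_C_k: "test_fun \<Omega> \<phi> \<Longrightarrow> C_k k \<phi>"
  by (simp add: test_fun_def smooth_fun_def)

text \<open>Integration by parts: the partial derivative of the compactly supported product
  \<open>f x * \<phi> x\<close> has integral zero, and the product rule splits it.\<close>

lemma weak_gradient_C1:
  assumes f: "C_k 1 f"
  shows "weak_gradient \<Omega> f (grad f)"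
  unfolding weak_gradient_def
proof (intro conjI allI impI)
  fix K assume "compact K \<and> K \<subseteq> \<Omega>"
  then show "integrable lborel (\<lambda>x. indicator K x *\<^sub>R grad f x)"
    by (intro borel_integrable_compact continuous_on_grad f) auto
next
  fix \<phi> and b :: "real^2" assume "test_fun \<Omega> \<phi> \<and> b \<in> Basis"
  then have \<phi>: "test_fun \<Omega> \<phi>" and b: "b \<in> Basis" by auto
  have C1: "C_k 1 \<phi>" using test_fun_C_k \<phi> .
  obtain K where K: "compact K" "K \<subseteq> \<Omega>" "\<And>x. x \<notin> K \<Longrightarrow> \<phi> x = 0"
    "\<And>x b. x \<notin> K \<Longrightarrow> frechet_derivative \<phi> (at x) b = 0" using test_fun_support[OF \<phi>] by auto
  show i1: "integrable lborel (\<lambda>x. f x * frechet_derivative \<phi> (at x) b)"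
    using K by (intro integrable_compact_support[OF K(1)] continuous_on_mult continuous_on_partial
        continuous_on_C_k f C1 b) (auto intro: f)
  have i2: "integrable lborel (\<lambda>x. frechet_derivative f (at x) b * \<phi> x)"
    using K by (intro integrable_compact_support[OF K(1)] continuous_on_mult continuous_on_partial
        continuous_on_C_k f C1 b) (auto intro: C1)
  then show "integrable lborel (\<lambda>x. grad f x \<bullet> b * \<phi> x)" using b by (simp add: grad_inner_Basis)
  have "(\<integral>x. frechet_derivative (\<lambda>x. f x * \<phi> x) (at x) b \<partial>lborel) = 0"
    using K by (intro integral_partial_eq_0[OF C_k_mult[OF f C1] K(1) _ b]) auto
  then show "(\<integral>x. f x * frechet_derivative \<phi> (at x) b \<partial>lborel) = - (\<integral>x. grad f x \<bullet> b * \<phi> x \<partial>lborel)"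
    using i1 i2 b by (simp add: frechet_derivative_mult[OF f C1] grad_inner_Basis)
qed

lemma weak_gradient_add:
  assumes "weak_gradient \<Omega> v g" "weak_gradient \<Omega> w h"
  shows "weak_gradient \<Omega> (\<lambda>x. v x + w x) (\<lambda>x. g x + h x)"
  unfolding weak_gradient_def
proof (intro conjI allI impI)
  fix K assume "compact K \<and> K \<subseteq> \<Omega>"
  then show "integrable lborel (\<lambda>x. indicator K x *\<^sub>R (g x + h x))"
    using assms unfolding weak_gradient_def scaleR_add_right by (intro Bochner_Integration.integrable_add) blast+
next
  fix \<phi> and b :: "real^2" assume "test_fun \<Omega> \<phi> \<and> b \<in> Basis"
  then show "integrable lborel (\<lambda>x. (v x + w x) * frechet_derivative \<phi> (at x) b)"
    "integrable lborel (\<lambda>x. (g x + h x) \<bullet> b * \<phi> x)"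
    "(\<integral>x. (v x + w x) * frechet_derivative \<phi> (at x) b \<partial>lborel) = - (\<integral>x. (g x + h x) \<bullet> b * \<phi> x \<partial>lborel)"
    using assms unfolding weak_gradient_def by (simp_all add: distrib_right inner_add_left)
qed

lemma weak_gradient_cmult:
  assumes "weak_gradient \<Omega> v g"
  shows "weak_gradient \<Omega> (\<lambda>x. c * v x) (\<lambda>x. c *\<^sub>R g x)"
  unfolding weak_gradient_def
proof (intro conjI allI impI)
  fix K assume "compact K \<and> K \<subseteq> \<Omega>"
  then have "integrable lborel (\<lambda>x. c *\<^sub>R (indicator K x *\<^sub>R g x))"
    using assms unfolding weak_gradient_def by (intro integrable_scaleR_right) blast
  then show "integrable lborel (\<lambda>x. indicator K x *\<^sub>R c *\<^sub>R g x)" by (simp add: mult.commute)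
next
  fix \<phi> and b :: "real^2" assume "test_fun \<Omega> \<phi> \<and> b \<in> Basis"
  then show "integrable lborel (\<lambda>x. c * v x * frechet_derivative \<phi> (at x) b)"
    "integrable lborel (\<lambda>x. c *\<^sub>R g x \<bullet> b * \<phi> x)"
    "(\<integral>x. c * v x * frechet_derivative \<phi> (at x) b \<partial>lborel) = - (\<integral>x. c *\<^sub>R g x \<bullet> b * \<phi> x \<partial>lborel)"
    using assms unfolding weak_gradient_def by (simp_all add: mult.assoc)
qed

text \<open>The product \<open>\<theta> x * \<phi> x\<close> is again a test function, so the
  identity for \<open>v\<close> can be applied to it; the product rule accounts for the extra term
  with \<open>grad \<theta>\<close>.\<close>

lemma weak_gradient_mult_smooth:
  assumes v: "continuous_on \<Omega> v" "weak_gradient \<Omega> v g" and \<theta>: "smooth_fun \<theta>"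
  shows "weak_gradient \<Omega> (\<lambda>x. \<theta> x * v x) (\<lambda>x. \<theta> x *\<^sub>R g x + v x *\<^sub>R grad \<theta> x)"
  unfolding weak_gradient_def
proof (intro conjI allI impI)
  have T1: "C_k 1 \<theta>" using \<theta> by (simp add: smooth_fun_def)
  {
    fix K assume K: "compact K \<and> K \<subseteq> \<Omega>"
    then have gK: "integrable lborel (\<lambda>x. indicator K x *\<^sub>R g x)"
      using v(2) unfolding weak_gradient_def by blast
    have "bounded (\<theta> ` K)" using K compact_continuous_image[OF continuous_on_C_k[OF T1]] compact_imp_bounded by blast
    then obtain B where B: "\<And>x. x \<in> K \<Longrightarrow> \<bar>\<theta> x\<bar> \<le> B" by (auto simp: bounded_iff)
    have "\<theta> \<in> borel_measurable borel" using continuous_on_C_k[OF T1] by (rule borel_measurable_continuous_onI)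
    then have "integrable lborel (\<lambda>x. \<theta> x *\<^sub>R (indicator K x *\<^sub>R g x))"
    proof (intro Bochner_Integration.integrable_bound[OF integrable_scaleR_right[OF gK, of B]])
      show "AE x in lborel. norm (\<theta> x *\<^sub>R (indicator K x *\<^sub>R g x)) \<le> norm (B *\<^sub>R (indicator K x *\<^sub>R g x))"
      proof (rule AE_I2)
        fix x
        show "norm (\<theta> x *\<^sub>R (indicator K x *\<^sub>R g x)) \<le> norm (B *\<^sub>R (indicator K x *\<^sub>R g x))"
          using B[of x] by (cases "x \<in> K") (auto intro!: mult_right_mono)
      qed
    qed (intro borel_measurable_scaleR borel_measurable_integrable[OF gK], simp)
    moreover have "integrable lborel (\<lambda>x. indicator K x *\<^sub>R (v x *\<^sub>R grad \<theta> x))"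
      using K v(1) by (intro borel_integrable_compact continuous_on_scaleR continuous_on_grad T1)
        (auto intro: continuous_on_subset)
    ultimately show "integrable lborel (\<lambda>x. indicator K x *\<^sub>R (\<theta> x *\<^sub>R g x + v x *\<^sub>R grad \<theta> x))"
      using Bochner_Integration.integrable_add[of lborel "\<lambda>x. \<theta> x *\<^sub>R (indicator K x *\<^sub>R g x)"
        "\<lambda>x. indicator K x *\<^sub>R (v x *\<^sub>R grad \<theta> x)"] by (simp add: scaleR_add_right mult.commute)
  }
  fix \<phi> and b :: "real^2" assume "test_fun \<Omega> \<phi> \<and> b \<in> Basis"
  then have \<phi>: "test_fun \<Omega> \<phi>" and b: "b \<in> Basis" by auto
  have C1: "C_k 1 \<phi>" using test_fun_C_k \<phi> .
  obtain K where K: "compact K" "K \<subseteq> \<Omega>" "\<And>x. x \<notin> K \<Longrightarrow> \<phi> x = 0"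
    "\<And>x b. x \<notin> K \<Longrightarrow> frechet_derivative \<phi> (at x) b = 0" using test_fun_support[OF \<phi>] by auto
  have sub: "closure {x. \<theta> x * \<phi> x \<noteq> 0} \<subseteq> closure {x. \<phi> x \<noteq> 0}" by (intro closure_mono) auto
  have "test_fun \<Omega> (\<lambda>x. \<theta> x * \<phi> x)"
    unfolding test_fun_def
  proof (intro conjI)
    show "smooth_fun (\<lambda>x. \<theta> x * \<phi> x)" using \<theta> \<phi> by (simp add: smooth_fun_def test_fun_def C_k_mult)
    show "compact (closure {x. \<theta> x * \<phi> x \<noteq> 0})"
      using sub \<phi> unfolding test_fun_def by (meson bounded_subset closed_closure compact_eq_bounded_closed)
    show "closure {x. \<theta> x * \<phi> x \<noteq> 0} \<subseteq> \<Omega>" using sub \<phi> unfolding test_fun_def by blast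
  qed
  with v(2) b have wg: "integrable lborel (\<lambda>x. v x * frechet_derivative (\<lambda>x. \<theta> x * \<phi> x) (at x) b)"
      "integrable lborel (\<lambda>x. g x \<bullet> b * (\<theta> x * \<phi> x))"
      "(\<integral>x. v x * frechet_derivative (\<lambda>x. \<theta> x * \<phi> x) (at x) b \<partial>lborel) = - (\<integral>x. g x \<bullet> b * (\<theta> x * \<phi> x) \<partial>lborel)"
    unfolding weak_gradient_def by blast+
  have i: "integrable lborel (\<lambda>x. v x * (frechet_derivative \<theta> (at x) b * \<phi> x))"
    using K by (intro integrable_compact_support[OF K(1)] continuous_on_mult continuous_on_partial
        continuous_on_C_k[OF C1] continuous_on_subset[OF v(1) K(2)] T1 b) auto
  have e1: "(\<lambda>x. \<theta> x * v x * frechet_derivative \<phi> (at x) b) = (\<lambda>x. v x * frechet_derivative (\<lambda>x. \<theta> x * \<phi> x) (at x) b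
      - v x * (frechet_derivative \<theta> (at x) b * \<phi> x))"
    unfolding frechet_derivative_mult[OF T1 C1] by (simp add: algebra_simps)
  have e2: "(\<lambda>x. (\<theta> x *\<^sub>R g x + v x *\<^sub>R grad \<theta> x) \<bullet> b * \<phi> x) =
     (\<lambda>x. g x \<bullet> b * (\<theta> x * \<phi> x) + v x * (frechet_derivative \<theta> (at x) b * \<phi> x))"
    using b by (simp add: inner_add_left grad_inner_Basis algebra_simps)
  show "integrable lborel (\<lambda>x. \<theta> x * v x * frechet_derivative \<phi> (at x) b)"
    unfolding e1 using wg i by simp
  show "integrable lborel (\<lambda>x. (\<theta> x *\<^sub>R g x + v x *\<^sub>R grad \<theta> x) \<bullet> b * \<phi> x)"
    unfolding e2 using wg i by simp
  show "(\<integral>x. \<theta> x * v x * frechet_derivative \<phi> (at x) b \<partial>lborel) =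
     - (\<integral>x. (\<theta> x *\<^sub>R g x + v x *\<^sub>R grad \<theta> x) \<bullet> b * \<phi> x \<partial>lborel)"
    unfolding e1 e2 using wg i by simp
qed

subsection \<open>Mollification\<close>

text \<open>Jensen's inequality for the square: the variance of \<open>f\<close> under the
  probability density \<open>w\<close> is nonnegative.\<close>

lemma square_integral_le_weighted:
  fixes f w :: "'a \<Rightarrow> real"
  assumes w: "integrable M w" "(\<integral>x. w x \<partial>M) = 1" "\<And>x. 0 \<le> w x"
    and f: "integrable M (\<lambda>x. f x * w x)" "integrable M (\<lambda>x. (f x)\<^sup>2 * w x)"
  shows "(\<integral>x. f x * w x \<partial>M)\<^sup>2 \<le> (\<integral>x. (f x)\<^sup>2 * w x \<partial>M)"
proof -
  define m where "m = (\<integral>x. f x * w x \<partial>M)"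
  have "0 \<le> (\<integral>x. (f x - m)\<^sup>2 * w x \<partial>M)" using w(3) by (intro integral_nonneg_AE) auto
  also have "(\<lambda>x. (f x - m)\<^sup>2 * w x) = (\<lambda>x. (f x)\<^sup>2 * w x - 2 * m * (f x * w x) + m\<^sup>2 * w x)"
    by (simp add: power2_eq_square algebra_simps)
  also have "(\<integral>x. (f x)\<^sup>2 * w x - 2 * m * (f x * w x) + m\<^sup>2 * w x \<partial>M)
      = (\<integral>x. (f x)\<^sup>2 * w x \<partial>M) - 2 * m * m + m\<^sup>2 * 1"
    using w f by (simp add: m_def)
  finally show ?thesis by (simp add: m_def power2_eq_square)
qed

lemma norm_sq_eq_sum_Basis: "(norm (x::'a::euclidean_space))\<^sup>2 = (\<Sum>b\<in>Basis. (x \<bullet> b)\<^sup>2)"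
  unfolding power2_norm_eq_inner euclidean_inner[of x x] by (simp add: power2_eq_square)

text \<open>Nothing is known about \<open>g\<close> off \<open>\<Omega>\<close>; cutting it off
  outside a compact set yields a function on the whole plane that can be integrated against
  kernels.\<close>

lemma weak_gradient_sq_integrable_compact:
  assumes g: "weak_gradient \<Omega> v g" "set_integrable lborel \<Omega> (\<lambda>x. (norm (g x))\<^sup>2)"
    and K: "compact K" "K \<subseteq> \<Omega>"
  shows "integrable lborel (\<lambda>x. indicator K x *\<^sub>R g x)"
    and "integrable lborel (\<lambda>x. (norm (indicator K x *\<^sub>R g x))\<^sup>2)"
    and "(\<integral>x. (norm (indicator K x *\<^sub>R g x))\<^sup>2 \<partial>lborel) \<le> (LINT x:\<Omega>|lborel. (norm (g x))\<^sup>2)"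
proof -
  show 1: "integrable lborel (\<lambda>x. indicator K x *\<^sub>R g x)"
    using g(1) K unfolding weak_gradient_def by blast
  have \<Omega>: "integrable lborel (\<lambda>x. indicator \<Omega> x *\<^sub>R (norm (g x))\<^sup>2)"
    using g(2) by (simp add: set_integrable_def)
  have le: "(norm (indicator K x *\<^sub>R g x))\<^sup>2 \<le> indicator \<Omega> x *\<^sub>R (norm (g x))\<^sup>2" for x
    using K(2) by (auto simp: indicator_def)
  show 2: "integrable lborel (\<lambda>x. (norm (indicator K x *\<^sub>R g x))\<^sup>2)"
  proof (rule Bochner_Integration.integrable_bound[OF \<Omega>])
    show "(\<lambda>x. (norm (indicator K x *\<^sub>R g x))\<^sup>2) \<in> borel_measurable lborel"
      using borel_measurable_integrable[OF 1] by measurable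
    show "AE x in lborel. norm ((norm (indicator K x *\<^sub>R g x))\<^sup>2) \<le> norm (indicator \<Omega> x *\<^sub>R (norm (g x))\<^sup>2)"
      using le by (intro AE_I2) (smt (verit) real_norm_def zero_le_power2)
  qed
  show "(\<integral>x. (norm (indicator K x *\<^sub>R g x))\<^sup>2 \<partial>lborel) \<le> (LINT x:\<Omega>|lborel. (norm (g x))\<^sup>2)"
    unfolding set_lebesgue_integral_def using le by (intro integral_mono 2 \<Omega>)
qed

text \<open>A bump divided by its integral, which is positive because the bump equals 1 on a
  ball.\<close>

lemma mollifier_exists:
  assumes "\<delta> > 0"
  obtains \<eta> :: "real^2 \<Rightarrow> real" where "smooth_fun \<eta>" "\<And>x. 0 \<le> \<eta> x" "\<And>x. \<delta> \<le> norm x \<Longrightarrow> \<eta> x = 0"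
    "(\<integral>x. \<eta> x \<partial>lborel) = 1" "\<And>x. \<eta> (- x) = \<eta> x"
proof -
  obtain \<psi> where \<psi>: "smooth_fun \<psi>" "\<And>x. 0 \<le> \<psi> x" "\<And>x. \<psi> x \<le> 1"
    "\<And>x. x \<in> cball (0::real^2) (\<delta> / 2) \<Longrightarrow> \<psi> x = 1" "\<And>x. x \<notin> ball 0 (2 * (\<delta> / 2)) \<Longrightarrow> \<psi> x = 0"
    "\<And>z. \<psi> (0 - z) = \<psi> (0 + z)"
    using bump_exists[of "\<delta> / 2" 0] assms by (metis half_gt_zero)
  have "C_k 0 \<psi>" using \<psi>(1) unfolding smooth_fun_def by blast
  then have c: "continuous_on S \<psi>" for S by (rule continuous_on_C_k)
  have int: "integrable lborel \<psi>"
    using \<psi>(5) by (intro integrable_compact_support[OF compact_cball c, of 0 \<delta>]) auto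
  define I where "I = (\<integral>x. \<psi> x \<partial>lborel)"
  have "measure lborel (cball (0::real^2) (\<delta> / 2)) = (\<integral>x. indicator (cball (0::real^2) (\<delta> / 2)) x \<partial>lborel)"
    by simp
  also have "\<dots> \<le> I" unfolding I_def
  proof (intro integral_mono int)
    show "integrable lborel (indicator (cball (0::real^2) (\<delta> / 2)) :: real^2 \<Rightarrow> real)"
      using emeasure_lborel_cball_finite by (intro integrable_real_indicator) auto
    show "indicator (cball 0 (\<delta> / 2)) x \<le> \<psi> x" for x using \<psi>(2,4)[of x] by (auto simp: indicator_def)
  qed
  finally have "measure lborel (cball (0::real^2) (\<delta> / 2)) \<le> I" .
  moreover have "0 < measure lborel (cball (0::real^2) (\<delta> / 2))"
    using assms by (intro content_cball_pos) simp
  ultimately have "0 < I" by linarith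
  show thesis
  proof (rule that[of "\<lambda>x. \<psi> x * (1 / I)"])
    show "smooth_fun (\<lambda>x. \<psi> x * (1 / I))"
      using \<psi>(1) unfolding smooth_fun_def by (intro allI C_k_mult C_k_const) simp
    show "(\<integral>x. \<psi> x * (1 / I) \<partial>lborel) = 1" using \<open>0 < I\<close> int by (simp flip: I_def)
  qed (use \<psi> \<open>0 < I\<close> in auto)
qed

text \<open>On \<open>K\<close> the partial derivatives of the convolution are averages of the weak
  gradient, so Jensen and Tonelli bound their energy by that of \<open>g\<close>. Derivatives are
  stated along axis-parallel lines with continuous \<open>D b\<close>, the form that the fundamental
  theorem of calculus on lines asks for.\<close>

lemma mollification:
  fixes v :: "real^2 \<Rightarrow> real"
  assumes \<Omega>: "open \<Omega>" and K: "compact K" "K \<subseteq> \<Omega>" and v: "continuous_on \<Omega> v"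
    and g: "weak_gradient \<Omega> v g" "set_integrable lborel \<Omega> (\<lambda>x. (norm (g x))\<^sup>2)" and \<epsilon>: "\<epsilon> > 0"
  shows "\<exists>u D. (\<forall>b\<in>Basis. continuous_on UNIV (D b)) \<and>
    (\<forall>b\<in>Basis. \<forall>x t. ((\<lambda>t. u (x + t *\<^sub>R b)) has_real_derivative D b (x + t *\<^sub>R b)) (at t)) \<and>
    (\<forall>x\<in>K. \<bar>u x - v x\<bar> \<le> \<epsilon>) \<and>
    (\<integral>\<^sup>+x\<in>K. ennreal (\<Sum>b\<in>Basis. (D b x)\<^sup>2) \<partial>lborel) \<le> ennreal (LINT x:\<Omega>|lborel. (norm (g x))\<^sup>2)"
proof -
  obtain r where r: "r > 0" "(\<Union>x\<in>K. cball x r) \<subseteq> \<Omega>"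
    using compact_subset_open_imp_cball_epsilon_subset[OF K(1) \<Omega> K(2)] by blast
  \<comment> \<open>The closed \<open>r\<close>-neighbourhood of \<open>K\<close>, still inside
    \<open>\<Omega>\<close>; all kernels centred in \<open>K\<close> will be supported here.\<close>
  define K' where "K' = (\<Union>x\<in>K. \<Union>y\<in>cball 0 r. {x + y})"
  have K': "compact K'" unfolding K'_def by (rule compact_sums'[OF K(1) compact_cball])
  have K'I: "y \<in> K'" if "x \<in> K" "dist x y \<le> r" for x y
    unfolding K'_def using that by (intro UN_I[of x] UN_I[of "y - x"]) (auto simp: dist_norm norm_minus_commute)
  have K'\<Omega>: "K' \<subseteq> \<Omega>" using r(2) unfolding K'_def by (force simp: dist_norm)
  have KK': "K \<subseteq> K'" using K'I r(1) by force
  have "uniformly_continuous_on K' v"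
    using compact_uniformly_continuous[OF continuous_on_subset[OF v K'\<Omega>] K'] .
  then obtain d where d: "d > 0" "\<And>x y. x \<in> K' \<Longrightarrow> y \<in> K' \<Longrightarrow> dist y x < d \<Longrightarrow> dist (v y) (v x) < \<epsilon>"
    using \<epsilon> unfolding uniformly_continuous_on_def by meson
  \<comment> \<open>At most \<open>r\<close>, so that kernels stay in \<open>K'\<close>; at most
    \<open>d\<close>, so that averaging moves \<open>v\<close> by no more than
    \<open>\<epsilon>\<close>.\<close>
  define \<delta> where "\<delta> = min r d"
  have \<delta>: "\<delta> > 0" "\<delta> \<le> r" "\<delta> \<le> d" using r d by (auto simp: \<delta>_def)
  obtain \<eta> :: "real^2 \<Rightarrow> real" where \<eta>: "smooth_fun \<eta>" "\<And>x. 0 \<le> \<eta> x" "\<And>x. \<delta> \<le> norm x \<Longrightarrow> \<eta> x = 0"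
    "(\<integral>x. \<eta> x \<partial>lborel) = 1" "\<And>x. \<eta> (- x) = \<eta> x"
    using mollifier_exists[OF \<delta>(1)] by metis
  have C\<eta>: "C_k k \<eta>" for k using \<eta>(1) unfolding smooth_fun_def by blast
  have c\<eta>: "continuous_on S \<eta>" for S using C\<eta> by (rule continuous_on_C_k)
  have m\<eta>: "\<eta> \<in> borel_measurable borel" using c\<eta> by (rule borel_measurable_continuous_onI)
  have D\<eta>: "(\<eta> has_derivative frechet_derivative \<eta> (at x)) (at x)" for x
    using C\<eta>[of "Suc 0"] by (rule C_1_has_derivative)
  have cD\<eta>: "continuous_on S (\<lambda>x. frechet_derivative \<eta> (at x) b)" if "b \<in> Basis" for S b
    using C\<eta> that by (rule continuous_on_partial)
  have D\<eta>0: "frechet_derivative \<eta> (at x) b = 0" if "x \<notin> cball 0 \<delta>" for x b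
    using that \<eta>(3) by (intro frechet_derivative_outside_support[OF closed_cball[of 0 \<delta>]]) auto
  \<comment> \<open>A Tietze extension of \<open>v\<close> from \<open>K'\<close>: convolution over
    a fixed box, at all centres, requires an integrand continuous on the whole box.\<close>
  obtain w where w: "continuous_on UNIV w" "\<And>x. x \<in> K' \<Longrightarrow> w x = v x"
    using Tietze_unbounded[of K' v UNIV] continuous_on_subset[OF v K'\<Omega>] K' compact_imp_closed
    by (metis closed_closedin subtopology_UNIV)
  obtain c where c: "K' \<subseteq> cbox (-c) c"
    using bounded_subset_cbox_symmetric[OF compact_imp_bounded[OF K']] by blast
  define u where "u x = integral (cbox (-c) c) (\<lambda>y. w y * \<eta> (y - x))" for x
  \<comment> \<open>The derivative falls on the kernel; the minus sign comes from differentiating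
    \<open>y - x\<close> with respect to \<open>x\<close>.\<close>
  define D where "D b x = integral (cbox (-c) c) (\<lambda>y. w y * - frechet_derivative \<eta> (at (y - x)) b)" for b x
  have contD: "continuous_on UNIV (D b)" if "b \<in> Basis" for b
    unfolding D_def
    by (intro integral_continuous_on_param, unfold split_beta)
      (auto intro!: continuous_intros continuous_on_compose2[OF w(1)]
        continuous_on_compose2[OF cD\<eta>[OF that, of UNIV]])
  have derivu: "((\<lambda>t. u (x + t *\<^sub>R b)) has_real_derivative D b (x + t *\<^sub>R b)) (at t)" if b: "b \<in> Basis" for b x t
    unfolding u_def D_def
  proof (rule leibniz_rule_field_derivative[where U = UNIV])
    fix t :: real and y :: "real^2"
    have "((\<lambda>t. y - (x + t *\<^sub>R b)) has_derivative (\<lambda>h. - (h *\<^sub>R b))) (at t)"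
      by (auto intro!: derivative_eq_intros)
    from has_derivative_compose[OF this D\<eta>]
    have A: "((\<lambda>t. \<eta> (y - (x + t *\<^sub>R b))) has_derivative
        (\<lambda>h. frechet_derivative \<eta> (at (y - (x + t *\<^sub>R b))) (- (h *\<^sub>R b)))) (at t)" by simp
    have B: "frechet_derivative \<eta> (at z) (- (h *\<^sub>R b)) = - frechet_derivative \<eta> (at z) b * h" for z h
      using linear_scale[OF has_derivative_linear[OF D\<eta>], of z h b] linear_neg[OF has_derivative_linear[OF D\<eta>], of z "h *\<^sub>R b"]
      by simp
    have "((\<lambda>t. \<eta> (y - (x + t *\<^sub>R b))) has_real_derivative
        - frechet_derivative \<eta> (at (y - (x + t *\<^sub>R b))) b) (at t)"
      unfolding has_field_derivative_def by (rule has_derivative_eq_rhs[OF A]) (simp add: B fun_eq_iff)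
    then show "((\<lambda>t. w y * \<eta> (y - (x + t *\<^sub>R b))) has_real_derivative
        w y * - frechet_derivative \<eta> (at (y - (x + t *\<^sub>R b))) b) (at t within UNIV)"
      by (rule DERIV_cmult)
  next
    fix t :: real
    show "(\<lambda>y. w y * \<eta> (y - (x + t *\<^sub>R b))) integrable_on cbox (-c) c"
      by (intro integrable_continuous continuous_intros continuous_on_subset[OF w(1)]
          continuous_on_compose2[OF c\<eta>[of UNIV]]) auto
  next
    show "continuous_on (UNIV \<times> cbox (-c) c) (\<lambda>(t, y). w y * - frechet_derivative \<eta> (at (y - (x + t *\<^sub>R b))) b)"
      unfolding split_beta
      by (intro continuous_intros continuous_on_compose2[OF w(1)] continuous_on_compose2[OF cD\<eta>[OF b, of UNIV]]) auto
  qed auto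
  have shift: "integrable lborel (\<lambda>y. \<eta> (y - x))" "(\<integral>y. \<eta> (y - x) \<partial>lborel) = 1" for x
  proof -
    show "integrable lborel (\<lambda>y. \<eta> (y - x))"
      using \<eta>(3) by (intro integrable_compact_support[OF compact_cball[of x \<delta>]] continuous_on_compose2[OF c\<eta>[of UNIV]]
          continuous_intros) (auto simp: dist_norm norm_minus_commute)
    show "(\<integral>y. \<eta> (y - x) \<partial>lborel) = 1"
      using lborel_integral_translation[OF m\<eta>, of "- x"] \<eta>(4) by simp
  qed
  have off: "\<eta> (y - x) = 0" "frechet_derivative \<eta> (at (y - x)) b = 0" if "x \<in> K" "y \<notin> K'" for x y b
  proof -
    have "norm (y - x) > \<delta>" using K'I[OF that(1), of y] that(2) \<delta>(2) by (force simp: dist_norm norm_minus_commute)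
    then show "\<eta> (y - x) = 0" "frechet_derivative \<eta> (at (y - x)) b = 0" using \<eta>(3) D\<eta>0 by auto
  qed
  have ulb: "integrable lborel (\<lambda>y. w y * \<eta> (y - x))" "u x = (\<integral>y. w y * \<eta> (y - x) \<partial>lborel)" if "x \<in> K" for x
  proof -
    show 1: "integrable lborel (\<lambda>y. w y * \<eta> (y - x))"
      using off(1)[OF that] by (intro integrable_compact_support[OF K'] continuous_on_compose2[OF c\<eta>[of UNIV]]
          continuous_intros continuous_on_subset[OF w(1)]) auto
    show "u x = (\<integral>y. w y * \<eta> (y - x) \<partial>lborel)"
      unfolding u_def using off(1)[OF that] c by (intro integral_cbox_eq_lborel 1) force
  qed
  have close: "\<bar>u x - v x\<bar> \<le> \<epsilon>" if x: "x \<in> K" for x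
  proof -
    have "u x - v x = (\<integral>y. w y * \<eta> (y - x) \<partial>lborel) - (\<integral>y. v x * \<eta> (y - x) \<partial>lborel)"
      using ulb(2)[OF x] shift(2)[of x] by simp
    also have "\<dots> = (\<integral>y. w y * \<eta> (y - x) - v x * \<eta> (y - x) \<partial>lborel)"
      using ulb(1)[OF x] shift(1)[of x] by simp
    finally have "\<bar>u x - v x\<bar> \<le> (\<integral>y. \<bar>w y * \<eta> (y - x) - v x * \<eta> (y - x)\<bar> \<partial>lborel)"
      using integral_norm_bound[of lborel "\<lambda>y. w y * \<eta> (y - x) - v x * \<eta> (y - x)"] by simp
    also have "\<dots> \<le> (\<integral>y. \<epsilon> * \<eta> (y - x) \<partial>lborel)"
    proof (intro integral_mono)
      fix y
      show "\<bar>w y * \<eta> (y - x) - v x * \<eta> (y - x)\<bar> \<le> \<epsilon> * \<eta> (y - x)"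
      proof (cases "dist y x < \<delta>")
        case True
        then have "y \<in> K'" using K'I[OF x, of y] \<delta> by (simp add: dist_commute)
        moreover have "dist (v y) (v x) < \<epsilon>" using d(2)[of x y] KK' x \<open>y \<in> K'\<close> True \<delta> by auto
        ultimately have "\<bar>w y - v x\<bar> \<le> \<epsilon>" using w(2) by (simp add: dist_real_def)
        then have "\<bar>w y - v x\<bar> * \<eta> (y - x) \<le> \<epsilon> * \<eta> (y - x)" using \<eta>(2) by (rule mult_right_mono)
        then show ?thesis using \<eta>(2)[of "y - x"] by (simp add: left_diff_distrib[symmetric] abs_mult)
      qed (use \<eta>(3)[of "y - x"] in \<open>simp add: dist_norm\<close>)
    qed (use ulb(1)[OF x] shift(1)[of x] in auto)
    also have "\<dots> = \<epsilon>" using shift(2) by simp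
    finally show ?thesis .
  qed
  define h where "h = (\<lambda>y. indicator K' y *\<^sub>R g y)"
  have h: "integrable lborel h" "integrable lborel (\<lambda>x. (norm (h x))\<^sup>2)"
    "(\<integral>x. (norm (h x))\<^sup>2 \<partial>lborel) \<le> (LINT x:\<Omega>|lborel. (norm (g x))\<^sup>2)"
    unfolding h_def using weak_gradient_sq_integrable_compact[OF g K' K'\<Omega>] .
  have mh [measurable]: "h \<in> borel_measurable borel" using h(1) by auto
  obtain M where M: "\<And>x. \<eta> x \<le> M"
  proof -
    have "bounded (\<eta> ` cball 0 \<delta>)" using compact_continuous_image[OF c\<eta> compact_cball] compact_imp_bounded by blast
    then obtain M where "\<forall>z\<in>\<eta> ` cball 0 \<delta>. norm z \<le> M" using bounded_iff by blast
    then have "\<And>x. x \<in> cball 0 \<delta> \<Longrightarrow> \<bar>\<eta> x\<bar> \<le> M" by simp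
    then have "\<eta> x \<le> max M 0" for x using \<eta>(3)[of x] by (cases "x \<in> cball 0 \<delta>") force+
    then show ?thesis using that by blast
  qed
  have key: "ennreal (\<Sum>b\<in>Basis. (D b x)\<^sup>2) \<le> (\<integral>\<^sup>+y. ennreal ((norm (h y))\<^sup>2 * \<eta> (y - x)) \<partial>lborel)" if x: "x \<in> K" for x
  proof -
    \<comment> \<open>The kernel centred at \<open>x\<close>, used as a test function; the
      redundant-looking shape matches \<open>C_k_affine\<close>.\<close>
    define \<phi> where "\<phi> y = \<eta> (1 *\<^sub>R y + - x)" for y
    have \<phi>\<eta>: "\<phi> y = \<eta> (y - x)" for y by (simp add: \<phi>_def)
    have sub: "closure {y. \<phi> y \<noteq> 0} \<subseteq> K'"
      using off(1)[OF x] by (intro closure_minimal compact_imp_closed K') (auto simp: \<phi>\<eta>)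
    have tst: "test_fun \<Omega> \<phi>"
      unfolding test_fun_def
    proof (intro conjI)
      show "smooth_fun \<phi>" unfolding smooth_fun_def \<phi>_def using C\<eta> C_k_affine by blast
      show "compact (closure {y. \<phi> y \<noteq> 0})"
        using sub K' by (meson bounded_subset closed_closure compact_eq_bounded_closed)
      show "closure {y. \<phi> y \<noteq> 0} \<subseteq> \<Omega>" using sub K'\<Omega> by blast
    qed
    have D\<phi>: "frechet_derivative \<phi> (at y) b = frechet_derivative \<eta> (at (y - x)) b" for y b
    proof -
      have "((\<lambda>y. y - x) has_derivative (\<lambda>h. h)) (at y)" by (auto intro!: derivative_eq_intros)
      from has_derivative_compose[OF this D\<eta>] have "(\<phi> has_derivative frechet_derivative \<eta> (at (y - x))) (at y)"
        by (simp add: \<phi>\<eta>[abs_def])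
      from fun_cong[OF frechet_derivative_at[OF this], of b] show ?thesis by simp
    qed
    have bnd: "(D b x)\<^sup>2 \<le> (\<integral>y. (h y \<bullet> b)\<^sup>2 * \<eta> (y - x) \<partial>lborel)" "integrable lborel (\<lambda>y. (h y \<bullet> b)\<^sup>2 * \<eta> (y - x))"
      if b: "b \<in> Basis" for b
    proof -
      have "integrable lborel (\<lambda>y. w y * - frechet_derivative \<eta> (at (y - x)) b)"
        using off(2)[OF x] by (intro integrable_compact_support[OF K'] continuous_on_compose2[OF cD\<eta>[OF b, of UNIV]]
          continuous_intros continuous_on_subset[OF w(1)]) auto
      then have "D b x = (\<integral>y. w y * - frechet_derivative \<eta> (at (y - x)) b \<partial>lborel)"
        unfolding D_def using off(2)[OF x] c by (intro integral_cbox_eq_lborel) force+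
      \<comment> \<open>On \<open>K'\<close> the extension agrees with \<open>v\<close>, and off
        \<open>K'\<close> the kernel derivative vanishes; so the defining identity of the weak
        gradient becomes applicable.\<close>
      also have "(\<lambda>y. w y * - frechet_derivative \<eta> (at (y - x)) b) = (\<lambda>y. - (v y * frechet_derivative \<phi> (at y) b))"
        using w(2) off(2)[OF x] by (intro ext) (metis D\<phi> mult_minus_right mult_zero_right)
      also have "(\<integral>y. - (v y * frechet_derivative \<phi> (at y) b) \<partial>lborel) = (\<integral>y. (g y \<bullet> b) * \<phi> y \<partial>lborel)"
        using g(1) tst b unfolding weak_gradient_def by simp
      also have "(\<lambda>y. (g y \<bullet> b) * \<phi> y) = (\<lambda>y. (h y \<bullet> b) * \<eta> (y - x))"
        using off(1)[OF x] by (intro ext) (auto simp: h_def \<phi>\<eta> indicator_def)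
      finally have Db: "D b x = (\<integral>y. (h y \<bullet> b) * \<eta> (y - x) \<partial>lborel)" .
      have i1: "integrable lborel (\<lambda>y. (h y \<bullet> b) * \<eta> (y - x))"
      proof (rule Bochner_Integration.integrable_bound[OF integrable_scaleR_right[OF h(1), of M]])
        show "(\<lambda>y. (h y \<bullet> b) * \<eta> (y - x)) \<in> borel_measurable lborel" using m\<eta> by measurable
        have "norm ((h y \<bullet> b) * \<eta> (y - x)) \<le> norm (M *\<^sub>R h y)" for y
        proof -
          have "\<bar>h y \<bullet> b\<bar> * \<eta> (y - x) \<le> norm (h y) * M"
            using b Basis_le_norm[OF b, of "h y"] M[of "y - x"] \<eta>(2)[of "y - x"] by (intro mult_mono) auto
          also have "\<dots> \<le> norm (M *\<^sub>R h y)" by (simp add: mult.commute mult_right_mono)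
          finally show ?thesis using \<eta>(2)[of "y - x"] by (simp add: abs_mult)
        qed
        then show "AE y in lborel. norm ((h y \<bullet> b) * \<eta> (y - x)) \<le> norm (M *\<^sub>R h y)" by simp
      qed
      show i2: "integrable lborel (\<lambda>y. (h y \<bullet> b)\<^sup>2 * \<eta> (y - x))"
      proof (rule Bochner_Integration.integrable_bound[OF integrable_mult_right[OF h(2), of M]])
        show "(\<lambda>y. (h y \<bullet> b)\<^sup>2 * \<eta> (y - x)) \<in> borel_measurable lborel" using m\<eta> by measurable
        have "norm ((h y \<bullet> b)\<^sup>2 * \<eta> (y - x)) \<le> norm (M * (norm (h y))\<^sup>2)" for y
        proof -
          have "(h y \<bullet> b)\<^sup>2 \<le> (norm (h y))\<^sup>2" using Basis_le_norm[OF b, of "h y"] by (metis abs_ge_zero power2_abs power_mono)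
          then have "(h y \<bullet> b)\<^sup>2 * \<eta> (y - x) \<le> (norm (h y))\<^sup>2 * M"
            using M[of "y - x"] \<eta>(2)[of "y - x"] by (intro mult_mono) auto
          then show ?thesis using \<eta>(2)[of "y - x"] order_trans[OF \<eta>(2)[of 0] M[of 0]] by (simp add: abs_mult mult.commute)
        qed
        then show "AE y in lborel. norm ((h y \<bullet> b)\<^sup>2 * \<eta> (y - x)) \<le> norm (M * (norm (h y))\<^sup>2)" by simp
      qed
      \<comment> \<open>Jensen for the probability density given by the kernel centred at
        \<open>x\<close>.\<close>
      show "(D b x)\<^sup>2 \<le> (\<integral>y. (h y \<bullet> b)\<^sup>2 * \<eta> (y - x) \<partial>lborel)"
        unfolding Db by (intro square_integral_le_weighted shift i1 i2 \<eta>(2))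
    qed
    have "(\<Sum>b\<in>Basis. (D b x)\<^sup>2) \<le> (\<Sum>b\<in>Basis. \<integral>y. (h y \<bullet> b)\<^sup>2 * \<eta> (y - x) \<partial>lborel)"
      using bnd(1) by (intro sum_mono)
    also have "\<dots> = (\<integral>y. (\<Sum>b\<in>Basis. (h y \<bullet> b)\<^sup>2 * \<eta> (y - x)) \<partial>lborel)"
      using bnd(2) by (intro Bochner_Integration.integral_sum[symmetric])
    also have "(\<lambda>y. \<Sum>b\<in>Basis. (h y \<bullet> b)\<^sup>2 * \<eta> (y - x)) = (\<lambda>y. (norm (h y))\<^sup>2 * \<eta> (y - x))"
      by (simp add: sum_distrib_right[symmetric] norm_sq_eq_sum_Basis)
    finally have le: "(\<Sum>b\<in>Basis. (D b x)\<^sup>2) \<le> (\<integral>y. (norm (h y))\<^sup>2 * \<eta> (y - x) \<partial>lborel)" .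
    have "integrable lborel (\<lambda>y. \<Sum>b\<in>Basis. (h y \<bullet> b)\<^sup>2 * \<eta> (y - x))" using bnd(2) by (intro Bochner_Integration.integrable_sum)
    then have "integrable lborel (\<lambda>y. (norm (h y))\<^sup>2 * \<eta> (y - x))"
      by (simp add: sum_distrib_right[symmetric] norm_sq_eq_sum_Basis)
    then have "(\<integral>\<^sup>+y. ennreal ((norm (h y))\<^sup>2 * \<eta> (y - x)) \<partial>lborel) = ennreal (\<integral>y. (norm (h y))\<^sup>2 * \<eta> (y - x) \<partial>lborel)"
      using \<eta>(2) by (intro nn_integral_eq_integral) auto
    then show ?thesis using le by (simp add: ennreal_leI)
  qed
  have ineq: "(\<integral>\<^sup>+x\<in>K. ennreal (\<Sum>b\<in>Basis. (D b x)\<^sup>2) \<partial>lborel) \<le> (\<integral>\<^sup>+x. (\<integral>\<^sup>+y. ennreal ((norm (h y))\<^sup>2 * \<eta> (y - x)) \<partial>lborel) \<partial>lborel)"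
    using key by (intro nn_integral_mono) (auto simp: indicator_def)
  have m2 [measurable]: "(\<lambda>p. \<eta> (snd p - fst p)) \<in> borel_measurable (borel \<Otimes>\<^sub>M borel)"
    unfolding borel_prod by (intro borel_measurable_continuous_onI continuous_on_compose2[OF c\<eta>[of UNIV]] continuous_intros) auto
  note ineq
  also have "(\<integral>\<^sup>+x. (\<integral>\<^sup>+y. ennreal ((norm (h y))\<^sup>2 * \<eta> (y - x)) \<partial>lborel) \<partial>lborel) = (\<integral>\<^sup>+y. (\<integral>\<^sup>+x. ennreal ((norm (h y))\<^sup>2 * \<eta> (y - x)) \<partial>lborel) \<partial>lborel)"
    using m\<eta> by (intro lborel_pair.Fubini'[symmetric]) measurable
  also have "\<dots> = (\<integral>\<^sup>+y. ennreal ((norm (h y))\<^sup>2) \<partial>lborel)"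
  proof (intro nn_integral_cong)
    fix y
    \<comment> \<open>After Tonelli, evenness turns the integral over centres into the total mass of
      the kernel centred at \<open>y\<close>.\<close>
    have e: "\<eta> (y - x) = \<eta> (x - y)" for x using \<eta>(5)[of "x - y"] by simp
    have "(\<integral>\<^sup>+x. ennreal (\<eta> (x - y)) \<partial>lborel) = 1"
      using nn_integral_eq_integral[OF shift(1)[of y]] shift(2)[of y] \<eta>(2) by simp
    then show "(\<integral>\<^sup>+x. ennreal ((norm (h y))\<^sup>2 * \<eta> (y - x)) \<partial>lborel) = ennreal ((norm (h y))\<^sup>2)"
      unfolding e using m\<eta> \<eta>(2) by (simp add: ennreal_mult nn_integral_cmult)
  qed
  also have "\<dots> = ennreal (\<integral>y. (norm (h y))\<^sup>2 \<partial>lborel)" using h(2) by (intro nn_integral_eq_integral) auto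
  also have "\<dots> \<le> ennreal (LINT x:\<Omega>|lborel. (norm (g x))\<^sup>2)" using h(3) by (rule ennreal_leI)
  finally show ?thesis using contD derivu close by (intro exI[of _ u] exI[of _ D]) blast
qed

subsection \<open>Oscillation on squares\<close>

text \<open>Cartesian coordinates: Tonelli is stated for pairs of reals, whereas the functions here
  live on \<open>real^2\<close>.\<close>

definition pt :: "real \<Rightarrow> real \<Rightarrow> real^2" where
  "pt s t = s *\<^sub>R axis 1 1 + t *\<^sub>R axis 2 1"

lemma pt_nth [simp]: "pt s t $ 1 = s" "pt s t $ 2 = t"
  by (simp_all add: pt_def axis_def)

lemma pt_nth_eq [simp]: "pt (p $ 1) (p $ 2) = p"
  by (simp add: vec_eq_iff forall_2)

lemma Basis_real2: "(Basis :: (real^2) set) = {axis 1 1, axis 2 1}"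
  by (auto simp: Basis_vec_def UNIV_2)

lemma axis_1_neq_2: "axis 1 1 \<noteq> (axis 2 1 :: real^2)"
  by (simp add: axis_eq_axis)

lemma continuous_on_pt: "continuous_on S f \<Longrightarrow> continuous_on S g \<Longrightarrow> continuous_on S (\<lambda>x. pt (f x) (g x))"
  unfolding pt_def by (intro continuous_intros)

lemma measurable_pt [measurable]: "(\<lambda>p. pt (fst p) (snd p)) \<in> borel_measurable (borel \<Otimes>\<^sub>M borel)"
  unfolding borel_prod by (intro borel_measurable_continuous_onI continuous_on_pt continuous_intros)

text \<open>Lebesgue measure is determined by its values on boxes, which are products of side
  lengths on both sides.\<close>

lemma lborel_real2: "(lborel :: (real^2) measure) = distr (lborel \<Otimes>\<^sub>M lborel) borel (\<lambda>p. pt (fst p) (snd p))"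
proof (rule lborel_eqI)
  fix l u :: "real^2"
  assume le: "\<And>b. b \<in> Basis \<Longrightarrow> l \<bullet> b \<le> u \<bullet> b"
  have le': "l $ 1 \<le> u $ 1" "l $ 2 \<le> u $ 2"
    using le[of "axis 1 1"] le[of "axis 2 1"] by (auto simp: Basis_real2 inner_axis)
  have m: "(\<lambda>p. pt (fst p) (snd p)) \<in> measurable (lborel \<Otimes>\<^sub>M lborel) borel"
    using measurable_pt by simp
  have vi: "(\<lambda>p. pt (fst p) (snd p)) -` box l u \<inter> space (lborel \<Otimes>\<^sub>M lborel) = {l $ 1<..<u $ 1} \<times> {l $ 2<..<u $ 2}"
    by (auto simp: mem_box_cart forall_2 space_pair_measure)
  have "emeasure (distr (lborel \<Otimes>\<^sub>M lborel) borel (\<lambda>p. pt (fst p) (snd p))) (box l u)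
      = emeasure (lborel \<Otimes>\<^sub>M lborel) ({l $ 1<..<u $ 1} \<times> {l $ 2<..<u $ 2})"
    by (subst emeasure_distr[OF m]) (auto simp: vi)
  also have "\<dots> = ennreal (u $ 1 - l $ 1) * ennreal (u $ 2 - l $ 2)"
    using le' by (subst lborel.emeasure_pair_measure_Times) auto
  also have "\<dots> = ennreal (\<Prod>b\<in>Basis. (u - l) \<bullet> b)"
    using le' axis_1_neq_2 by (simp add: Basis_real2 inner_axis ennreal_mult)
  finally show "emeasure (distr (lborel \<Otimes>\<^sub>M lborel) borel (\<lambda>p. pt (fst p) (snd p))) (box l u)
      = ennreal (\<Prod>b\<in>Basis. (u - l) \<bullet> b)" .
qed simp

lemma nn_integral_real2:
  fixes f :: "real^2 \<Rightarrow> ennreal"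
  assumes [measurable]: "f \<in> borel_measurable borel"
  shows "(\<integral>\<^sup>+x. f x \<partial>lborel) = (\<integral>\<^sup>+s. \<integral>\<^sup>+t. f (pt s t) \<partial>lborel \<partial>lborel)"
proof -
  have m: "(\<lambda>p. pt (fst p) (snd p)) \<in> measurable (lborel \<Otimes>\<^sub>M lborel) borel"
    using measurable_pt by simp
  have "(\<integral>\<^sup>+x. f x \<partial>lborel) = (\<integral>\<^sup>+p. f (pt (fst p) (snd p)) \<partial>(lborel \<Otimes>\<^sub>M lborel))"
    by (subst lborel_real2, subst nn_integral_distr[OF m]) auto
  also have "\<dots> = (\<integral>\<^sup>+s. \<integral>\<^sup>+t. f (pt s t) \<partial>lborel \<partial>lborel)"
    using measurable_compose[OF m assms] by (subst lborel.nn_integral_fst[symmetric]) auto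
  finally show ?thesis .
qed

text \<open>Fundamental theorem of calculus, then Jensen with the uniform density on the interval
  between \<open>a\<close> and \<open>b\<close>. Length and energy are enlarged to the full interval
  so that the bound is the same for all pairs of points.\<close>

lemma sq_increment_le_energy:
  fixes f f' :: "real \<Rightarrow> real"
  assumes f: "\<And>t. (f has_real_derivative f' t) (at t)" and c: "continuous_on UNIV f'"
    and ab: "a \<in> {\<alpha>..\<beta>}" "b \<in> {\<alpha>..\<beta>}"
  shows "ennreal ((f b - f a)\<^sup>2) \<le> ennreal (\<beta> - \<alpha>) * (\<integral>\<^sup>+t\<in>{\<alpha>..\<beta>}. ennreal ((f' t)\<^sup>2) \<partial>lborel)"
  using ab
proof (induction a b rule: linorder_wlog)
  case (sym a b)
  then show ?case by (simp add: power2_commute)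
next
  case (le a b)
  show ?case
  proof (cases "a = b")
    case False
    then have ab: "a < b" using le by simp
    let ?L = "b - a" and ?w = "\<lambda>t. indicator {a..b} t * (1 / (b - a))"
    have cs: "continuous_on S f'" for S using c continuous_on_subset by blast
    have i0: "integrable lborel (indicator {a..b} :: real \<Rightarrow> real)" using le by (intro integrable_real_indicator) auto
    have i1: "integrable lborel (\<lambda>t. indicator {a..b} t *\<^sub>R f' t)" by (intro borel_integrable_compact cs) auto
    have i2: "integrable lborel (\<lambda>t. indicator {a..b} t *\<^sub>R (f' t)\<^sup>2)"
      by (intro borel_integrable_compact continuous_intros cs) auto
    have ftc: "(\<integral>t. indicator {a..b} t *\<^sub>R f' t \<partial>lborel) = f b - f a"
      using f ab by (intro integral_FTC_atLeastAtMost cs)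
        (auto simp: has_real_derivative_iff_has_vector_derivative intro: has_vector_derivative_at_within)
    have "(\<integral>t. f' t * ?w t \<partial>lborel)\<^sup>2 \<le> (\<integral>t. (f' t)\<^sup>2 * ?w t \<partial>lborel)"
    proof (rule square_integral_le_weighted)
      show "integrable lborel ?w" using i0 by simp
      show "(\<integral>t. ?w t \<partial>lborel) = 1" using ab by simp
      show "0 \<le> ?w t" for t using ab by simp
      show "integrable lborel (\<lambda>t. f' t * ?w t)" using integrable_mult_left[OF i1, of "1 / ?L"] by (simp add: mult_ac)
      show "integrable lborel (\<lambda>t. (f' t)\<^sup>2 * ?w t)" using integrable_mult_left[OF i2, of "1 / ?L"] by (simp add: mult_ac)
    qed
    moreover have "(\<integral>t. f' t * ?w t \<partial>lborel) = (f b - f a) * (1 / ?L)"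
      using ftc integral_mult_left_zero[of lborel "\<lambda>t. indicator {a..b} t *\<^sub>R f' t" "1 / ?L"] by (simp add: mult_ac)
    moreover have "(\<integral>t. (f' t)\<^sup>2 * ?w t \<partial>lborel) = (\<integral>t. indicator {a..b} t *\<^sub>R (f' t)\<^sup>2 \<partial>lborel) * (1 / ?L)"
      using integral_mult_left_zero[of lborel "\<lambda>t. indicator {a..b} t *\<^sub>R (f' t)\<^sup>2" "1 / ?L"] by (simp add: mult_ac)
    ultimately have "((f b - f a) / ?L)\<^sup>2 \<le> (\<integral>t. indicator {a..b} t *\<^sub>R (f' t)\<^sup>2 \<partial>lborel) / ?L"
      by (simp only: mult_1_right times_divide_eq_right)
    then have "((f b - f a) / ?L)\<^sup>2 * ?L\<^sup>2 \<le> (\<integral>t. indicator {a..b} t *\<^sub>R (f' t)\<^sup>2 \<partial>lborel) / ?L * ?L\<^sup>2"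
      by (rule mult_right_mono) simp
    then have "(f b - f a)\<^sup>2 \<le> ?L * (\<integral>t. indicator {a..b} t *\<^sub>R (f' t)\<^sup>2 \<partial>lborel)"
      using ab by (simp add: power_divide power2_eq_square mult.commute)
    then have "ennreal ((f b - f a)\<^sup>2) \<le> ennreal ?L * ennreal (\<integral>t. indicator {a..b} t *\<^sub>R (f' t)\<^sup>2 \<partial>lborel)"
      using ab by (simp add: ennreal_mult'[symmetric] ennreal_leI)
    also have "ennreal (\<integral>t. indicator {a..b} t *\<^sub>R (f' t)\<^sup>2 \<partial>lborel) = (\<integral>\<^sup>+t. ennreal (indicator {a..b} t *\<^sub>R (f' t)\<^sup>2) \<partial>lborel)"
      using i2 by (intro nn_integral_eq_integral[symmetric]) auto
    also have "\<dots> \<le> (\<integral>\<^sup>+t\<in>{\<alpha>..\<beta>}. ennreal ((f' t)\<^sup>2) \<partial>lborel)"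
      using le by (intro nn_integral_mono) (auto simp: indicator_def)
    also have "ennreal ?L \<le> ennreal (\<beta> - \<alpha>)" using le by (intro ennreal_leI) auto
    finally show ?thesis by (simp add: mult_left_mono mult_right_mono)
  qed simp
qed

text \<open>The mean of \<open>W\<close> is at most \<open>e / (b - a)\<close>. The factor 2 leaves
  room for a contradiction from weak inequalities: exceeding the bound everywhere would give an
  integral of at least \<open>2 * e\<close>.\<close>

lemma good_point:
  fixes W :: "real \<Rightarrow> ennreal"
  assumes [measurable]: "W \<in> borel_measurable borel" and ab: "a < b" and "e > 0"
    and W: "(\<integral>\<^sup>+s\<in>{a..b}. W s \<partial>lborel) \<le> ennreal e"
  shows "\<exists>s\<in>{a..b}. W s \<le> ennreal (2 * e / (b - a))"
proof (rule ccontr)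
  assume "\<not> ?thesis"
  then have "(\<integral>\<^sup>+s\<in>{a..b}. ennreal (2 * e / (b - a)) \<partial>lborel) \<le> (\<integral>\<^sup>+s\<in>{a..b}. W s \<partial>lborel)"
    by (intro nn_integral_mono) (auto simp: indicator_def not_le intro: less_imp_le)
  moreover have "(\<integral>\<^sup>+s\<in>{a..b}. ennreal (2 * e / (b - a)) \<partial>lborel) = ennreal (2 * e / (b - a)) * ennreal (b - a)"
    using ab by (subst nn_integral_cmult_indicator) auto
  also have "\<dots> = ennreal (2 * e)" using ab \<open>e > 0\<close> by (simp add: ennreal_mult'[symmetric])
  ultimately have "ennreal (2 * e) \<le> ennreal e" using W by (metis order_trans)
  then show False using \<open>e > 0\<close> by simp
qed

text \<open>Stated in extended reals so that line energies can be inserted without first showing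
  that they are finite.\<close>

lemma ennreal_sq_add_le:
  assumes "ennreal (x\<^sup>2) \<le> A" "ennreal (y\<^sup>2) \<le> B"
  shows "ennreal ((x + y)\<^sup>2) \<le> 2 * A + 2 * B"
proof -
  have "(x + y)\<^sup>2 \<le> 2 * x\<^sup>2 + 2 * y\<^sup>2" using sum_squares_bound[of x y] by (simp add: power2_sum)
  then have "ennreal ((x + y)\<^sup>2) \<le> 2 * ennreal (x\<^sup>2) + 2 * ennreal (y\<^sup>2)"
    by (simp add: ennreal_plus[symmetric] ennreal_mult'[symmetric] ennreal_leI ennreal_numeral[symmetric]
        del: ennreal_plus ennreal_numeral)
  also have "\<dots> \<le> 2 * A + 2 * B" using assms by (intro add_mono mult_left_mono) auto
  finally show ?thesis .
qed

text \<open>Compare \<open>U s t\<close> with the value \<open>c\<close> at the crossing of one good vertical and one good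
  horizontal line: first move along the line through the point, then along the good line.\<close>

lemma rectangle_oscillation:
  fixes U A B :: "real \<Rightarrow> real \<Rightarrow> real"
  assumes r: "r > 0" and e: "e > 0"
    and dA: "\<And>s t. ((\<lambda>s. U s t) has_real_derivative A s t) (at s)"
    and dB: "\<And>s t. ((\<lambda>t. U s t) has_real_derivative B s t) (at t)"
    and cA: "continuous_on UNIV (\<lambda>p. A (fst p) (snd p))" and cB: "continuous_on UNIV (\<lambda>p. B (fst p) (snd p))"
    and en: "(\<integral>\<^sup>+s\<in>{\<alpha>-r..\<alpha>+r}. (\<integral>\<^sup>+t\<in>{\<beta>-r..\<beta>+r}. ennreal ((A s t)\<^sup>2 + (B s t)\<^sup>2) \<partial>lborel) \<partial>lborel) \<le> ennreal e"
  shows "\<exists>c W H. W \<in> borel_measurable borel \<and> H \<in> borel_measurable borel \<and>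
    (\<integral>\<^sup>+s\<in>{\<alpha>-r..\<alpha>+r}. W s \<partial>lborel) \<le> ennreal e \<and> (\<integral>\<^sup>+t\<in>{\<beta>-r..\<beta>+r}. H t \<partial>lborel) \<le> ennreal e \<and>
    (\<forall>s\<in>{\<alpha>-r..\<alpha>+r}. \<forall>t\<in>{\<beta>-r..\<beta>+r}. ennreal ((U s t - c)\<^sup>2) \<le> ennreal (4 * r) * W s + ennreal (4 * e) \<and>
      ennreal ((U s t - c)\<^sup>2) \<le> ennreal (4 * r) * H t + ennreal (4 * e))"
proof -
  let ?S = "{\<alpha>-r..\<alpha>+r}" and ?T = "{\<beta>-r..\<beta>+r}"
  have mA [measurable]: "(\<lambda>p. A (fst p) (snd p)) \<in> borel_measurable (borel \<Otimes>\<^sub>M borel)"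
    unfolding borel_prod using cA by (rule borel_measurable_continuous_onI)
  have mB [measurable]: "(\<lambda>p. B (fst p) (snd p)) \<in> borel_measurable (borel \<Otimes>\<^sub>M borel)"
    unfolding borel_prod using cB by (rule borel_measurable_continuous_onI)
  have mAi [measurable]: "(\<lambda>(s, t). ennreal ((A s t)\<^sup>2) * indicator ?S s) \<in> borel_measurable (borel \<Otimes>\<^sub>M borel)"
    unfolding split_beta by measurable
  have mBi [measurable]: "(\<lambda>(s, t). ennreal ((B s t)\<^sup>2) * indicator ?T t) \<in> borel_measurable (borel \<Otimes>\<^sub>M borel)"
    unfolding split_beta by measurable
  \<comment> \<open>\<open>W\<close> is the energy of the vertical derivative along a vertical line,
    \<open>H\<close> that of the horizontal derivative along a horizontal line.\<close>
  define W where "W s = (\<integral>\<^sup>+t\<in>?T. ennreal ((B s t)\<^sup>2) \<partial>lborel)" for s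
  define H where "H t = (\<integral>\<^sup>+s\<in>?S. ennreal ((A s t)\<^sup>2) \<partial>lborel)" for t
  have mW [measurable]: "W \<in> borel_measurable borel"
    unfolding W_def using lborel.borel_measurable_nn_integral[of "\<lambda>s t. ennreal ((B s t)\<^sup>2) * indicator ?T t" borel] mBi
    by simp
  have mH [measurable]: "H \<in> borel_measurable borel"
  proof -
    have "(\<lambda>(t, s). ennreal ((A s t)\<^sup>2) * indicator ?S s) \<in> borel_measurable (borel \<Otimes>\<^sub>M borel)"
      using measurable_pair_swap[OF mAi] by (simp add: split_beta)
    then show ?thesis
      unfolding H_def using lborel.borel_measurable_nn_integral[of "\<lambda>t s. ennreal ((A s t)\<^sup>2) * indicator ?S s" borel] by simp
  qed
  have iW: "(\<integral>\<^sup>+s\<in>?S. W s \<partial>lborel) \<le> ennreal e"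
  proof (rule order_trans[OF _ en])
    show "(\<integral>\<^sup>+s\<in>?S. W s \<partial>lborel) \<le> (\<integral>\<^sup>+s\<in>?S. (\<integral>\<^sup>+t\<in>?T. ennreal ((A s t)\<^sup>2 + (B s t)\<^sup>2) \<partial>lborel) \<partial>lborel)"
      unfolding W_def by (intro nn_integral_mono mult_right_mono ennreal_leI) auto
  qed
  \<comment> \<open>The energy is given with \<open>t\<close> as inner variable; the horizontal
    lines need the other order of integration.\<close>
  have iH: "(\<integral>\<^sup>+t\<in>?T. H t \<partial>lborel) \<le> ennreal e"
  proof -
    have "(\<integral>\<^sup>+t\<in>?T. H t \<partial>lborel) = (\<integral>\<^sup>+t. (\<integral>\<^sup>+s. ennreal ((A s t)\<^sup>2) * indicator ?S s * indicator ?T t \<partial>lborel) \<partial>lborel)"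
      unfolding H_def by (intro nn_integral_cong nn_integral_multc[symmetric]) (auto intro: measurable_Pair2[OF mAi, simplified] measurable_compose_Pair1 simp: split_beta)
    also have "\<dots> = (\<integral>\<^sup>+s. (\<integral>\<^sup>+t. ennreal ((A s t)\<^sup>2) * indicator ?S s * indicator ?T t \<partial>lborel) \<partial>lborel)"
      by (rule lborel_pair.Fubini') (unfold split_beta, measurable)
    also have "\<dots> \<le> (\<integral>\<^sup>+s\<in>?S. (\<integral>\<^sup>+t\<in>?T. ennreal ((A s t)\<^sup>2 + (B s t)\<^sup>2) \<partial>lborel) \<partial>lborel)"
    proof (intro nn_integral_mono)
      fix s
      show "(\<integral>\<^sup>+t. ennreal ((A s t)\<^sup>2) * indicator ?S s * indicator ?T t \<partial>lborel)
          \<le> (\<integral>\<^sup>+t\<in>?T. ennreal ((A s t)\<^sup>2 + (B s t)\<^sup>2) \<partial>lborel) * indicator ?S s"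
        by (cases "s \<in> ?S") (auto intro!: nn_integral_mono mult_right_mono ennreal_leI)
    qed
    also have "\<dots> \<le> ennreal e" by (rule en)
    finally show ?thesis .
  qed
  have len: "a - r < a + r" "a + r - (a - r) = 2 * r" for a using r by auto
  \<comment> \<open>One vertical and one horizontal line of energy at most \<open>e / r\<close>; the
    value at their crossing will be the constant.\<close>
  obtain s0 where s0: "s0 \<in> ?S" "W s0 \<le> ennreal (2 * e / (2 * r))"
    using good_point[OF mW len(1) e iW, unfolded len(2)] by blast
  obtain t0 where t0: "t0 \<in> ?T" "H t0 \<le> ennreal (2 * e / (2 * r))"
    using good_point[OF mH len(1) e iH, unfolded len(2)] by blast
  have cAt: "continuous_on UNIV (\<lambda>s. A s t)" for t
    by (rule continuous_on_compose2[OF cA, of _ "\<lambda>s. (s, t)", simplified]) (intro continuous_intros)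
  have cBs: "continuous_on UNIV (\<lambda>t. B s t)" for s
    by (rule continuous_on_compose2[OF cB, of _ "\<lambda>t. (s, t)", simplified]) (intro continuous_intros)
  have vert: "ennreal ((U s t - U s t')\<^sup>2) \<le> ennreal (2 * r) * W s" if "t \<in> ?T" "t' \<in> ?T" for s t t'
    using sq_increment_le_energy[OF dB cBs that(2,1)] by (simp add: W_def)
  have hori: "ennreal ((U s t - U s' t)\<^sup>2) \<le> ennreal (2 * r) * H t" if "s \<in> ?S" "s' \<in> ?S" for s s' t
    using sq_increment_le_energy[OF dA cAt that(2,1)] by (simp add: H_def)
  have r2: "ennreal (2 * r) * X \<le> ennreal (2 * e)" if "X \<le> ennreal (2 * e / (2 * r))" for X
  proof -
    have "ennreal (2 * r) * X \<le> ennreal (2 * r) * ennreal (2 * e / (2 * r))" using that by (rule mult_left_mono) simp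
    also have "\<dots> = ennreal (2 * e)" using r e by (subst ennreal_mult'[symmetric]) auto
    finally show ?thesis .
  qed
  have dbl: "2 * (ennreal (2 * r) * X) + 2 * ennreal (2 * e) = ennreal (4 * r) * X + ennreal (4 * e)" for X
  proof -
    have "2 * (ennreal (2 * r) * X) = ennreal (4 * r) * X" "2 * ennreal (2 * e) = ennreal (4 * e)"
      using r e by (simp_all add: ennreal_mult' mult.assoc[symmetric])
    then show ?thesis by simp
  qed
  \<comment> \<open>Via \<open>(s, t0)\<close>: the vertical move costs \<open>2 * r * W s\<close>,
    the horizontal move on the good line costs \<open>2 * e\<close>, and squaring the sum doubles
    both.\<close>
  have "ennreal ((U s t - U s0 t0)\<^sup>2) \<le> ennreal (4 * r) * W s + ennreal (4 * e)" if "s \<in> ?S" "t \<in> ?T" for s t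
    using ennreal_sq_add_le[OF vert[OF that(2) t0(1), of s] order_trans[OF hori[OF that(1) s0(1), of t0] r2[OF t0(2)]]]
    by (simp add: dbl)
  \<comment> \<open>Via \<open>(s0, t)\<close> instead, so that the varying energy is the one of the
    horizontal line through the point.\<close>
  moreover have "ennreal ((U s t - U s0 t0)\<^sup>2) \<le> ennreal (4 * r) * H t + ennreal (4 * e)" if "s \<in> ?S" "t \<in> ?T" for s t
    using ennreal_sq_add_le[OF hori[OF that(1) s0(1), of t] order_trans[OF vert[OF that(2) t0(1), of s0] r2[OF s0(2)]]]
    by (simp add: dbl)
  ultimately show ?thesis using mW mH iW iH by (intro exI[of _ "U s0 t0"] exI[of _ W] exI[of _ H]) blast
qed


text \<open>Sup-norm distance. Its spheres are square boundaries, made of four segments on which the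
  vertical and horizontal line energies apply.\<close>

definition supd :: "real^2 \<Rightarrow> real^2 \<Rightarrow> real" where
  "supd x p = max \<bar>p $ 1 - x $ 1\<bar> \<bar>p $ 2 - x $ 2\<bar>"

definition square :: "real^2 \<Rightarrow> real \<Rightarrow> (real^2) set" where
  "square x r = {p. supd x p \<le> r}"

lemma square_iff: "p \<in> square x r \<longleftrightarrow> p $ 1 \<in> {x $ 1 - r..x $ 1 + r} \<and> p $ 2 \<in> {x $ 2 - r..x $ 2 + r}"
  unfolding square_def supd_def by auto

lemma square_eq_cbox: "square x r = cbox (x - vec r) (x + vec r)"
  by (auto simp: square_iff mem_box_cart forall_2)

lemma continuous_on_supd: "continuous_on S (supd x)"
  unfolding supd_def by (intro continuous_intros)

lemma compact_square: "compact (square x r)"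
  by (simp add: square_eq_cbox compact_cbox)

lemma square_subset_open:
  assumes "open U" "x \<in> U" "R > 0"
  obtains r where "0 < r" "r \<le> R" "square x r \<subseteq> U"
proof -
  obtain d where d: "d > 0" "ball x d \<subseteq> U" using assms open_contains_ball by blast
  \<comment> \<open>Coordinate differences of at most \<open>d / 3\<close> give Euclidean distance
    at most \<open>2 * d / 3 < d\<close>.\<close>
  define r where "r = min R (d / 3)"
  have "square x r \<subseteq> ball x d"
  proof
    fix p assume "p \<in> square x r"
    then have "supd x p \<le> d / 3" by (simp add: square_def r_def)
    then have "\<bar>p $ 1 - x $ 1\<bar> \<le> d / 3" "\<bar>p $ 2 - x $ 2\<bar> \<le> d / 3"
      by (simp_all only: supd_def max.bounded_iff)
    moreover have "norm (p - x) \<le> \<bar>(p - x) $ 1\<bar> + \<bar>(p - x) $ 2\<bar>"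
      using norm_le_l1_cart[of "p - x"] by (simp add: sum_2)
    ultimately show "p \<in> ball x d" using d(1) by (simp add: dist_norm norm_minus_commute)
  qed
  then show thesis using that[of r] assms d by (auto simp: r_def)
qed

lemma ball_subset_square: "ball x r \<subseteq> square x r"
proof
  fix p assume "p \<in> ball x r"
  then have "norm (p - x) \<le> r" by (simp add: dist_norm norm_minus_commute)
  then show "p \<in> square x r"
    using component_le_norm_cart[of "p - x" 1] component_le_norm_cart[of "p - x" 2]
    by (auto simp: square_def supd_def)
qed

text \<open>The part of admissibility that ignores the two sets, so that one set of estimates serves
  the competitors of both capacities.\<close>

definition energy_le :: "(real^2) set \<Rightarrow> (real^2 \<Rightarrow> real) \<Rightarrow> (real^2 \<Rightarrow> real^2) \<Rightarrow> real \<Rightarrow> bool" where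
  "energy_le \<Omega> v g e \<longleftrightarrow> continuous_on \<Omega> v \<and> weak_gradient \<Omega> v g \<and>
     set_integrable lborel \<Omega> (\<lambda>x. (norm (g x))\<^sup>2) \<and> (LINT x:\<Omega>|lborel. (norm (g x))\<^sup>2) \<le> e"

text \<open>The substitution is a translation or a reflection: it preserves length and sends
  \<open>{0..r}\<close> onto one half of the interval.\<close>

lemma nn_integral_reflect_le:
  fixes W :: "real \<Rightarrow> ennreal"
  assumes [measurable]: "W \<in> borel_measurable borel" and c: "\<bar>c\<bar> = 1"
  shows "(\<integral>\<^sup>+\<rho>\<in>{0..r}. W (\<alpha> + c * \<rho>) \<partial>lborel) \<le> (\<integral>\<^sup>+s\<in>{\<alpha>-r..\<alpha>+r}. W s \<partial>lborel)"
proof -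
  have "(\<integral>\<^sup>+s\<in>{\<alpha>-r..\<alpha>+r}. W s \<partial>lborel) = \<bar>c\<bar> * (\<integral>\<^sup>+\<rho>. W (\<alpha> + c * \<rho>) * indicator {\<alpha>-r..\<alpha>+r} (\<alpha> + c * \<rho>) \<partial>lborel)"
    using c by (intro nn_integral_real_affine[of "\<lambda>s. W s * indicator {\<alpha>-r..\<alpha>+r} s" c \<alpha>]) auto
  also have "\<dots> \<ge> (\<integral>\<^sup>+\<rho>\<in>{0..r}. W (\<alpha> + c * \<rho>) \<partial>lborel)"
    unfolding c ennreal_1 mult_1_left
  proof (intro nn_integral_mono mult_left_mono)
    fix \<rho>
    have "c = 1 \<or> c = -1" using c by auto
    then show "indicator {0..r} \<rho> \<le> (indicator {\<alpha>-r..\<alpha>+r} (\<alpha> + c * \<rho>) :: ennreal)"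
      by (auto simp: indicator_def)
  qed simp
  finally show ?thesis .
qed

text \<open>The oscillation estimate for a mollification, transferred back to \<open>v\<close>.
  \<open>Z \<rho>\<close> adds the energies of the four lines carrying the sides of the square of
  radius \<open>\<rho>\<close>, so a single good \<open>\<rho>\<close> controls \<open>v\<close> on
  that entire boundary.\<close>

lemma square_estimate:
  assumes \<Omega>: "open \<Omega>" and r: "r > 0" and Q: "square x r \<subseteq> \<Omega>" and v: "energy_le \<Omega> v g e" and e: "e > 0"
  shows "\<exists>c Z. Z \<in> borel_measurable borel \<and> (\<integral>\<^sup>+\<rho>\<in>{0..r}. Z \<rho> \<partial>lborel) \<le> ennreal (4 * e) \<and>
    (\<forall>p\<in>square x r. ennreal ((v p - c)\<^sup>2) \<le> ennreal (8 * r) * Z (supd x p) + ennreal (10 * e)) \<and>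
    (\<integral>\<^sup>+p\<in>square x r. ennreal ((v p - c)\<^sup>2) \<partial>lborel) \<le> ennreal (56 * r\<^sup>2 * e)"
proof -
  let ?\<alpha> = "x $ 1" and ?\<beta> = "x $ 2"
  let ?S = "{?\<alpha>-r..?\<alpha>+r}" and ?T = "{?\<beta>-r..?\<beta>+r}"
  have v': "continuous_on \<Omega> v" "weak_gradient \<Omega> v g" "set_integrable lborel \<Omega> (\<lambda>x. (norm (g x))\<^sup>2)"
    "(LINT x:\<Omega>|lborel. (norm (g x))\<^sup>2) \<le> e" using v by (auto simp: energy_le_def)
  \<comment> \<open>The mollification error is chosen as \<open>sqrt e\<close>, so that its square
    has the order of the energy.\<close>
  have sqe: "sqrt e > 0" using e by simp
  obtain u D where D: "\<forall>b\<in>Basis. continuous_on UNIV (D b)"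
      "\<forall>b\<in>Basis. \<forall>x t. ((\<lambda>t. u (x + t *\<^sub>R b)) has_real_derivative D b (x + t *\<^sub>R b)) (at t)"
      "\<forall>p\<in>square x r. \<bar>u p - v p\<bar> \<le> sqrt e"
      "(\<integral>\<^sup>+p\<in>square x r. ennreal (\<Sum>b\<in>Basis. (D b p)\<^sup>2) \<partial>lborel) \<le> ennreal (LINT x:\<Omega>|lborel. (norm (g x))\<^sup>2)"
    using mollification[OF \<Omega> compact_square Q v'(1-3) sqe] by blast
  let ?A = "\<lambda>s t. D (axis 1 1) (pt s t)" and ?B = "\<lambda>s t. D (axis 2 1) (pt s t)"
  have cD: "continuous_on UNIV (D (axis 1 1))" "continuous_on UNIV (D (axis 2 1))" using D(1) by (auto simp: Basis_real2)
  have [measurable]: "D (axis 1 1) \<in> borel_measurable borel" "D (axis 2 1) \<in> borel_measurable borel"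
    using cD by (auto intro: borel_measurable_continuous_onI)
  have [measurable]: "square x r \<in> sets borel" using compact_imp_closed[OF compact_square] by (rule borel_closed)
  have ind: "indicator (square x r) (pt s t) = (indicator ?S s * indicator ?T t :: ennreal)" for s t
    by (auto simp: indicator_def square_iff)
  have "(\<integral>\<^sup>+s\<in>?S. (\<integral>\<^sup>+t\<in>?T. ennreal ((?A s t)\<^sup>2 + (?B s t)\<^sup>2) \<partial>lborel) \<partial>lborel)
      = (\<integral>\<^sup>+s. (\<integral>\<^sup>+t. ennreal ((?A s t)\<^sup>2 + (?B s t)\<^sup>2) * indicator (square x r) (pt s t) \<partial>lborel) \<partial>lborel)"
  proof (intro nn_integral_cong)
    fix s
    show "(\<integral>\<^sup>+t\<in>?T. ennreal ((?A s t)\<^sup>2 + (?B s t)\<^sup>2) \<partial>lborel) * indicator ?S s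
        = (\<integral>\<^sup>+t. ennreal ((?A s t)\<^sup>2 + (?B s t)\<^sup>2) * indicator (square x r) (pt s t) \<partial>lborel)"
      unfolding ind by (cases "s \<in> ?S") (auto intro!: nn_integral_cong)
  qed
  also have "\<dots> = (\<integral>\<^sup>+p\<in>square x r. ennreal ((D (axis 1 1) p)\<^sup>2 + (D (axis 2 1) p)\<^sup>2) \<partial>lborel)"
    by (rule nn_integral_real2[symmetric]) measurable
  also have "\<dots> = (\<integral>\<^sup>+p\<in>square x r. ennreal (\<Sum>b\<in>Basis. (D b p)\<^sup>2) \<partial>lborel)"
    using axis_1_neq_2 by (simp add: Basis_real2)
  also have "\<dots> \<le> ennreal e" using D(4) v'(4) by (meson ennreal_leI order_trans)
  finally have en: "(\<integral>\<^sup>+s\<in>?S. (\<integral>\<^sup>+t\<in>?T. ennreal ((?A s t)\<^sup>2 + (?B s t)\<^sup>2) \<partial>lborel) \<partial>lborel) \<le> ennreal e" .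
  have dA: "((\<lambda>s. u (pt s t)) has_real_derivative ?A s t) (at s)" for s t
    using D(2)[rule_format, of "axis 1 1" "pt 0 t" s] by (simp add: Basis_real2 pt_def add.commute)
  have dB: "((\<lambda>t. u (pt s t)) has_real_derivative ?B s t) (at t)" for s t
    using D(2)[rule_format, of "axis 2 1" "pt s 0" t] by (simp add: Basis_real2 pt_def)
  have cpt: "continuous_on UNIV (\<lambda>p. pt (fst p) (snd p))" by (intro continuous_on_pt continuous_intros)
  have cA: "continuous_on UNIV (\<lambda>p. ?A (fst p) (snd p))" and cB: "continuous_on UNIV (\<lambda>p. ?B (fst p) (snd p))"
    using continuous_on_compose2[OF cD(1) cpt] continuous_on_compose2[OF cD(2) cpt] by simp_all
  obtain c W H where [measurable]: "W \<in> borel_measurable borel" "H \<in> borel_measurable borel"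
    and iW: "(\<integral>\<^sup>+s\<in>?S. W s \<partial>lborel) \<le> ennreal e" and iH: "(\<integral>\<^sup>+t\<in>?T. H t \<partial>lborel) \<le> ennreal e"
    and osc: "\<forall>s\<in>?S. \<forall>t\<in>?T. ennreal ((u (pt s t) - c)\<^sup>2) \<le> ennreal (4 * r) * W s + ennreal (4 * e) \<and>
      ennreal ((u (pt s t) - c)\<^sup>2) \<le> ennreal (4 * r) * H t + ennreal (4 * e)"
    using rectangle_oscillation[where U = "\<lambda>s t. u (pt s t)", OF r e dA dB cA cB en]
    by (elim exE conjE) (rule that)
  \<comment> \<open>Twice the squared mollification error \<open>e\<close> plus twice the bound for
    \<open>u\<close>: this is where \<open>8 * r\<close> and \<open>10 = 2 + 2 * 4\<close> come
    from.\<close>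
  have dbl: "2 * ennreal e + 2 * (ennreal (4 * r) * X + ennreal (4 * e)) = ennreal (8 * r) * X + ennreal (10 * e)" for X
  proof -
    have two: "ennreal (2 * y) = 2 * ennreal y" if "0 \<le> y" for y using that by (simp add: ennreal_mult)
    have "2 * (ennreal (4 * r) * X) = ennreal (8 * r) * X"
      using two[of "4 * r"] r by (simp add: mult.assoc)
    moreover have "2 * ennreal e + 2 * ennreal (4 * e) = ennreal (10 * e)"
      using two[of e] two[of "4 * e"] ennreal_plus[of "2 * e" "8 * e"] e by simp
    ultimately show ?thesis by (simp add: distrib_left add.left_commute)
  qed
  have est: "ennreal ((v p - c)\<^sup>2) \<le> ennreal (8 * r) * X + ennreal (10 * e)"
    if "p \<in> square x r" "ennreal ((u p - c)\<^sup>2) \<le> ennreal (4 * r) * X + ennreal (4 * e)" for p X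
  proof -
    have "(v p - u p)\<^sup>2 \<le> (sqrt e)\<^sup>2" using D(3) that(1) sqe by (intro abs_le_square_iff[THEN iffD1]) auto
    then have "ennreal ((v p - u p)\<^sup>2) \<le> ennreal e" using e by (intro ennreal_leI) simp
    from ennreal_sq_add_le[OF this that(2), unfolded dbl] show ?thesis by simp
  qed
  have estW: "ennreal ((v p - c)\<^sup>2) \<le> ennreal (8 * r) * W (p $ 1) + ennreal (10 * e)"
    and estH: "ennreal ((v p - c)\<^sup>2) \<le> ennreal (8 * r) * H (p $ 2) + ennreal (10 * e)" if "p \<in> square x r" for p
    using osc[rule_format, of "p $ 1" "p $ 2"] that est[OF that] by (auto simp: square_iff)
  define Z where "Z \<rho> = W (?\<alpha> + 1 * \<rho>) + W (?\<alpha> + -1 * \<rho>) + H (?\<beta> + 1 * \<rho>) + H (?\<beta> + -1 * \<rho>)" for \<rho>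
  have Zm: "Z \<in> borel_measurable borel" unfolding Z_def by measurable
  have "(\<integral>\<^sup>+\<rho>\<in>{0..r}. Z \<rho> \<partial>lborel) = (\<integral>\<^sup>+\<rho>\<in>{0..r}. W (?\<alpha> + 1 * \<rho>) \<partial>lborel) + (\<integral>\<^sup>+\<rho>\<in>{0..r}. W (?\<alpha> + -1 * \<rho>) \<partial>lborel)
      + (\<integral>\<^sup>+\<rho>\<in>{0..r}. H (?\<beta> + 1 * \<rho>) \<partial>lborel) + (\<integral>\<^sup>+\<rho>\<in>{0..r}. H (?\<beta> + -1 * \<rho>) \<partial>lborel)"
    unfolding Z_def distrib_right by (simp add: nn_integral_add)
  also have "\<dots> \<le> ennreal e + ennreal e + ennreal e + ennreal e"
    using iW iH by (intro add_mono order_trans[OF nn_integral_reflect_le]) auto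
  also have "\<dots> = ennreal (4 * e)" using e by (simp flip: ennreal_plus)
  finally have iZ: "(\<integral>\<^sup>+\<rho>\<in>{0..r}. Z \<rho> \<partial>lborel) \<le> ennreal (4 * e)" .
  have estZ: "ennreal ((v p - c)\<^sup>2) \<le> ennreal (8 * r) * Z (supd x p) + ennreal (10 * e)" if p: "p \<in> square x r" for p
  proof -
    \<comment> \<open>\<open>p\<close> lies on one of the four sides of its own square boundary, and
      the energy of the line carrying that side is a summand of \<open>Z\<close>.\<close>
    have "W (p $ 1) \<le> Z (supd x p) \<or> H (p $ 2) \<le> Z (supd x p)"
    proof (cases "supd x p = \<bar>p $ 1 - ?\<alpha>\<bar>")
      case True
      then have "?\<alpha> + 1 * supd x p = p $ 1 \<or> ?\<alpha> + -1 * supd x p = p $ 1" by auto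
      then have "W (p $ 1) \<le> Z (supd x p)" unfolding Z_def
        by (elim disjE; simp only:) (simp_all add: add.assoc add_increasing2 add_increasing)
      then show ?thesis ..
    next
      case False
      then have "supd x p = \<bar>p $ 2 - ?\<beta>\<bar>" unfolding supd_def by auto
      then have "?\<beta> + 1 * supd x p = p $ 2 \<or> ?\<beta> + -1 * supd x p = p $ 2" by auto
      then have "H (p $ 2) \<le> Z (supd x p)" unfolding Z_def
        by (elim disjE; simp only:) (simp_all add: add.assoc add_increasing2 add_increasing)
      then show ?thesis ..
    qed
    then show ?thesis
      using estW[OF p] estH[OF p] by (meson add_right_mono mult_left_mono order_trans zero_le)
  qed
  \<comment> \<open>Integrate the bound by \<open>W\<close> over the square:
    \<open>8 * r * e * (2 * r)\<close> plus \<open>10 * e * (2 * r) * (2 * r)\<close>, in total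
    \<open>56 * r\<^sup>2 * e\<close>.\<close>
  have "(\<integral>\<^sup>+p\<in>square x r. ennreal ((v p - c)\<^sup>2) \<partial>lborel)
      \<le> (\<integral>\<^sup>+p. (ennreal (8 * r) * W (p $ 1) + ennreal (10 * e)) * indicator (square x r) p \<partial>lborel)"
    using estW by (intro nn_integral_mono) (auto simp: indicator_def)
  also have "\<dots> = (\<integral>\<^sup>+s. \<integral>\<^sup>+t. (ennreal (8 * r) * W s + ennreal (10 * e)) * indicator ?S s * indicator ?T t \<partial>lborel \<partial>lborel)"
  proof (subst nn_integral_real2)
    have "(\<lambda>p::real^2. p $ 1) \<in> borel_measurable borel"
      by (intro borel_measurable_continuous_onI continuous_intros)
    then show "(\<lambda>p. (ennreal (8 * r) * W (p $ 1) + ennreal (10 * e)) * indicator (square x r) p) \<in> borel_measurable borel"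
      by measurable
  qed (simp add: ind mult.assoc)
  also have "\<dots> = (\<integral>\<^sup>+s. (ennreal (8 * r) * W s + ennreal (10 * e)) * indicator ?S s * ennreal (2 * r) \<partial>lborel)"
    using r by (intro nn_integral_cong) (subst nn_integral_cmult_indicator, auto)
  also have "\<dots> = (\<integral>\<^sup>+s. (ennreal (8 * r) * W s + ennreal (10 * e)) * indicator ?S s \<partial>lborel) * ennreal (2 * r)"
    by (rule nn_integral_multc) measurable
  also have "(\<integral>\<^sup>+s. (ennreal (8 * r) * W s + ennreal (10 * e)) * indicator ?S s \<partial>lborel)
      = ennreal (8 * r) * (\<integral>\<^sup>+s\<in>?S. W s \<partial>lborel) + ennreal (10 * e) * ennreal (2 * r)"
    using r by (simp add: distrib_right nn_integral_add nn_integral_cmult mult.assoc)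
  also have "\<dots> * ennreal (2 * r) \<le> (ennreal (8 * r) * ennreal e + ennreal (10 * e) * ennreal (2 * r)) * ennreal (2 * r)"
    using iW by (intro mult_right_mono add_mono mult_left_mono) auto
  also have "\<dots> = ennreal ((8 * r * e + 10 * e * (2 * r)) * (2 * r))"
    using r e by (simp only: ennreal_mult' ennreal_plus ennreal_mult mult_nonneg_nonneg add_nonneg_nonneg less_imp_le zero_le_numeral)
  also have "(8 * r * e + 10 * e * (2 * r)) * (2 * r) = 56 * r\<^sup>2 * e" by (simp add: power2_eq_square)
  finally show ?thesis using Zm iZ estZ by blast
qed

subsection \<open>Poincare inequality on compact sets\<close>

lemma borel_measurable_sq_indicator:
  fixes v :: "real^2 \<Rightarrow> real"
  assumes "continuous_on \<Omega> v" "compact A" "A \<subseteq> \<Omega>"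
  shows "(\<lambda>p. ennreal ((v p - c)\<^sup>2) * indicator A p) \<in> borel_measurable borel"
proof -
  have A: "A \<in> sets borel" using compact_imp_closed[OF assms(2)] by (rule borel_closed)
  have "(\<lambda>p. indicator A p *\<^sub>R (v p - c)\<^sup>2) \<in> borel_measurable borel"
    by (intro borel_measurable_continuous_on_indicator A continuous_intros continuous_on_subset[OF assms(1,3)])
  then have "(\<lambda>p. ennreal (indicator A p *\<^sub>R (v p - c)\<^sup>2)) \<in> borel_measurable borel" by measurable
  also have "(\<lambda>p. ennreal (indicator A p *\<^sub>R (v p - c)\<^sup>2)) = (\<lambda>p. ennreal ((v p - c)\<^sup>2) * indicator A p)"
    by (auto simp: indicator_def)
  finally show ?thesis .
qed

text \<open>On the common ball both constants approximate the same function, so the distance between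
  them is paid for by the two errors.\<close>

lemma sq_diff_const_le:
  fixes v :: "real^2 \<Rightarrow> real"
  assumes v: "continuous_on \<Omega> v" and A: "compact A" "A \<subseteq> \<Omega>" and B: "compact B" "B \<subseteq> \<Omega>"
    and z: "ball z d \<subseteq> A" "ball z d \<subseteq> B" and ab: "0 \<le> a" "0 \<le> b"
    and iA: "(\<integral>\<^sup>+p\<in>A. ennreal ((v p - c)\<^sup>2) \<partial>lborel) \<le> ennreal a"
    and iB: "(\<integral>\<^sup>+p\<in>B. ennreal ((v p - c')\<^sup>2) \<partial>lborel) \<le> ennreal b"
  shows "(c' - c)\<^sup>2 * measure lborel (ball z d) \<le> 2 * a + 2 * b"
proof -
  note [measurable] = borel_measurable_sq_indicator[OF v A] borel_measurable_sq_indicator[OF v B]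
  have fin: "emeasure lborel (ball z d) = ennreal (measure lborel (ball z d))"
    using emeasure_lborel_ball_finite[of z d] by (intro emeasure_eq_ennreal_measure) auto
  have "ennreal ((c' - c)\<^sup>2 * measure lborel (ball z d)) = ennreal ((c' - c)\<^sup>2) * emeasure lborel (ball z d)"
    unfolding fin by (rule ennreal_mult) auto
  also have "\<dots> = (\<integral>\<^sup>+p\<in>ball z d. ennreal ((c' - c)\<^sup>2) \<partial>lborel)"
    by (rule nn_integral_cmult_indicator[symmetric]) simp
  also have "\<dots> \<le> (\<integral>\<^sup>+p. 2 * (ennreal ((v p - c)\<^sup>2) * indicator A p) + 2 * (ennreal ((v p - c')\<^sup>2) * indicator B p) \<partial>lborel)"
  proof (intro nn_integral_mono)
    fix p
    show "ennreal ((c' - c)\<^sup>2) * indicator (ball z d) p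
        \<le> 2 * (ennreal ((v p - c)\<^sup>2) * indicator A p) + 2 * (ennreal ((v p - c')\<^sup>2) * indicator B p)"
    proof (cases "p \<in> ball z d")
      case True
      then have "p \<in> A" "p \<in> B" using z by auto
      moreover have "ennreal ((c' - v p)\<^sup>2) \<le> ennreal ((v p - c')\<^sup>2)" by (simp add: power2_commute)
      from ennreal_sq_add_le[OF order_refl[of "ennreal ((v p - c)\<^sup>2)"] this]
      have "ennreal ((c' - c)\<^sup>2) \<le> 2 * ennreal ((v p - c)\<^sup>2) + 2 * ennreal ((v p - c')\<^sup>2)" by simp
      ultimately show ?thesis using True by simp
    qed simp
  qed
  also have "\<dots> = 2 * (\<integral>\<^sup>+p\<in>A. ennreal ((v p - c)\<^sup>2) \<partial>lborel) + 2 * (\<integral>\<^sup>+p\<in>B. ennreal ((v p - c')\<^sup>2) \<partial>lborel)"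
    by (simp add: nn_integral_add nn_integral_cmult)
  also have "\<dots> \<le> 2 * ennreal a + 2 * ennreal b" using iA iB by (intro add_mono mult_left_mono) auto
  also have "\<dots> = ennreal (2 * a + 2 * b)" using ab by (simp add: ennreal_mult)
  finally show ?thesis using ab by (subst (asm) ennreal_le_iff) auto
qed

text \<open>\<open>C\<close> is uniform in \<open>v\<close>, while \<open>c\<close> may depend on
  it. Leaving \<open>c\<close> free, rather than prescribing the mean over \<open>S\<close>, makes
  gluing easy.\<close>

definition poincare :: "(real^2) set \<Rightarrow> (real^2) set \<Rightarrow> real \<Rightarrow> bool" where
  "poincare \<Omega> S C \<longleftrightarrow> compact S \<and> S \<subseteq> \<Omega> \<and> C \<ge> 0 \<and>
     (\<forall>v g e. energy_le \<Omega> v g e \<and> e > 0 \<longrightarrow> (\<exists>c. (\<integral>\<^sup>+p\<in>S. ennreal ((v p - c)\<^sup>2) \<partial>lborel) \<le> ennreal (C * e)))"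

lemma poincare_square:
  assumes "open \<Omega>" "r > 0" "square x r \<subseteq> \<Omega>"
  shows "poincare \<Omega> (square x r) (56 * r\<^sup>2)"
  unfolding poincare_def
proof (intro conjI allI impI)
  fix v g e assume "energy_le \<Omega> v g e \<and> e > 0"
  then show "\<exists>c. (\<integral>\<^sup>+p\<in>square x r. ennreal ((v p - c)\<^sup>2) \<partial>lborel) \<le> ennreal (56 * r\<^sup>2 * e)"
    using square_estimate[OF assms, of v g e] by auto
qed (use assms compact_square in auto)

text \<open>The shared ball forces the two constants to within order \<open>sqrt e\<close> of each
  other, so the constant of \<open>A\<close> also serves on \<open>B\<close>.\<close>

lemma poincare_Un:
  assumes A: "poincare \<Omega> A CA" and B: "poincare \<Omega> B CB" and d: "d > 0" "ball z d \<subseteq> A" "ball z d \<subseteq> B"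
  shows "\<exists>C. poincare \<Omega> (A \<union> B) C"
proof -
  have A': "compact A" "A \<subseteq> \<Omega>" "CA \<ge> 0" and B': "compact B" "B \<subseteq> \<Omega>" "CB \<ge> 0"
    using A B by (auto simp: poincare_def)
  define m where "m = measure lborel (ball z d)"
  have m: "m > 0" unfolding m_def using d(1) by (rule content_ball_pos)
  define L where "L = measure lborel B"
  have "emeasure lborel B = ennreal L" unfolding L_def
    using emeasure_compact_finite[OF B'(1)] by (intro emeasure_eq_ennreal_measure) auto
  have L: "L \<ge> 0" by (simp add: L_def)
  \<comment> \<open>On \<open>B\<close>, twice the deviation from \<open>b\<close> plus twice
    \<open>(b - a)\<^sup>2\<close> times the area \<open>L\<close>; the quotient by \<open>m\<close>
    is the bound found on the ball of measure \<open>m\<close>.\<close>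
  define C where "C = CA + (2 * CB + 2 * ((2 * CA + 2 * CB) / m * L))"
  have C: "C \<ge> 0" unfolding C_def using A' B' m L by (intro add_nonneg_nonneg mult_nonneg_nonneg divide_nonneg_nonneg) auto
  have "poincare \<Omega> (A \<union> B) C"
    unfolding poincare_def
  proof (intro conjI allI impI)
    fix v g e assume as: "energy_le \<Omega> v g e \<and> e > 0"
    then have v: "continuous_on \<Omega> v" and e: "e > 0" by (auto simp: energy_le_def)
    obtain a where a: "(\<integral>\<^sup>+p\<in>A. ennreal ((v p - a)\<^sup>2) \<partial>lborel) \<le> ennreal (CA * e)"
      using A as unfolding poincare_def by blast
    obtain b where b: "(\<integral>\<^sup>+p\<in>B. ennreal ((v p - b)\<^sup>2) \<partial>lborel) \<le> ennreal (CB * e)"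
      using B as unfolding poincare_def by blast
    note [measurable] = borel_measurable_sq_indicator[OF v A'(1,2)] borel_measurable_sq_indicator[OF v B'(1,2)]
    have mB [measurable]: "B \<in> sets borel" using compact_imp_closed[OF B'(1)] by (rule borel_closed)
    have "(b - a)\<^sup>2 * m \<le> 2 * (CA * e) + 2 * (CB * e)"
      unfolding m_def using sq_diff_const_le[OF v A'(1,2) B'(1,2) d(2,3) _ _ a b] A' B' e by simp
    then have ba: "(b - a)\<^sup>2 \<le> (2 * CA + 2 * CB) / m * e" using m by (simp add: field_simps)
    have "(\<integral>\<^sup>+p\<in>A \<union> B. ennreal ((v p - a)\<^sup>2) \<partial>lborel)
       \<le> (\<integral>\<^sup>+p. ennreal ((v p - a)\<^sup>2) * indicator A p + (2 * (ennreal ((v p - b)\<^sup>2) * indicator B p) + 2 * (ennreal ((b - a)\<^sup>2) * indicator B p)) \<partial>lborel)"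
    proof (intro nn_integral_mono)
      fix p
      have "ennreal ((v p - a)\<^sup>2) \<le> 2 * ennreal ((v p - b)\<^sup>2) + 2 * ennreal ((b - a)\<^sup>2)"
        using ennreal_sq_add_le[OF order_refl[of "ennreal ((v p - b)\<^sup>2)"] order_refl[of "ennreal ((b - a)\<^sup>2)"]] by simp
      then show "ennreal ((v p - a)\<^sup>2) * indicator (A \<union> B) p \<le> ennreal ((v p - a)\<^sup>2) * indicator A p
          + (2 * (ennreal ((v p - b)\<^sup>2) * indicator B p) + 2 * (ennreal ((b - a)\<^sup>2) * indicator B p))"
        by (cases "p \<in> A"; cases "p \<in> B") auto
    qed
    also have "\<dots> = (\<integral>\<^sup>+p\<in>A. ennreal ((v p - a)\<^sup>2) \<partial>lborel) + (2 * (\<integral>\<^sup>+p\<in>B. ennreal ((v p - b)\<^sup>2) \<partial>lborel)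
        + 2 * (ennreal ((b - a)\<^sup>2) * ennreal L))"
      using \<open>emeasure lborel B = ennreal L\<close> by (simp add: nn_integral_add nn_integral_cmult)
    also have "\<dots> \<le> ennreal (CA * e) + (2 * ennreal (CB * e) + 2 * (ennreal ((2 * CA + 2 * CB) / m * e) * ennreal L))"
      using a b ba by (intro add_mono mult_left_mono mult_right_mono ennreal_leI) auto
    also have "\<dots> = ennreal (CA * e + (2 * (CB * e) + 2 * ((2 * CA + 2 * CB) / m * e * L)))"
    proof -
      define X where "X = (2 * CA + 2 * CB) / m * e"
      have X: "0 \<le> X" unfolding X_def using A' B' m e by (intro mult_nonneg_nonneg divide_nonneg_nonneg) auto
      have "2 * (ennreal X * ennreal L) = ennreal (2 * (X * L))" "2 * ennreal (CB * e) = ennreal (2 * (CB * e))"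
        using X L B' e by (simp_all add: ennreal_mult)
      moreover have "0 \<le> CA * e" "0 \<le> 2 * (CB * e)" "0 \<le> 2 * (X * L)" using A' B' e X L by auto
      ultimately show ?thesis unfolding X_def[symmetric] by simp
    qed
    also have "CA * e + (2 * (CB * e) + 2 * ((2 * CA + 2 * CB) / m * e * L)) = C * e"
      by (simp add: C_def algebra_simps)
    finally show "\<exists>c. (\<integral>\<^sup>+p\<in>A \<union> B. ennreal ((v p - c)\<^sup>2) \<partial>lborel) \<le> ennreal (C * e)" by blast
  qed (use A' B' C in auto)
  then show ?thesis by blast
qed

lemma poincare_Un_interior:
  assumes "poincare \<Omega> A CA" "poincare \<Omega> B CB" "z \<in> interior A" "z \<in> interior B"
  shows "\<exists>C. poincare \<Omega> (A \<union> B) C"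
proof -
  have "open (interior A \<inter> interior B)" "z \<in> interior A \<inter> interior B" using assms by auto
  then obtain d where "d > 0" "ball z d \<subseteq> interior A \<inter> interior B" using open_contains_ball by blast
  then have "ball z d \<subseteq> A" "ball z d \<subseteq> B" using interior_subset by blast+
  then show ?thesis using poincare_Un[OF assms(1,2) \<open>d > 0\<close>] by blast
qed

text \<open>Lying in the interior of a common Poincare set is an equivalence relation with open
  classes, so connectedness leaves one class. Interiors are used because two sets then overlap in a
  ball as soon as they share a point.\<close>

lemma poincare_connects:
  assumes "open \<Omega>" "connected \<Omega>" "a \<in> \<Omega>" "b \<in> \<Omega>"
  shows "\<exists>S C. poincare \<Omega> S C \<and> a \<in> interior S \<and> b \<in> interior S"
proof (rule connected_equivalence_relation[OF assms(2-4), where R = "\<lambda>a b. \<exists>S C. poincare \<Omega> S C \<and> a \<in> interior S \<and> b \<in> interior S"])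
  fix x y assume "\<exists>S C. poincare \<Omega> S C \<and> x \<in> interior S \<and> y \<in> interior S"
  then show "\<exists>S C. poincare \<Omega> S C \<and> y \<in> interior S \<and> x \<in> interior S" by blast
next
  fix x y z
  assume "\<exists>S C. poincare \<Omega> S C \<and> x \<in> interior S \<and> y \<in> interior S" "\<exists>S C. poincare \<Omega> S C \<and> y \<in> interior S \<and> z \<in> interior S"
  then obtain S C S' C' where S: "poincare \<Omega> S C" "x \<in> interior S" "y \<in> interior S"
    "poincare \<Omega> S' C'" "y \<in> interior S'" "z \<in> interior S'" by blast
  obtain C'' where "poincare \<Omega> (S \<union> S') C''" using poincare_Un_interior[OF S(1,4,3,5)] by blast
  moreover have "interior S \<subseteq> interior (S \<union> S')" "interior S' \<subseteq> interior (S \<union> S')" by (auto intro!: interior_mono)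
  ultimately show "\<exists>S C. poincare \<Omega> S C \<and> x \<in> interior S \<and> z \<in> interior S" using S by blast
next
  fix a assume a: "a \<in> \<Omega>"
  obtain r where r: "0 < r" "r \<le> 1" "square a r \<subseteq> \<Omega>" using square_subset_open[OF assms(1) a, of 1] by auto
  have sub: "ball a r \<subseteq> interior (square a r)" by (intro interior_maximal ball_subset_square) auto
  show "\<exists>T. openin (top_of_set \<Omega>) T \<and> a \<in> T \<and> (\<forall>x\<in>T. \<exists>S C. poincare \<Omega> S C \<and> a \<in> interior S \<and> x \<in> interior S)"
  proof (rule exI[of _ "ball a r"], intro conjI ballI)
    have "ball a r \<subseteq> \<Omega>" using ball_subset_square r(3) by blast
    then show "openin (top_of_set \<Omega>) (ball a r)" by (simp add: open_subset)
    show "a \<in> ball a r" using r by simp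
    fix x assume "x \<in> ball a r"
    then show "\<exists>S C. poincare \<Omega> S C \<and> a \<in> interior S \<and> x \<in> interior S"
      using poincare_square[OF assms(1) r(1,3)] sub \<open>a \<in> ball a r\<close> by blast
  qed
qed

text \<open>All covering sets are taken with the base point \<open>a\<close> in their interior. Any
  two of them then overlap in a ball about \<open>a\<close>, and a finite subcover can be glued in
  any order.\<close>

lemma poincare_superset:
  assumes "open \<Omega>" "connected \<Omega>" "compact K" "K \<subseteq> \<Omega>" "a \<in> \<Omega>"
  shows "\<exists>S C. poincare \<Omega> S C \<and> K \<subseteq> S"
proof -
  define \<C> where "\<C> = {S. (\<exists>C. poincare \<Omega> S C) \<and> a \<in> interior S}"
  have cov: "K \<subseteq> \<Union> (interior ` \<C>)"
  proof
    fix b assume "b \<in> K"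
    then have "b \<in> \<Omega>" using assms(4) by blast
    from poincare_connects[OF assms(1,2,5) this] show "b \<in> \<Union> (interior ` \<C>)" unfolding \<C>_def by blast
  qed
  obtain \<D> where \<D>: "\<D> \<subseteq> \<C>" "finite \<D>" "K \<subseteq> \<Union> (interior ` \<D>)"
  proof (rule compactE_image[OF assms(3), of \<C> interior])
    show "K \<subseteq> (\<Union>c\<in>\<C>. interior c)" using cov by simp
  qed (use that in auto)
  have "\<exists>S\<in>\<C>. \<Union>\<D> \<subseteq> S" using \<D>(2,1)
  proof (induction \<D> rule: finite_induct)
    case empty
    show ?case using poincare_connects[OF assms(1,2,5,5)] unfolding \<C>_def by auto
  next
    case (insert D \<D>)
    then obtain S where S: "S \<in> \<C>" "\<Union>\<D> \<subseteq> S" by auto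
    have D: "D \<in> \<C>" using insert by blast
    obtain CS CD where c: "poincare \<Omega> S CS" "poincare \<Omega> D CD" "a \<in> interior S" "a \<in> interior D"
      using S(1) D unfolding \<C>_def by blast
    have "a \<in> interior (S \<union> D)" using c(3) interior_mono[of S "S \<union> D"] by blast
    then have "S \<union> D \<in> \<C>" using poincare_Un_interior[OF c] unfolding \<C>_def by blast
    then show ?case using S(2) by blast
  qed
  then obtain S where "S \<in> \<C>" "\<Union>\<D> \<subseteq> S" by blast
  moreover have "\<Union> (interior ` \<D>) \<subseteq> \<Union>\<D>" using interior_subset by blast
  ultimately have "K \<subseteq> S" using \<D>(3) by (meson order_trans)
  moreover obtain C where "poincare \<Omega> S C" using \<open>S \<in> \<C>\<close> unfolding \<C>_def by blast
  ultimately show ?thesis by blast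
qed

text \<open>The square estimate brings its own constant \<open>c'\<close>. Comparison on a ball
  lying in the square and in \<open>T\<close> replaces it by the constant of \<open>T\<close>, which
  makes values on distant squares comparable.\<close>

lemma square_estimate_common_const:
  assumes \<Omega>: "open \<Omega>" and T: "compact T" "T \<subseteq> \<Omega>" and r: "r > 0" "square x r \<subseteq> T" and K: "K \<ge> 0"
  shows "\<exists>C\<ge>0. \<forall>v g e c. energy_le \<Omega> v g e \<and> e > 0 \<and> (\<integral>\<^sup>+p\<in>T. ennreal ((v p - c)\<^sup>2) \<partial>lborel) \<le> ennreal (K * e) \<longrightarrow>
    (\<exists>Z. Z \<in> borel_measurable borel \<and> (\<integral>\<^sup>+\<rho>\<in>{0..r}. Z \<rho> \<partial>lborel) \<le> ennreal (4 * e) \<and>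
      (\<forall>p\<in>square x r. ennreal ((v p - c)\<^sup>2) \<le> ennreal (16 * r) * Z (supd x p) + ennreal (C * e)))"
proof -
  define m where "m = measure lborel (ball x r)"
  have m: "m > 0" unfolding m_def using r(1) by (rule content_ball_pos)
  \<comment> \<open>20 is twice the 10 of the square estimate; the rest is twice the factor of
    \<open>e\<close> in the bound for \<open>(c' - c)\<^sup>2\<close>.\<close>
  define C where "C = 20 + 2 * ((2 * (56 * r\<^sup>2) + 2 * K) / m)"
  have C: "C \<ge> 0" unfolding C_def using m K by (intro add_nonneg_nonneg mult_nonneg_nonneg divide_nonneg_nonneg) auto
  show ?thesis
  proof (intro exI[of _ C] conjI C allI impI; elim conjE)
    fix v g e c
    assume v: "energy_le \<Omega> v g e" and e: "0 < e" and c: "(\<integral>\<^sup>+p\<in>T. ennreal ((v p - c)\<^sup>2) \<partial>lborel) \<le> ennreal (K * e)"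
    have Q: "square x r \<subseteq> \<Omega>" using r T by blast
    obtain c' Z where Z: "Z \<in> borel_measurable borel" "(\<integral>\<^sup>+\<rho>\<in>{0..r}. Z \<rho> \<partial>lborel) \<le> ennreal (4 * e)"
      and p: "\<And>p. p \<in> square x r \<Longrightarrow> ennreal ((v p - c')\<^sup>2) \<le> ennreal (8 * r) * Z (supd x p) + ennreal (10 * e)"
      and c': "(\<integral>\<^sup>+p\<in>square x r. ennreal ((v p - c')\<^sup>2) \<partial>lborel) \<le> ennreal (56 * r\<^sup>2 * e)"
      using square_estimate[OF \<Omega> r(1) Q v e] by auto
    have cv: "continuous_on \<Omega> v" using v by (simp add: energy_le_def)
    have b: "ball x r \<subseteq> square x r" "ball x r \<subseteq> T" using ball_subset_square r(2) by blast+
    have "(c - c')\<^sup>2 * m \<le> 2 * (56 * r\<^sup>2 * e) + 2 * (K * e)"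
      unfolding m_def using sq_diff_const_le[OF cv compact_square Q T b _ _ c' c] e K by simp
    then have "(c' - c)\<^sup>2 \<le> (2 * (56 * r\<^sup>2) + 2 * K) / m * e" using m by (simp add: field_simps power2_commute)
    then have cc: "ennreal ((c' - c)\<^sup>2) \<le> ennreal ((2 * (56 * r\<^sup>2) + 2 * K) / m * e)" by (rule ennreal_leI)
    have two: "2 * ennreal y = ennreal (2 * y)" if "0 \<le> y" for y using that by (simp add: ennreal_mult)
    have "ennreal ((v q - c)\<^sup>2) \<le> ennreal (16 * r) * Z (supd x q) + ennreal (C * e)" if q: "q \<in> square x r" for q
    proof -
      have "ennreal ((v q - c)\<^sup>2) \<le> 2 * (ennreal (8 * r) * Z (supd x q) + ennreal (10 * e)) + 2 * ennreal ((2 * (56 * r\<^sup>2) + 2 * K) / m * e)"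
        using ennreal_sq_add_le[OF p[OF q] cc] by simp
      also have "\<dots> = (2 * ennreal (8 * r)) * Z (supd x q) + (2 * ennreal (10 * e) + 2 * ennreal ((2 * (56 * r\<^sup>2) + 2 * K) / m * e))"
        by (simp only: distrib_left mult.assoc add.assoc)
      also have "2 * ennreal (8 * r) = ennreal (16 * r)" using two[of "8 * r"] r by simp
      also have "2 * ennreal (10 * e) + 2 * ennreal ((2 * (56 * r\<^sup>2) + 2 * K) / m * e) = ennreal (C * e)"
      proof -
        have n: "0 \<le> (2 * (56 * r\<^sup>2) + 2 * K) / m * e" using m K e by (intro mult_nonneg_nonneg divide_nonneg_nonneg) auto
        have "2 * ennreal (10 * e) + 2 * ennreal ((2 * (56 * r\<^sup>2) + 2 * K) / m * e) = ennreal (2 * (10 * e) + 2 * ((2 * (56 * r\<^sup>2) + 2 * K) / m * e))"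
          using two[OF n] two[of "10 * e"] ennreal_plus[of "2 * (10 * e)" "2 * ((2 * (56 * r\<^sup>2) + 2 * K) / m * e)"] n e by simp
        also have "2 * (10 * e) + 2 * ((2 * (56 * r\<^sup>2) + 2 * K) / m * e) = C * e" unfolding C_def by (simp add: distrib_right)
        finally show ?thesis .
      qed
      finally show ?thesis .
    qed
    then show "\<exists>Z. Z \<in> borel_measurable borel \<and> (\<integral>\<^sup>+\<rho>\<in>{0..r}. Z \<rho> \<partial>lborel) \<le> ennreal (4 * e) \<and>
      (\<forall>p\<in>square x r. ennreal ((v p - c)\<^sup>2) \<le> ennreal (16 * r) * Z (supd x p) + ennreal (C * e))"
      using Z by blast
  qed
qed

subsection \<open>Capacity\<close>

text \<open>A weak gradient is controlled on compact subsets only; an exhaustion of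
  \<open>\<Omega>\<close> by compact sets gives measurability on all of it as a pointwise
  limit.\<close>

lemma weak_gradient_measurable:
  assumes "open \<Omega>" "weak_gradient \<Omega> v g"
  shows "(\<lambda>x. indicator \<Omega> x *\<^sub>R g x) \<in> borel_measurable lborel"
proof -
  have "\<exists>C :: nat \<Rightarrow> (real^2) set. (\<forall>n. compact (C n)) \<and> (\<forall>n. C n \<subseteq> \<Omega>) \<and>
      (\<forall>K. compact K \<longrightarrow> K \<subseteq> \<Omega> \<longrightarrow> (\<exists>N. \<forall>n\<ge>N. K \<subseteq> C n))"
    by (rule open_Union_compact_subsets[OF assms(1)]) metis
  then obtain C :: "nat \<Rightarrow> (real^2) set" where C: "\<And>n. compact (C n)" "\<And>n. C n \<subseteq> \<Omega>"
    "\<And>K. \<lbrakk>compact K; K \<subseteq> \<Omega>\<rbrakk> \<Longrightarrow> \<exists>N. \<forall>n\<ge>N. K \<subseteq> C n" by blast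
  show ?thesis
  proof (rule borel_measurable_LIMSEQ_metric)
    show "(\<lambda>x. indicator (C n) x *\<^sub>R g x) \<in> borel_measurable lborel" for n
      using assms(2)[unfolded weak_gradient_def, THEN conjunct1, rule_format, of "C n"] C
      by (intro borel_measurable_integrable) simp
    fix x
    show "(\<lambda>n. indicator (C n) x *\<^sub>R g x) \<longlonglongrightarrow> indicator \<Omega> x *\<^sub>R g x"
    proof (cases "x \<in> \<Omega>")
      case True
      then obtain N where "\<forall>n\<ge>N. {x} \<subseteq> C n" using C(3)[of "{x}"] by auto
      then have "eventually (\<lambda>n. indicator (C n) x *\<^sub>R g x = indicator \<Omega> x *\<^sub>R g x) sequentially"
        using True unfolding eventually_sequentially by (intro exI[of _ N]) auto
      then show ?thesis by (rule tendsto_eventually)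
    next
      case False
      then have "x \<notin> C n" for n using C(2) by blast
      then show ?thesis using False by simp
    qed
  qed
qed

lemma energy_bound:
  assumes "open \<Omega>" "weak_gradient \<Omega> v h" and f: "set_integrable lborel \<Omega> f"
    and le: "\<And>x. x \<in> \<Omega> \<Longrightarrow> (norm (h x))\<^sup>2 \<le> f x"
  shows "set_integrable lborel \<Omega> (\<lambda>x. (norm (h x))\<^sup>2)"
    and "(LINT x:\<Omega>|lborel. (norm (h x))\<^sup>2) \<le> (LINT x:\<Omega>|lborel. f x)"
proof -
  note m = weak_gradient_measurable[OF assms(1,2)]
  have eq: "indicator \<Omega> x *\<^sub>R (norm (h x))\<^sup>2 = (norm (indicator \<Omega> x *\<^sub>R h x))\<^sup>2" for x
    by (auto simp: indicator_def)
  show i: "set_integrable lborel \<Omega> (\<lambda>x. (norm (h x))\<^sup>2)"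
    unfolding set_integrable_def
  proof (rule Bochner_Integration.integrable_bound[OF f[unfolded set_integrable_def]])
    show "(\<lambda>x. indicator \<Omega> x *\<^sub>R (norm (h x))\<^sup>2) \<in> borel_measurable lborel"
      unfolding eq using m by measurable
    have "norm (indicator \<Omega> x *\<^sub>R (norm (h x))\<^sup>2) \<le> norm (indicator \<Omega> x *\<^sub>R f x)" for x
      using le[of x] by (cases "x \<in> \<Omega>") auto
    then show "AE x in lborel. norm (indicator \<Omega> x *\<^sub>R (norm (h x))\<^sup>2) \<le> norm (indicator \<Omega> x *\<^sub>R f x)" by simp
  qed
  show "(LINT x:\<Omega>|lborel. (norm (h x))\<^sup>2) \<le> (LINT x:\<Omega>|lborel. f x)"
    using le by (intro set_integral_mono i f)
qed

lemma energy_nonneg: "0 \<le> (LINT x:\<Omega>|lborel. (norm (g x))\<^sup>2)"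
  unfolding set_lebesgue_integral_def by (intro integral_nonneg_AE) (auto simp: indicator_def)

section \<open>The capacity as an infimum, and its subadditivity\<close>

lemma energy_set_bdd_below:
  "bdd_below {(LINT x:\<Omega>|lborel. (norm (g x))\<^sup>2) | v g. cap_admissible F0 F1 \<Omega> v g}"
  using energy_nonneg by (intro bdd_belowI[of _ 0]) auto

lemma conf_cap_le:
  "cap_admissible F0 F1 \<Omega> v g \<Longrightarrow> conf_cap F0 F1 \<Omega> \<le> (LINT x:\<Omega>|lborel. (norm (g x))\<^sup>2)"
  unfolding conf_cap_def by (intro cInf_lower energy_set_bdd_below) blast

text \<open>A competitor is assumed because the infimum of the empty set of reals is an unspecified
  value; hence the existence results below.\<close>

lemma conf_cap_nonneg:
  assumes "cap_admissible F0 F1 \<Omega> v g"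
  shows "0 \<le> conf_cap F0 F1 \<Omega>"
  unfolding conf_cap_def
proof (rule cInf_greatest)
  show "{(LINT x:\<Omega>|lborel. (norm (g x))\<^sup>2) | v g. cap_admissible F0 F1 \<Omega> v g} \<noteq> {}" using assms by blast
qed (use energy_nonneg in auto)

lemma conf_cap_lessD:
  assumes "cap_admissible F0 F1 \<Omega> v g" "conf_cap F0 F1 \<Omega> < e"
  shows "\<exists>v g. cap_admissible F0 F1 \<Omega> v g \<and> (LINT x:\<Omega>|lborel. (norm (g x))\<^sup>2) < e"
proof -
  have "{(LINT x:\<Omega>|lborel. (norm (g x))\<^sup>2) | v g. cap_admissible F0 F1 \<Omega> v g} \<noteq> {}" using assms by blast
  from cInf_lessD[OF this assms(2)[unfolded conf_cap_def]] show ?thesis by auto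
qed

lemma cap_admissible_energy_le:
  "cap_admissible F0 F1 \<Omega> v g \<Longrightarrow> (LINT x:\<Omega>|lborel. (norm (g x))\<^sup>2) \<le> e \<Longrightarrow> energy_le \<Omega> v g e"
  by (simp add: cap_admissible_def energy_le_def)

text \<open>Nonnegativity is what keeps the sum at least 1 wherever one of the summands is.\<close>

lemma cap_admissible_add:
  assumes \<Omega>: "open \<Omega>" and "cap_admissible F A \<Omega> v g" "cap_admissible F B \<Omega> w h"
  shows "cap_admissible F (A \<union> B) \<Omega> (\<lambda>x. v x + w x) (\<lambda>x. g x + h x)"
proof -
  have v: "continuous_on \<Omega> v" "\<forall>x\<in>\<Omega>. 0 \<le> v x" "weak_gradient \<Omega> v g" "set_integrable lborel \<Omega> (\<lambda>x. (norm (g x))\<^sup>2)"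
    and w: "continuous_on \<Omega> w" "\<forall>x\<in>\<Omega>. 0 \<le> w x" "weak_gradient \<Omega> w h" "set_integrable lborel \<Omega> (\<lambda>x. (norm (h x))\<^sup>2)"
    using assms by (auto simp: cap_admissible_def)
  obtain U U' where U: "open U" "F \<subseteq> U" "\<forall>x\<in>U \<inter> \<Omega>. v x = 0" "open U'" "A \<subseteq> U'" "\<forall>x\<in>U' \<inter> \<Omega>. 1 \<le> v x"
    using assms(2) by (auto simp: cap_admissible_def)
  obtain T T' where T: "open T" "F \<subseteq> T" "\<forall>x\<in>T \<inter> \<Omega>. w x = 0" "open T'" "B \<subseteq> T'" "\<forall>x\<in>T' \<inter> \<Omega>. 1 \<le> w x"
    using assms(3) by (auto simp: cap_admissible_def)
  have wg: "weak_gradient \<Omega> (\<lambda>x. v x + w x) (\<lambda>x. g x + h x)" using v(3) w(3) by (rule weak_gradient_add)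
  have b: "(norm (g x + h x))\<^sup>2 \<le> 2 * (norm (g x))\<^sup>2 + 2 * (norm (h x))\<^sup>2" for x
  proof -
    have "(norm (g x + h x))\<^sup>2 \<le> (norm (g x) + norm (h x))\<^sup>2" by (intro power_mono norm_triangle_ineq) auto
    also have "\<dots> \<le> 2 * (norm (g x))\<^sup>2 + 2 * (norm (h x))\<^sup>2"
      using sum_squares_bound[of "norm (g x)" "norm (h x)"] by (simp add: power2_sum)
    finally show ?thesis .
  qed
  have "set_integrable lborel \<Omega> (\<lambda>x. 2 * (norm (g x))\<^sup>2 + 2 * (norm (h x))\<^sup>2)"
    using v(4) w(4) by (intro set_integral_add set_integrable_mult_right) auto
  from energy_bound(1)[OF \<Omega> wg this b]
  have "set_integrable lborel \<Omega> (\<lambda>x. (norm (g x + h x))\<^sup>2)" .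
  moreover have "\<forall>x\<in>(U \<inter> T) \<inter> \<Omega>. v x + w x = 0" using U T by auto
  moreover have "\<forall>x\<in>(U' \<union> T') \<inter> \<Omega>. 1 \<le> v x + w x"
  proof
    fix x assume x: "x \<in> (U' \<union> T') \<inter> \<Omega>"
    then have "0 \<le> v x" "0 \<le> w x" "1 \<le> v x \<or> 1 \<le> w x" using U(6) T(6) v(2) w(2) by auto
    then show "1 \<le> v x + w x" by linarith
  qed
  moreover have "open (U \<inter> T)" "F \<subseteq> U \<inter> T" "open (U' \<union> T')" "A \<union> B \<subseteq> U' \<union> T'" using U T by auto
  moreover have "continuous_on \<Omega> (\<lambda>x. v x + w x)" using v(1) w(1) by (intro continuous_intros)
  moreover have "\<forall>x\<in>\<Omega>. 0 \<le> v x + w x" using v(2) w(2) by simp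
  ultimately show ?thesis unfolding cap_admissible_def using wg by blast
qed

text \<open>Minkowski's inequality for the gradients, in the form
  \<open>|g + h|\<^sup>2 \<le> (1 + \<beta>/\<alpha>)|g|\<^sup>2 + (1 + \<alpha>/\<beta>)|h|\<^sup>2\<close> with \<open>\<alpha>\<close>, \<open>\<beta>\<close> bounds for the two norms.\<close>

lemma sqrt_conf_cap_Un_le:
  assumes \<Omega>: "open \<Omega>" and A: "cap_admissible F A \<Omega> v0 g0" and B: "cap_admissible F B \<Omega> w0 h0"
  shows "sqrt (conf_cap F (A \<union> B) \<Omega>) \<le> sqrt (conf_cap F A \<Omega>) + sqrt (conf_cap F B \<Omega>)"
proof (rule field_le_epsilon)
  fix \<epsilon> :: real assume \<epsilon>: "\<epsilon> > 0"
  \<comment> \<open>The summand \<open>\<epsilon> / 2\<close> admits near-optimal competitors and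
    keeps \<open>\<alpha>\<close> and \<open>\<beta>\<close> positive even if a capacity is
    zero.\<close>
  define \<alpha> where "\<alpha> = sqrt (conf_cap F A \<Omega>) + \<epsilon> / 2"
  define \<beta> where "\<beta> = sqrt (conf_cap F B \<Omega>) + \<epsilon> / 2"
  have nn: "0 \<le> conf_cap F A \<Omega>" "0 \<le> conf_cap F B \<Omega>" using conf_cap_nonneg A B by blast+
  have pos: "\<alpha> > 0" "\<beta> > 0" using nn \<epsilon> by (auto simp: \<alpha>_def \<beta>_def add_nonneg_pos)
  have "sqrt (conf_cap F A \<Omega>) < \<alpha>" "sqrt (conf_cap F B \<Omega>) < \<beta>" using \<epsilon> by (auto simp: \<alpha>_def \<beta>_def)
  then have less: "conf_cap F A \<Omega> < \<alpha>\<^sup>2" "conf_cap F B \<Omega> < \<beta>\<^sup>2" using pos nn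
    by (metis less_le real_sqrt_less_iff real_sqrt_unique zero_le_power2)+
  obtain v g where v: "cap_admissible F A \<Omega> v g" "(LINT x:\<Omega>|lborel. (norm (g x))\<^sup>2) < \<alpha>\<^sup>2"
    using conf_cap_lessD[OF A less(1)] by blast
  obtain w h where w: "cap_admissible F B \<Omega> w h" "(LINT x:\<Omega>|lborel. (norm (h x))\<^sup>2) < \<beta>\<^sup>2"
    using conf_cap_lessD[OF B less(2)] by blast
  have adm: "cap_admissible F (A \<union> B) \<Omega> (\<lambda>x. v x + w x) (\<lambda>x. g x + h x)"
    using cap_admissible_add[OF \<Omega> v(1) w(1)] .
  then have wg: "weak_gradient \<Omega> (\<lambda>x. v x + w x) (\<lambda>x. g x + h x)" by (simp add: cap_admissible_def)
  have sg: "set_integrable lborel \<Omega> (\<lambda>x. (norm (g x))\<^sup>2)" and sh: "set_integrable lborel \<Omega> (\<lambda>x. (norm (h x))\<^sup>2)"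
    using v(1) w(1) by (auto simp: cap_admissible_def)
  have b: "(norm (g x + h x))\<^sup>2 \<le> (1 + \<beta> / \<alpha>) * (norm (g x))\<^sup>2 + (1 + \<alpha> / \<beta>) * (norm (h x))\<^sup>2" for x
  proof -
    let ?p = "norm (g x)" and ?q = "norm (h x)"
    \<comment> \<open>Weighted arithmetic-geometric inequality, with weights fitted to competitors
      of norms about \<open>\<alpha>\<close> and \<open>\<beta>\<close>.\<close>
    have "0 \<le> (\<beta> * ?p - \<alpha> * ?q)\<^sup>2 / (\<alpha> * \<beta>)" using pos by simp
    also have "\<dots> = \<beta> / \<alpha> * ?p\<^sup>2 + \<alpha> / \<beta> * ?q\<^sup>2 - 2 * ?p * ?q"
      using pos by (simp add: power2_eq_square field_simps)
    finally have "(?p + ?q)\<^sup>2 \<le> (1 + \<beta> / \<alpha>) * ?p\<^sup>2 + (1 + \<alpha> / \<beta>) * ?q\<^sup>2"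
      by (simp add: power2_sum distrib_right)
    moreover have "(norm (g x + h x))\<^sup>2 \<le> (?p + ?q)\<^sup>2" by (intro power_mono norm_triangle_ineq) auto
    ultimately show ?thesis by linarith
  qed
  have si: "set_integrable lborel \<Omega> (\<lambda>x. (1 + \<beta> / \<alpha>) * (norm (g x))\<^sup>2)" "set_integrable lborel \<Omega> (\<lambda>x. (1 + \<alpha> / \<beta>) * (norm (h x))\<^sup>2)"
    using sg sh by (auto intro: set_integrable_mult_right)
  have "conf_cap F (A \<union> B) \<Omega> \<le> (LINT x:\<Omega>|lborel. (norm (g x + h x))\<^sup>2)" using conf_cap_le[OF adm] .
  also have "\<dots> \<le> (LINT x:\<Omega>|lborel. (1 + \<beta> / \<alpha>) * (norm (g x))\<^sup>2 + (1 + \<alpha> / \<beta>) * (norm (h x))\<^sup>2)"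
    using si by (intro energy_bound(2)[OF \<Omega> wg _ b] set_integral_add)
  also have "\<dots> = (1 + \<beta> / \<alpha>) * (LINT x:\<Omega>|lborel. (norm (g x))\<^sup>2) + (1 + \<alpha> / \<beta>) * (LINT x:\<Omega>|lborel. (norm (h x))\<^sup>2)"
    using si by (simp add: set_integral_add)
  also have "\<dots> \<le> (1 + \<beta> / \<alpha>) * \<alpha>\<^sup>2 + (1 + \<alpha> / \<beta>) * \<beta>\<^sup>2"
    using v(2) w(2) pos by (intro add_mono mult_left_mono) auto
  \<comment> \<open>Each product contributes one square and one \<open>\<alpha> * \<beta>\<close>,
    which completes the square.\<close>
  also have "\<dots> = (\<alpha> + \<beta>)\<^sup>2" using pos by (simp add: power2_eq_square field_simps)
  finally have "sqrt (conf_cap F (A \<union> B) \<Omega>) \<le> \<alpha> + \<beta>" using pos by (simp add: real_le_lsqrt)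
  then show "sqrt (conf_cap F (A \<union> B) \<Omega>) \<le> sqrt (conf_cap F A \<Omega>) + sqrt (conf_cap F B \<Omega>) + \<epsilon>"
    by (simp add: \<alpha>_def \<beta>_def)
qed

section \<open>Competitors built from cutoff functions\<close>

lemma grad_outside_support:
  assumes "test_fun U \<theta>" "x \<notin> closure {x. \<theta> x \<noteq> 0}"
  shows "grad \<theta> x = 0"
proof (rule grad_locally_const[of "- closure {x. \<theta> x \<noteq> 0}" x \<theta> 0])
  show "\<theta> y = 0" if "y \<in> - closure {x. \<theta> x \<noteq> 0}" for y
    using that closure_subset[of "{x. \<theta> x \<noteq> 0}"] by auto
qed (use assms in auto)

lemma test_fun_energy_integrable:
  assumes "test_fun U \<theta>"
  shows "integrable lborel (\<lambda>x. (norm (grad \<theta> x))\<^sup>2)"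
proof (rule integrable_compact_support)
  show "compact (closure {x. \<theta> x \<noteq> 0})" using assms by (simp add: test_fun_def)
  show "continuous_on (closure {x. \<theta> x \<noteq> 0}) (\<lambda>x. (norm (grad \<theta> x))\<^sup>2)"
    by (intro continuous_intros continuous_on_grad test_fun_C_k[OF assms])
qed (use grad_outside_support[OF assms] in simp)

lemma test_fun_energy_set_integrable:
  assumes "test_fun U \<theta>" "open \<Omega>"
  shows "set_integrable lborel \<Omega> (\<lambda>x. (norm (grad \<theta> x))\<^sup>2)"
    and "(LINT x:\<Omega>|lborel. (norm (grad \<theta> x))\<^sup>2) \<le> (\<integral>x. (norm (grad \<theta> x))\<^sup>2 \<partial>lborel)"
proof -
  show i: "set_integrable lborel \<Omega> (\<lambda>x. (norm (grad \<theta> x))\<^sup>2)"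
    unfolding set_integrable_def using assms(2) by (intro integrable_mult_indicator test_fun_energy_integrable[OF assms(1)]) auto
  show "(LINT x:\<Omega>|lborel. (norm (grad \<theta> x))\<^sup>2) \<le> (\<integral>x. (norm (grad \<theta> x))\<^sup>2 \<partial>lborel)"
    unfolding set_lebesgue_integral_def
    by (intro integral_mono i[unfolded set_integrable_def] test_fun_energy_integrable[OF assms(1)])
       (auto simp: indicator_def)
qed

lemma cap_admissible_test_fun:
  assumes \<Omega>: "open \<Omega>" and \<theta>: "test_fun U \<theta>" "\<And>x. 0 \<le> \<theta> x" and F0: "F0 \<inter> U = {}"
    and W: "open W" "F1 \<subseteq> W" "\<And>x. x \<in> W \<Longrightarrow> 1 \<le> \<theta> x"
  shows "cap_admissible F0 F1 \<Omega> \<theta> (grad \<theta>)"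
proof -
  let ?U = "- closure {x. \<theta> x \<noteq> 0}"
  have C1: "C_k 1 \<theta>" by (rule test_fun_C_k[OF \<theta>(1)])
  have "open ?U" by auto
  moreover have "F0 \<subseteq> ?U" using \<theta>(1) F0 unfolding test_fun_def by blast
  moreover have "\<forall>x\<in>?U \<inter> \<Omega>. \<theta> x = 0" using closure_subset[of "{x. \<theta> x \<noteq> 0}"] by auto
  moreover have "\<forall>x\<in>W \<inter> \<Omega>. 1 \<le> \<theta> x" using W(3) by auto
  ultimately show ?thesis unfolding cap_admissible_def
    using W(1,2) \<theta>(2) continuous_on_C_k[OF C1] weak_gradient_C1[OF C1] test_fun_energy_set_integrable(1)[OF \<theta>(1) \<Omega>] by blast
qed

text \<open>An open set is disjoint from its frontier, so a cutoff supported in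
  \<open>\<Omega>\<close> vanishes near \<open>frontier \<Omega>\<close>. The intermediate
  \<open>K\<close> allows \<open>A\<close> to be non-compact, such as a curve cut by the open set
  \<open>V\<close>.\<close>

lemma cap_admissible_frontier_exists:
  assumes \<Omega>: "open \<Omega>" and K: "compact K" "K \<subseteq> \<Omega>" "A \<subseteq> K"
  shows "\<exists>v g. cap_admissible (frontier \<Omega>) A \<Omega> v g"
proof -
  obtain \<theta> W where \<theta>: "test_fun \<Omega> \<theta>" "\<And>x. 0 \<le> \<theta> x" "\<And>x. \<theta> x \<le> 1"
    "open W" "K \<subseteq> W" "\<And>x. x \<in> W \<Longrightarrow> \<theta> x = 1" using cutoff_exists[OF K(1) \<Omega> K(2)] by metis
  have "frontier \<Omega> \<inter> \<Omega> = {}" using \<Omega> by (simp add: frontier_disjoint_eq)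
  then have "cap_admissible (frontier \<Omega>) A \<Omega> \<theta> (grad \<theta>)"
    using \<theta> K(3) by (intro cap_admissible_test_fun[OF \<Omega> \<theta>(1,2), of _ W]) auto
  then show ?thesis by blast
qed

lemma grad_diff_const:
  assumes "C_k 1 f"
  shows "grad (\<lambda>x. c - f x) x = - grad f x"
proof -
  have "(f has_derivative frechet_derivative f (at x)) (at x)"
    using assms unfolding One_nat_def by (rule C_1_has_derivative)
  then have "((\<lambda>x. c - f x) has_derivative (\<lambda>h. - frechet_derivative f (at x) h)) (at x)"
    by (auto intro!: derivative_eq_intros)
  from frechet_derivative_at[OF this, symmetric] show ?thesis by (simp add: grad_def sum_negf)
qed

text \<open>One minus a cutoff of \<open>F\<close> inside \<open>V\<close>. The support of the
  cutoff is a closed subset of \<open>V\<close>, so \<open>A\<close> may well touch the boundary of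
  \<open>V\<close>.\<close>

lemma cap_admissible_outside_exists:
  assumes \<Omega>: "open \<Omega>" and F: "compact F" "F \<subseteq> V" "open V" and A: "A \<inter> V = {}"
  shows "\<exists>v g. cap_admissible F A \<Omega> v g"
proof -
  obtain \<theta> W where \<theta>: "test_fun V \<theta>" "\<And>x. 0 \<le> \<theta> x" "\<And>x. \<theta> x \<le> 1"
    "open W" "F \<subseteq> W" "\<And>x. x \<in> W \<Longrightarrow> \<theta> x = 1" using cutoff_exists[OF F(1,3,2)] by metis
  let ?v = "\<lambda>x. 1 - \<theta> x" and ?U = "- closure {x. \<theta> x \<noteq> 0}"
  have C1: "C_k 1 \<theta>" by (rule test_fun_C_k[OF \<theta>(1)])
  have C1': "C_k 1 ?v" by (intro C_k_diff C_k_const C1)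
  have "open ?U" by auto
  moreover have "A \<subseteq> ?U" using \<theta>(1) A unfolding test_fun_def by blast
  moreover have "\<forall>x\<in>?U \<inter> \<Omega>. 1 \<le> ?v x"
  proof
    fix x assume "x \<in> ?U \<inter> \<Omega>"
    then have "\<theta> x = 0" using closure_subset[of "{x. \<theta> x \<noteq> 0}"] by auto
    then show "1 \<le> ?v x" by simp
  qed
  moreover have "\<forall>x\<in>W \<inter> \<Omega>. ?v x = 0" using \<theta>(6) by auto
  moreover have "set_integrable lborel \<Omega> (\<lambda>x. (norm (grad ?v x))\<^sup>2)"
    using test_fun_energy_set_integrable(1)[OF \<theta>(1) \<Omega>] by (simp add: grad_diff_const[OF C1])
  moreover have "\<forall>x\<in>\<Omega>. 0 \<le> ?v x" using \<theta>(3) by simp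
  ultimately have "cap_admissible F A \<Omega> ?v (grad ?v)" unfolding cap_admissible_def
    using \<theta>(4,5) continuous_on_C_k[OF C1'] weak_gradient_C1[OF C1'] by blast
  then show ?thesis by blast
qed

text \<open>The bound \<open>M / r\<close> on a set of area of order \<open>r\<^sup>2\<close> makes
  the energy of a bump independent of its scale; this is special to dimension two and the reason why
  points have zero capacity.\<close>

lemma scaled_bump_exists:
  "\<exists>M. \<forall>a r. r > 0 \<longrightarrow> (\<exists>\<psi>. smooth_fun \<psi> \<and> (\<forall>x. 0 \<le> \<psi> x) \<and> (\<forall>x\<in>cball a r. \<psi> x = 1) \<and>
     (\<forall>x. x \<notin> cball a (2 * r) \<longrightarrow> \<psi> x = 0) \<and> (\<forall>x. norm (grad \<psi> x) \<le> M / r))"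
proof -
  obtain \<psi> :: "real^2 \<Rightarrow> real" where \<psi>: "smooth_fun \<psi>" "\<And>x. 0 \<le> \<psi> x" "\<And>x. \<psi> x \<le> 1"
    "\<And>x. norm x \<le> 1 \<Longrightarrow> \<psi> x = 1" "\<And>x. 2 \<le> norm x \<Longrightarrow> \<psi> x = 0"
    "\<And>x. \<psi> (- x) = \<psi> x"
    using unit_bump_exists by metis
  have C1: "C_k 1 \<psi>" using \<psi>(1) by (simp only: smooth_fun_def)
  have "compact (grad \<psi> ` cball 0 2)" by (intro compact_continuous_image continuous_on_grad C1 compact_cball)
  then obtain M where M: "\<forall>z\<in>grad \<psi> ` cball 0 2. norm z \<le> M" using compact_imp_bounded bounded_iff by metis
  have "norm (grad \<psi> 0) \<le> M" using M by auto
  then have M0: "0 \<le> M" using norm_ge_zero order_trans by blast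
  have Mx: "norm (grad \<psi> x) \<le> M" for x
  proof (cases "x \<in> cball 0 2")
    case False
    have "grad \<psi> x = 0"
      using \<psi>(5) False by (intro grad_locally_const[of "- cball 0 2" x \<psi> 0]) auto
    then show ?thesis using M0 by simp
  qed (use M in blast)
  show ?thesis
  proof (intro exI[of _ M] allI impI)
    fix a :: "real^2" and r :: real assume r: "r > 0"
    let ?A = "\<lambda>x. (1 / r) *\<^sub>R x + (- (1 / r) *\<^sub>R a)"
    have n: "norm (?A x) = dist a x / r" for x
    proof -
      have "?A x = (1 / r) *\<^sub>R (x - a)" by (simp add: algebra_simps)
      then show ?thesis using r by (simp add: dist_norm norm_minus_commute)
    qed
    have D: "(\<psi> has_derivative frechet_derivative \<psi> (at x)) (at x)" for x
      using C1 unfolding One_nat_def by (rule C_1_has_derivative)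
    have g: "grad (\<lambda>x. \<psi> (?A x)) x = (1 / r) *\<^sub>R grad \<psi> (?A x)" for x
    proof -
      have "(?A has_derivative (\<lambda>h. (1 / r) *\<^sub>R h)) (at x)" by (auto intro!: derivative_eq_intros)
      from frechet_derivative_at[OF has_derivative_compose[OF this D], symmetric]
      have "frechet_derivative (\<lambda>x. \<psi> (?A x)) (at x) = (\<lambda>h. frechet_derivative \<psi> (at (?A x)) ((1 / r) *\<^sub>R h))" .
      then show ?thesis
        using linear_scale[OF has_derivative_linear[OF D]] by (simp add: grad_def scaleR_sum_right)
    qed
    show "\<exists>\<psi>. smooth_fun \<psi> \<and> (\<forall>x. 0 \<le> \<psi> x) \<and> (\<forall>x\<in>cball a r. \<psi> x = 1) \<and>
     (\<forall>x. x \<notin> cball a (2 * r) \<longrightarrow> \<psi> x = 0) \<and> (\<forall>x. norm (grad \<psi> x) \<le> M / r)"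
    proof (intro exI[of _ "\<lambda>x. \<psi> (?A x)"] conjI allI ballI impI)
      show "smooth_fun (\<lambda>x. \<psi> (?A x))" using \<psi>(1) unfolding smooth_fun_def by (blast intro: C_k_affine)
      show "\<psi> (?A x) = 1" if "x \<in> cball a r" for x
        using that r by (intro \<psi>(4), subst n) (simp add: field_simps)
      show "\<psi> (?A x) = 0" if "x \<notin> cball a (2 * r)" for x
        using that r by (intro \<psi>(5), subst n) (simp add: field_simps)
      show "norm (grad (\<lambda>x. \<psi> (?A x)) x) \<le> M / r" for x
        unfolding g using Mx[of "?A x"] r by (simp add: divide_right_mono)
    qed (use \<psi> in auto)
  qed
qed

lemma grad_add:
  assumes "C_k 1 f" "C_k 1 g"
  shows "grad (\<lambda>x. f x + g x) x = grad f x + grad g x"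
proof -
  have "(f has_derivative frechet_derivative f (at x)) (at x)" "(g has_derivative frechet_derivative g (at x)) (at x)"
    using assms unfolding One_nat_def by (auto intro: C_1_has_derivative simp del: C_k.simps)
  from frechet_derivative_at[OF has_derivative_add[OF this], symmetric] show ?thesis
    by (simp add: grad_def scaleR_add_left sum.distrib)
qed

text \<open>The summands are bumps on shrinking scales, each supported where the earlier ones are constant, so
  that the gradients have disjoint supports and the energies add up.\<close>

lemma nested_bumps:
  obtains C where "\<And>n a R. R > 0 \<Longrightarrow> \<exists>\<psi> \<rho>. \<rho> > 0 \<and> smooth_fun \<psi> \<and> (\<forall>x. 0 \<le> \<psi> x) \<and>
    (\<forall>x\<in>ball a \<rho>. \<psi> x = real n) \<and> (\<forall>x. x \<notin> cball a R \<longrightarrow> \<psi> x = 0) \<and>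
    (\<integral>x. (norm (grad \<psi> x))\<^sup>2 \<partial>lborel) \<le> real n * C"
proof -
  obtain M where M: "\<And>a r. r > 0 \<Longrightarrow> (\<exists>\<psi>. smooth_fun \<psi> \<and> (\<forall>x. 0 \<le> \<psi> x) \<and> (\<forall>x\<in>cball a r. \<psi> x = 1) \<and>
     (\<forall>x. x \<notin> cball a (2 * r) \<longrightarrow> \<psi> x = 0) \<and> (\<forall>x. norm (grad \<psi> x) \<le> M / r))"
    using scaled_bump_exists by blast
  have tf: "test_fun UNIV \<psi>" if "smooth_fun \<psi>" "\<forall>x. x \<notin> cball a R \<longrightarrow> \<psi> x = 0" for \<psi> a R
  proof -
    have "closure {x. \<psi> x \<noteq> 0} \<subseteq> cball a R" using that(2) by (intro closure_minimal) auto
    then show ?thesis using that(1) unfolding test_fun_def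
      by (meson bounded_cball bounded_subset closed_closure compact_eq_bounded_closed subset_UNIV)
  qed
  have C1: "C_k 1 \<psi>" if "smooth_fun \<psi>" for \<psi> using that by (simp only: smooth_fun_def)
  show thesis
  proof (rule that[of "16 * M\<^sup>2"])
    fix n :: nat and a :: "real^2" and R :: real assume R: "R > 0"
    show "\<exists>\<psi> \<rho>. \<rho> > 0 \<and> smooth_fun \<psi> \<and> (\<forall>x. 0 \<le> \<psi> x) \<and>
      (\<forall>x\<in>ball a \<rho>. \<psi> x = real n) \<and> (\<forall>x. x \<notin> cball a R \<longrightarrow> \<psi> x = 0) \<and>
      (\<integral>x. (norm (grad \<psi> x))\<^sup>2 \<partial>lborel) \<le> real n * (16 * M\<^sup>2)"
    proof (induction n)
      case 0
      have "grad (\<lambda>x. 0) = (\<lambda>x. 0)" by (simp add: grad_def fun_eq_iff)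
      then show ?case using R by (intro exI[of _ "\<lambda>x. 0"] exI[of _ 1]) (simp add: smooth_fun_def)
    next
      case (Suc n)
      then obtain \<psi> \<rho> where \<psi>: "\<rho> > 0" "smooth_fun \<psi>" "\<forall>x. 0 \<le> \<psi> x" "\<forall>x\<in>ball a \<rho>. \<psi> x = real n"
        "\<forall>x. x \<notin> cball a R \<longrightarrow> \<psi> x = 0" "(\<integral>x. (norm (grad \<psi> x))\<^sup>2 \<partial>lborel) \<le> real n * (16 * M\<^sup>2)" by blast
      \<comment> \<open>The new bump lives in radius \<open>2 * r\<close>, which is below
        \<open>\<rho>\<close>, hence where \<open>\<psi>\<close> is constant.\<close>
      define r where "r = min \<rho> R / 4"
      have r: "r > 0" "2 * r < \<rho>" "2 * r \<le> R" using \<psi>(1) R by (auto simp: r_def)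
      obtain \<eta> where \<eta>: "smooth_fun \<eta>" "\<forall>x. 0 \<le> \<eta> x" "\<forall>x\<in>cball a r. \<eta> x = 1"
        "\<forall>x. x \<notin> cball a (2 * r) \<longrightarrow> \<eta> x = 0" "\<forall>x. norm (grad \<eta> x) \<le> M / r" using M[OF r(1), of a] by blast
      \<comment> \<open>The squared gradient bound \<open>(M / r)\<^sup>2\<close> times the area of
        a square of side \<open>4 * r\<close>.\<close>
      have e\<eta>: "(\<integral>x. (norm (grad \<eta> x))\<^sup>2 \<partial>lborel) \<le> 16 * M\<^sup>2"
      proof -
        have i: "integrable lborel (\<lambda>x. (M / r)\<^sup>2 * indicator (square a (2 * r)) x)"
          unfolding square_eq_cbox by (intro integrable_mult_right integrable_real_indicator) (auto simp: emeasure_lborel_cbox_eq)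
        have z: "grad \<eta> x = 0" if "x \<notin> square a (2 * r)" for x
        proof (rule grad_locally_const[of "- square a (2 * r)" x \<eta> 0])
          show "open (- square a (2 * r))" using compact_imp_closed[OF compact_square] by auto
          fix y assume "y \<in> - square a (2 * r)"
          then have "y \<notin> cball a (2 * r)"
            using component_le_norm_cart[of "y - a" 1] component_le_norm_cart[of "y - a" 2]
            by (auto simp: square_def supd_def dist_norm norm_minus_commute)
          then show "\<eta> y = 0" using \<eta>(4) by blast
        qed (use that in auto)
        have "(norm (grad \<eta> x))\<^sup>2 \<le> (M / r)\<^sup>2 * indicator (square a (2 * r)) x" for x
          using \<eta>(5) z[of x] by (cases "x \<in> square a (2 * r)") (auto intro!: power_mono)
        then have "(\<integral>x. (norm (grad \<eta> x))\<^sup>2 \<partial>lborel) \<le> (\<integral>x. (M / r)\<^sup>2 * indicator (square a (2 * r)) x \<partial>lborel)"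
          by (intro integral_mono i test_fun_energy_integrable[OF tf[OF \<eta>(1,4)]])
        also have "\<dots> = (M / r)\<^sup>2 * measure lborel (square a (2 * r))" by simp
        also have "measure lborel (square a (2 * r)) = (4 * r) * (4 * r)"
        proof -
          have "a \<in> square a (2 * r)" using r by (simp add: square_def supd_def)
          then show ?thesis unfolding square_eq_cbox
            by (subst content_cbox_cart) (auto simp: UNIV_2)
        qed
        also have "(M / r)\<^sup>2 * ((4 * r) * (4 * r)) = 16 * M\<^sup>2" using r by (simp add: power2_eq_square)
        finally show ?thesis .
      qed
      let ?f = "\<lambda>x. \<psi> x + \<eta> x"
      \<comment> \<open>At each point one of the two gradients vanishes, so there is no cross
        term.\<close>
      have "(norm (grad ?f x))\<^sup>2 = (norm (grad \<psi> x))\<^sup>2 + (norm (grad \<eta> x))\<^sup>2" for x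
      proof (cases "x \<in> ball a \<rho>")
        case True
        have "grad \<psi> x = 0" using \<psi>(4) True by (intro grad_locally_const[of "ball a \<rho>" x \<psi> "real n"]) auto
        then show ?thesis by (simp add: grad_add[OF C1[OF \<psi>(2)] C1[OF \<eta>(1)]])
      next
        case False
        have "grad \<eta> x = 0" using \<eta>(4) False r(2) by (intro grad_locally_const[of "- cball a (2 * r)" x \<eta> 0]) auto
        then show ?thesis by (simp add: grad_add[OF C1[OF \<psi>(2)] C1[OF \<eta>(1)]])
      qed
      then have "(\<integral>x. (norm (grad ?f x))\<^sup>2 \<partial>lborel) = (\<integral>x. (norm (grad \<psi> x))\<^sup>2 \<partial>lborel) + (\<integral>x. (norm (grad \<eta> x))\<^sup>2 \<partial>lborel)"
        using test_fun_energy_integrable[OF tf[OF \<psi>(2,5)]] test_fun_energy_integrable[OF tf[OF \<eta>(1,4)]] by simp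
      also have "\<dots> \<le> real (Suc n) * (16 * M\<^sup>2)" using \<psi>(6) e\<eta> by (simp add: distrib_right)
      finally have E: "(\<integral>x. (norm (grad ?f x))\<^sup>2 \<partial>lborel) \<le> real (Suc n) * (16 * M\<^sup>2)" .
      have "smooth_fun ?f" using \<psi>(2) \<eta>(1) unfolding smooth_fun_def by (blast intro: C_k_add)
      moreover have "\<forall>x\<in>ball a r. ?f x = real (Suc n)" using \<psi>(4) \<eta>(3) r by auto
      moreover have "\<forall>x. x \<notin> cball a R \<longrightarrow> ?f x = 0" using \<psi>(5) \<eta>(4) r by auto
      moreover have "\<forall>x. 0 \<le> ?f x" using \<psi>(3) \<eta>(2) by simp
      ultimately show ?case using r(1) E by (intro exI[of _ ?f] exI[of _ r]) blast
    qed
  qed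
qed

text \<open>The tower of \<open>n\<close> bumps has energy at most \<open>n * C\<close>; dividing by
  its height \<open>n\<close> divides the energy by the square of \<open>n\<close>, leaving
  \<open>C / n\<close>.\<close>

lemma conf_cap_point:
  assumes \<Omega>: "open \<Omega>" and U: "open U" "a \<in> U" "F \<inter> U = {}"
  shows "conf_cap F {a} \<Omega> = 0"
proof -
  obtain C where C: "\<And>n a R. R > 0 \<Longrightarrow> \<exists>\<psi> \<rho>. \<rho> > 0 \<and> smooth_fun \<psi> \<and> (\<forall>x. 0 \<le> \<psi> x) \<and>
    (\<forall>x\<in>ball a \<rho>. \<psi> x = real n) \<and> (\<forall>x. x \<notin> cball a R \<longrightarrow> \<psi> x = 0) \<and>
    (\<integral>x. (norm (grad \<psi> x))\<^sup>2 \<partial>lborel) \<le> real n * C" using nested_bumps by blast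
  obtain R where R: "R > 0" "cball a R \<subseteq> U" using open_contains_cball_eq[OF U(1)] U(2) by blast
  have ex: "\<exists>v g. cap_admissible F {a} \<Omega> v g \<and> (LINT x:\<Omega>|lborel. (norm (g x))\<^sup>2) \<le> C / real n" if n: "n > 0" for n
  proof -
    obtain \<psi> \<rho> where \<psi>: "\<rho> > 0" "smooth_fun \<psi>" "\<forall>x. 0 \<le> \<psi> x" "\<forall>x\<in>ball a \<rho>. \<psi> x = real n"
        "\<forall>x. x \<notin> cball a R \<longrightarrow> \<psi> x = 0" "(\<integral>x. (norm (grad \<psi> x))\<^sup>2 \<partial>lborel) \<le> real n * C" using C[OF R(1), of a n] by blast
    have cl: "closure {x. \<psi> x \<noteq> 0} \<subseteq> cball a R" using \<psi>(5) by (intro closure_minimal) auto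
    then have tf: "test_fun U \<psi>" using \<psi>(2) R(2) unfolding test_fun_def
      by (meson bounded_cball bounded_subset closed_closure compact_eq_bounded_closed order_trans)
    have C1: "C_k 1 \<psi>" by (rule test_fun_C_k[OF tf])
    let ?v = "\<lambda>x. (1 / real n) * \<psi> x" and ?g = "\<lambda>x. (1 / real n) *\<^sub>R grad \<psi> x"
    have ng: "(norm (?g x))\<^sup>2 = (1 / real n)\<^sup>2 * (norm (grad \<psi> x))\<^sup>2" for x by (simp add: power_mult_distrib power_divide)
    have "cap_admissible F {a} \<Omega> ?v ?g"
      unfolding cap_admissible_def
    proof (intro conjI)
      show "continuous_on \<Omega> ?v" by (intro continuous_intros continuous_on_C_k[OF C1])
      show "\<forall>x\<in>\<Omega>. 0 \<le> ?v x" using \<psi>(3) by simp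
      show "weak_gradient \<Omega> ?v ?g" by (intro weak_gradient_cmult weak_gradient_C1 C1)
      show "set_integrable lborel \<Omega> (\<lambda>x. (norm (?g x))\<^sup>2)"
        unfolding ng by (intro set_integrable_mult_right test_fun_energy_set_integrable(1)[OF tf \<Omega>])
      show "\<exists>U. open U \<and> F \<subseteq> U \<and> (\<forall>x\<in>U \<inter> \<Omega>. ?v x = 0)"
        using \<psi>(5) R(2) U(3) by (intro exI[of _ "- cball a R"]) auto
      show "\<exists>U. open U \<and> {a} \<subseteq> U \<and> (\<forall>x\<in>U \<inter> \<Omega>. 1 \<le> ?v x)"
        using \<psi>(1,4) n by (intro exI[of _ "ball a \<rho>"]) auto
    qed
    moreover have "(LINT x:\<Omega>|lborel. (norm (?g x))\<^sup>2) \<le> C / real n"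
    proof -
      have "(LINT x:\<Omega>|lborel. (norm (?g x))\<^sup>2) = (1 / real n)\<^sup>2 * (LINT x:\<Omega>|lborel. (norm (grad \<psi> x))\<^sup>2)"
        unfolding ng by (rule set_integral_mult_right)
      also have "\<dots> \<le> (1 / real n)\<^sup>2 * (real n * C)"
        using order_trans[OF test_fun_energy_set_integrable(2)[OF tf \<Omega>] \<psi>(6)] by (rule mult_left_mono) simp
      also have "\<dots> = C / real n" using n by (simp add: power2_eq_square)
      finally show ?thesis .
    qed
    ultimately show ?thesis by blast
  qed
  have le: "conf_cap F {a} \<Omega> \<le> C / real n" if "n > 0" for n
    using ex[OF that] conf_cap_le by (meson order_trans)
  have "(\<lambda>n. C / real (Suc n)) \<longlonglongrightarrow> 0"
    using LIMSEQ_Suc[OF lim_const_over_n[of C]] by simp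
  then have "conf_cap F {a} \<Omega> \<le> 0"
    by (rule LIMSEQ_le_const) (use le[OF zero_less_Suc] in blast)
  moreover have "0 \<le> conf_cap F {a} \<Omega>" using ex[OF zero_less_one] conf_cap_nonneg by blast
  ultimately show ?thesis by simp
qed

lemma conf_cap_empty:
  assumes "open \<Omega>"
  shows "conf_cap F {} \<Omega> = 0"
proof -
  have "cap_admissible F {} \<Omega> (\<lambda>x. 0) (\<lambda>x. 0)"
    unfolding cap_admissible_def
  proof (intro conjI)
    have "grad (\<lambda>x. 0) = (\<lambda>x. 0)" by (simp add: grad_def fun_eq_iff)
    then show "weak_gradient \<Omega> (\<lambda>x. 0) (\<lambda>x. 0)" using weak_gradient_C1[of "\<lambda>x. 0" \<Omega>] by simp
  qed (auto simp: set_integrable_def)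
  from conf_cap_le[OF this] conf_cap_nonneg[OF this] show ?thesis by (simp add: set_lebesgue_integral_def)
qed

subsection \<open>Rectifiable paths\<close>

lemma rectifiable_linepath: "rectifiable_path (linepath a b)"
  unfolding rectifiable_path_def
proof (intro conjI exI[of _ "dist b a"] allI impI; (elim conjE)?)
  fix n and t :: "nat \<Rightarrow> real"
  assume t: "t 0 = 0" "t n = 1" "\<forall>i<n. t i \<le> t (Suc i)"
  have d: "dist (linepath a b s) (linepath a b u) = \<bar>s - u\<bar> * dist b a" for s u
  proof -
    have "linepath a b s - linepath a b u = (s - u) *\<^sub>R (b - a)" by (simp add: linepath_def algebra_simps)
    then show ?thesis by (simp add: dist_norm)
  qed
  have "(\<Sum>i<n. dist (linepath a b (t (Suc i))) (linepath a b (t i))) = (\<Sum>i<n. (t (Suc i) - t i) * dist b a)"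
    using t(3) by (intro sum.cong) (auto simp: d)
  also have "\<dots> = (t n - t 0) * dist b a"
    by (simp add: sum_distrib_right[symmetric] sum_lessThan_telescope)
  finally show "(\<Sum>i<n. dist (linepath a b (t (Suc i))) (linepath a b (t i))) \<le> dist b a" using t by simp
qed simp

lemma rectifiable_reversepath:
  assumes "rectifiable_path p"
  shows "rectifiable_path (reversepath p)"
proof -
  obtain B where p: "path p" and B: "\<And>(n::nat) t. t 0 = 0 \<Longrightarrow> t n = 1 \<Longrightarrow> (\<forall>i<n. t i \<le> t (Suc i)) \<Longrightarrow>
      (\<Sum>i<n. dist (p (t (Suc i))) (p (t i))) \<le> B" using assms unfolding rectifiable_path_def by blast
  show ?thesis unfolding rectifiable_path_def
  proof (intro conjI exI[of _ B] allI impI; (elim conjE)?)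
    show "path (reversepath p)" using p by simp
    fix n and t :: "nat \<Rightarrow> real"
    assume t: "t 0 = 0" "t n = 1" "\<forall>i<n. t i \<le> t (Suc i)"
    \<comment> \<open>The reversed partition, again increasing from 0 to 1.\<close>
    let ?t = "\<lambda>i. 1 - t (n - i)"
    have mono: "\<forall>i<n. ?t i \<le> ?t (Suc i)"
    proof (intro allI impI)
      fix i assume "i < n"
      then show "?t i \<le> ?t (Suc i)" using t(3)[rule_format, of "n - Suc i"] by (simp add: Suc_diff_Suc)
    qed
    have "(\<Sum>i<n. dist (reversepath p (t (Suc i))) (reversepath p (t i)))
        = (\<Sum>i<n. dist (reversepath p (t (Suc (n - Suc i)))) (reversepath p (t (n - Suc i))))"
      by (rule sum.nat_diff_reindex[symmetric])
    also have "\<dots> = (\<Sum>i<n. dist (p (?t (Suc i))) (p (?t i)))"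
      by (intro sum.cong) (auto simp: reversepath_def Suc_diff_Suc dist_commute)
    also have "\<dots> \<le> B" using t mono by (intro B) auto
    finally show "(\<Sum>i<n. dist (reversepath p (t (Suc i))) (reversepath p (t i))) \<le> B" .
  qed
qed

lemma rectifiable_joinpaths:
  assumes "rectifiable_path p" "rectifiable_path q" "pathfinish p = pathstart q"
  shows "rectifiable_path (p +++ q)"
proof -
  obtain B where p: "path p" and B: "\<And>(n::nat) t. t 0 = 0 \<Longrightarrow> t n = 1 \<Longrightarrow> (\<forall>i<n. t i \<le> t (Suc i)) \<Longrightarrow>
      (\<Sum>i<n. dist (p (t (Suc i))) (p (t i))) \<le> B" using assms(1) unfolding rectifiable_path_def by blast
  obtain B' where q: "path q" and B': "\<And>(n::nat) t. t 0 = 0 \<Longrightarrow> t n = 1 \<Longrightarrow> (\<forall>i<n. t i \<le> t (Suc i)) \<Longrightarrow>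
      (\<Sum>i<n. dist (q (t (Suc i))) (q (t i))) \<le> B'" using assms(2) unfolding rectifiable_path_def by blast
  have pq: "p 1 = q 0" using assms(3) by (simp add: pathfinish_def pathstart_def)
  show ?thesis unfolding rectifiable_path_def
  proof (intro conjI exI[of _ "B + B'"] allI impI; (elim conjE)?)
    show "path (p +++ q)" using p q assms(3) by simp
    fix n and t :: "nat \<Rightarrow> real"
    assume t: "t 0 = 0" "t n = 1" "\<forall>i<n. t i \<le> t (Suc i)"
    \<comment> \<open>Clamping turns one partition into partitions for \<open>p\<close> and for
      \<open>q\<close>, each constant while the other path is traversed; a step across
      \<open>1 / 2\<close> is split at the common point.\<close>
    let ?s = "\<lambda>i. min 1 (2 * t i)" and ?u = "\<lambda>i. max 0 (2 * t i - 1)"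
    have le: "dist ((p +++ q) (t (Suc i))) ((p +++ q) (t i))
        \<le> dist (p (?s (Suc i))) (p (?s i)) + dist (q (?u (Suc i))) (q (?u i))" if i: "i < n" for i
    proof -
      have ti: "t i \<le> t (Suc i)" using t(3) i by blast
      consider "t (Suc i) \<le> 1 / 2" | "t i \<le> 1 / 2" "t (Suc i) > 1 / 2" | "t i > 1 / 2" by linarith
      then show ?thesis
      proof cases
        case 1
        then have "?s (Suc i) = 2 * t (Suc i)" "?s i = 2 * t i" using ti by auto
        then show ?thesis using 1 ti by (simp add: joinpaths_def)
      next
        case 2
        then have "?s (Suc i) = 1" "?s i = 2 * t i" "?u (Suc i) = 2 * t (Suc i) - 1" "?u i = 0" by auto
        then show ?thesis using 2 dist_triangle[of "q (2 * t (Suc i) - 1)" "p (2 * t i)" "p 1"] pq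
          by (simp add: joinpaths_def)
      next
        case 3
        then have "?u (Suc i) = 2 * t (Suc i) - 1" "?u i = 2 * t i - 1" using ti by auto
        then show ?thesis using 3 ti by (simp add: joinpaths_def)
      qed
    qed
    have "(\<Sum>i<n. dist ((p +++ q) (t (Suc i))) ((p +++ q) (t i)))
        \<le> (\<Sum>i<n. dist (p (?s (Suc i))) (p (?s i)) + dist (q (?u (Suc i))) (q (?u i)))"
      using le by (intro sum_mono) auto
    also have "\<dots> = (\<Sum>i<n. dist (p (?s (Suc i))) (p (?s i))) + (\<Sum>i<n. dist (q (?u (Suc i))) (q (?u i)))"
      by (rule sum.distrib)
    also have "\<dots> \<le> B + B'"
    proof (intro add_mono B B')
      show "\<forall>i<n. ?s i \<le> ?s (Suc i)"
        using t(3) by (intro allI impI min.mono) auto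
      show "\<forall>i<n. ?u i \<le> ?u (Suc i)"
        using t(3) by (intro allI impI max.mono) auto
    qed (use t in auto)
    finally show "(\<Sum>i<n. dist ((p +++ q) (t (Suc i))) ((p +++ q) (t i))) \<le> B + B'" .
  qed
qed

text \<open>Segments in small balls make the classes open, and joining and reversing make the
  relation an equivalence. Without such curves the infimum in \<open>cap_dist\<close> would be over
  an empty set.\<close>

lemma rectifiably_connected:
  fixes \<Omega> :: "(real^2) set"
  assumes "open \<Omega>" "connected \<Omega>" "a \<in> \<Omega>" "b \<in> \<Omega>"
  shows "\<exists>l. rectifiable_path l \<and> path_image l \<subseteq> \<Omega> \<and> pathstart l = a \<and> pathfinish l = b"
proof (rule connected_equivalence_relation[OF assms(2-4), where
      R = "\<lambda>a b. \<exists>l. rectifiable_path l \<and> path_image l \<subseteq> \<Omega> \<and> pathstart l = a \<and> pathfinish l = b"])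
  fix x y assume "\<exists>l. rectifiable_path l \<and> path_image l \<subseteq> \<Omega> \<and> pathstart l = x \<and> pathfinish l = y"
  then obtain l where "rectifiable_path l" "path_image l \<subseteq> \<Omega>" "pathstart l = x" "pathfinish l = y" by blast
  then show "\<exists>l. rectifiable_path l \<and> path_image l \<subseteq> \<Omega> \<and> pathstart l = y \<and> pathfinish l = x"
    by (intro exI[of _ "reversepath l"]) (auto intro: rectifiable_reversepath)
next
  fix x y z
  assume "\<exists>l. rectifiable_path l \<and> path_image l \<subseteq> \<Omega> \<and> pathstart l = x \<and> pathfinish l = y"
    "\<exists>l. rectifiable_path l \<and> path_image l \<subseteq> \<Omega> \<and> pathstart l = y \<and> pathfinish l = z"
  then obtain l m where "rectifiable_path l" "path_image l \<subseteq> \<Omega>" "pathstart l = x" "pathfinish l = y"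
    "rectifiable_path m" "path_image m \<subseteq> \<Omega>" "pathstart m = y" "pathfinish m = z" by blast
  then show "\<exists>l. rectifiable_path l \<and> path_image l \<subseteq> \<Omega> \<and> pathstart l = x \<and> pathfinish l = z"
    by (intro exI[of _ "l +++ m"]) (auto intro: rectifiable_joinpaths simp: path_image_join)
next
  fix a assume "a \<in> \<Omega>"
  then obtain r where r: "r > 0" "ball a r \<subseteq> \<Omega>" using assms(1) open_contains_ball by blast
  show "\<exists>T. openin (top_of_set \<Omega>) T \<and> a \<in> T \<and>
     (\<forall>x\<in>T. \<exists>l. rectifiable_path l \<and> path_image l \<subseteq> \<Omega> \<and> pathstart l = a \<and> pathfinish l = x)"
  proof (rule exI[of _ "ball a r"], intro conjI ballI)
    show "openin (top_of_set \<Omega>) (ball a r)" using r by (simp add: open_subset)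
    show a: "a \<in> ball a r" using r by simp
    fix x assume "x \<in> ball a r"
    then have "closed_segment a x \<subseteq> ball a r" using a by (intro closed_segment_subset convex_ball)
    then have "closed_segment a x \<subseteq> \<Omega>" using r(2) by blast
    then show "\<exists>l. rectifiable_path l \<and> path_image l \<subseteq> \<Omega> \<and> pathstart l = a \<and> pathfinish l = x"
      by (intro exI[of _ "linepath a x"]) (simp add: rectifiable_linepath)
  qed
qed

subsection \<open>Positivity\<close>

text \<open>Intermediate value theorem for the sup-norm distance from \<open>x\<close>.\<close>

lemma connected_meets_supd_sphere:
  assumes "connected S" "x \<in> S" "y \<in> S" "0 \<le> \<rho>" "\<rho> \<le> supd x y"
  shows "\<exists>p\<in>S. supd x p = \<rho>"
proof -
  have "connected (supd x ` S)" using continuous_on_supd assms(1) by (rule connected_continuous_image)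
  moreover have "supd x x = 0" by (simp add: supd_def)
  then have "0 \<in> supd x ` S" using assms(2) by (metis imageI)
  moreover have "supd x y \<in> supd x ` S" using assms(3) by blast
  ultimately have "{0..supd x y} \<subseteq> supd x ` S" by (rule connected_contains_Icc)
  then show ?thesis using assms(4,5) by (auto simp: subset_iff)
qed

lemma supd_pos: "x \<noteq> y \<Longrightarrow> 0 < supd x y"
  by (auto simp: supd_def vec_eq_iff forall_2 less_max_iff_disj)

text \<open>If \<open>v\<close> is \<open>L\<^sup>2\<close>-close to a constant \<open>k > 1/2\<close> on the support of the cutoff \<open>\<theta>\<close>, then
  \<open>((1 - \<theta>) v + \<theta> k) / k\<close> is a competitor for \<open>K\<close> of small energy.\<close>

lemma conf_cap_le_near_const:
  assumes \<Omega>: "open \<Omega>" and \<theta>: "test_fun \<Omega> \<theta>" "\<And>x. 0 \<le> \<theta> x" "\<And>x. \<theta> x \<le> 1"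
    and W: "open W" "K \<subseteq> W" "\<And>x. x \<in> W \<Longrightarrow> \<theta> x = 1"
    and M: "\<And>x. (norm (grad \<theta> x))\<^sup>2 \<le> M"
    and v: "cap_admissible (frontier \<Omega>) A \<Omega> v g" "(LINT x:\<Omega>|lborel. (norm (g x))\<^sup>2) \<le> e"
    and T: "compact T" "T \<subseteq> \<Omega>" "closure {x. \<theta> x \<noteq> 0} \<subseteq> T"
    and k: "(\<integral>\<^sup>+p\<in>T. ennreal ((v p - k)\<^sup>2) \<partial>lborel) \<le> ennreal (P * e)" "k > 1 / 2" and Pe: "0 \<le> P" "0 \<le> e"
  shows "conf_cap (frontier \<Omega>) K \<Omega> \<le> 8 * (1 + M * P) * e"
proof -
  have M0: "0 \<le> M" using M[of 0] zero_le_power2 order_trans by blast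
  have C1: "C_k 1 \<theta>" by (rule test_fun_C_k[OF \<theta>(1)])
  have cv: "continuous_on \<Omega> v" and v0: "\<forall>x\<in>\<Omega>. 0 \<le> v x" and wgv: "weak_gradient \<Omega> v g"
    and sg: "set_integrable lborel \<Omega> (\<lambda>x. (norm (g x))\<^sup>2)" using v(1) by (auto simp: cap_admissible_def)
  obtain U where U: "open U" "frontier \<Omega> \<subseteq> U" "\<forall>x\<in>U \<inter> \<Omega>. v x = 0" using v(1) by (auto simp: cap_admissible_def)
  have sm: "smooth_fun (\<lambda>x. 1 - \<theta> x)" using \<theta>(1) unfolding smooth_fun_def test_fun_def by (intro allI C_k_diff C_k_const) blast
  define w where "w = (\<lambda>x. (1 / k) * ((1 - \<theta> x) * v x) + \<theta> x)"
  define h where "h = (\<lambda>x. (1 / k) *\<^sub>R ((1 - \<theta> x) *\<^sub>R g x + v x *\<^sub>R grad (\<lambda>x. 1 - \<theta> x) x) + grad \<theta> x)"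
  have wg: "weak_gradient \<Omega> w h"
    unfolding w_def h_def
    by (intro weak_gradient_add weak_gradient_cmult weak_gradient_mult_smooth cv wgv sm weak_gradient_C1 C1)
  \<comment> \<open>The 8 is \<open>4 * 2\<close>: dividing by \<open>k > 1 / 2\<close> costs at
    most 4 in the square, and splitting the squared sum costs 2.\<close>
  define f where "f = (\<lambda>x. 8 * (norm (g x))\<^sup>2 + 8 * M * (indicator T x * (v x - k)\<^sup>2))"
  have hf: "(norm (h x))\<^sup>2 \<le> f x" for x
  proof -
    define G where "G = (1 - \<theta> x) *\<^sub>R g x + (k - v x) *\<^sub>R grad \<theta> x"
    \<comment> \<open>Because the gradient of \<open>1 - \<theta>\<close> is
      \<open>- grad \<theta>\<close>, the terms with \<open>grad \<theta>\<close> combine, and their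
      factor \<open>k - v x\<close> is exactly what is small on \<open>T\<close>.\<close>
    have "h x = (1 / k) *\<^sub>R G"
      unfolding h_def G_def using k(2) by (simp add: grad_diff_const[OF C1] algebra_simps)
    then have "(norm (h x))\<^sup>2 = (norm G)\<^sup>2 / k\<^sup>2" using k(2) by (simp add: power_divide)
    also have "\<dots> \<le> (norm G)\<^sup>2 / (1 / 2)\<^sup>2"
      using k(2) by (intro divide_left_mono power_mono) auto
    also have "\<dots> = 4 * (norm G)\<^sup>2" by (simp add: power2_eq_square)
    also have "(norm G)\<^sup>2 \<le> 2 * (norm ((1 - \<theta> x) *\<^sub>R g x))\<^sup>2 + 2 * (norm ((k - v x) *\<^sub>R grad \<theta> x))\<^sup>2"
    proof -
      let ?p = "norm ((1 - \<theta> x) *\<^sub>R g x)" and ?q = "norm ((k - v x) *\<^sub>R grad \<theta> x)"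
      have "(norm G)\<^sup>2 \<le> (?p + ?q)\<^sup>2" unfolding G_def by (intro power_mono norm_triangle_ineq) auto
      also have "\<dots> \<le> 2 * ?p\<^sup>2 + 2 * ?q\<^sup>2" using sum_squares_bound[of ?p ?q] by (simp only: power2_sum)
      finally show ?thesis .
    qed
    also have "(norm ((1 - \<theta> x) *\<^sub>R g x))\<^sup>2 \<le> (norm (g x))\<^sup>2"
    proof (rule power_mono)
      show "norm ((1 - \<theta> x) *\<^sub>R g x) \<le> norm (g x)" using \<theta>(2,3)[of x] by (simp add: mult_left_le_one_le)
    qed simp
    also have "(norm ((k - v x) *\<^sub>R grad \<theta> x))\<^sup>2 \<le> M * (indicator T x * (v x - k)\<^sup>2)"
    proof (cases "x \<in> T")
      case True
      have "(norm ((k - v x) *\<^sub>R grad \<theta> x))\<^sup>2 = (norm (grad \<theta> x))\<^sup>2 * (v x - k)\<^sup>2"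
        by (simp add: power_mult_distrib power2_commute mult.commute)
      also have "\<dots> \<le> M * (v x - k)\<^sup>2" using M by (rule mult_right_mono) simp
      finally show ?thesis using True by simp
    next
      case False
      then have "grad \<theta> x = 0" using T(3) by (intro grad_outside_support[OF \<theta>(1)]) blast
      then show ?thesis using False by simp
    qed
    finally show ?thesis unfolding f_def by (simp add: algebra_simps)
  qed
  have mT: "T \<in> sets borel" using compact_imp_closed[OF T(1)] by (rule borel_closed)
  have cT: "continuous_on T (\<lambda>x. (v x - k)\<^sup>2)"
    by (intro continuous_intros continuous_on_subset[OF cv T(2)])
  have iT: "integrable lborel (\<lambda>x. indicator T x * (v x - k)\<^sup>2)"
    using borel_integrable_compact[OF T(1) cT] by simp
  have eqT: "indicator \<Omega> x *\<^sub>R (indicator T x * (v x - k)\<^sup>2) = indicator T x * (v x - k)\<^sup>2" for x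
    using T(2) by (auto simp: indicator_def)
  have sT: "set_integrable lborel \<Omega> (\<lambda>x. indicator T x * (v x - k)\<^sup>2)"
    unfolding set_integrable_def eqT by (rule iT)
  have "ennreal (\<integral>x. indicator T x * (v x - k)\<^sup>2 \<partial>lborel) = (\<integral>\<^sup>+x. ennreal (indicator T x * (v x - k)\<^sup>2) \<partial>lborel)"
    using iT by (intro nn_integral_eq_integral[symmetric]) auto
  also have "\<dots> = (\<integral>\<^sup>+p\<in>T. ennreal ((v p - k)\<^sup>2) \<partial>lborel)"
    by (intro nn_integral_cong) (auto simp: indicator_def)
  also note k(1)
  finally have intT: "(\<integral>x. indicator T x * (v x - k)\<^sup>2 \<partial>lborel) \<le> P * e"
    using Pe by (simp add: ennreal_le_iff)
  have sf: "set_integrable lborel \<Omega> f"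
    unfolding f_def by (intro set_integral_add set_integrable_mult_right sg sT)
  have "(LINT x:\<Omega>|lborel. f x) = 8 * (LINT x:\<Omega>|lborel. (norm (g x))\<^sup>2) + 8 * M * (LINT x:\<Omega>|lborel. indicator T x * (v x - k)\<^sup>2)"
    unfolding f_def using sg sT by (subst set_integral_add) (auto intro: set_integrable_mult_right)
  also have "(LINT x:\<Omega>|lborel. indicator T x * (v x - k)\<^sup>2) = (\<integral>x. indicator T x * (v x - k)\<^sup>2 \<partial>lborel)"
    unfolding set_lebesgue_integral_def eqT ..
  also have "8 * (LINT x:\<Omega>|lborel. (norm (g x))\<^sup>2) + 8 * M * (\<integral>x. indicator T x * (v x - k)\<^sup>2 \<partial>lborel) \<le> 8 * e + 8 * M * (P * e)"
    using v(2) intT M0 by (intro add_mono mult_left_mono) auto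
  finally have ef: "(LINT x:\<Omega>|lborel. f x) \<le> 8 * (1 + M * P) * e" by (simp add: algebra_simps)
  note eb = energy_bound[OF \<Omega> wg sf hf]
  have "cap_admissible (frontier \<Omega>) K \<Omega> w h"
    unfolding cap_admissible_def
  proof (intro conjI wg eb)
    show "continuous_on \<Omega> w" unfolding w_def
      by (intro continuous_intros cv continuous_on_C_k[OF C1])
    show "\<forall>x\<in>\<Omega>. 0 \<le> w x" unfolding w_def using v0 \<theta>(2,3) k(2) by (auto intro!: add_nonneg_nonneg divide_nonneg_nonneg mult_nonneg_nonneg)
    show "\<exists>U. open U \<and> frontier \<Omega> \<subseteq> U \<and> (\<forall>x\<in>U \<inter> \<Omega>. w x = 0)"
    proof (intro exI[of _ "U - closure {x. \<theta> x \<noteq> 0}"] conjI ballI)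
      show "open (U - closure {x. \<theta> x \<noteq> 0})" using U(1) by (intro open_Diff) auto
      have "frontier \<Omega> \<inter> \<Omega> = {}" using \<Omega> by (simp add: frontier_disjoint_eq)
      then show "frontier \<Omega> \<subseteq> U - closure {x. \<theta> x \<noteq> 0}" using U(2) \<theta>(1) unfolding test_fun_def by blast
      fix x assume x: "x \<in> (U - closure {x. \<theta> x \<noteq> 0}) \<inter> \<Omega>"
      then have "\<theta> x = 0" using closure_subset[of "{x. \<theta> x \<noteq> 0}"] by auto
      moreover have "v x = 0" using x U(3) by blast
      ultimately show "w x = 0" by (simp add: w_def)
    qed
    show "\<exists>U. open U \<and> K \<subseteq> U \<and> (\<forall>x\<in>U \<inter> \<Omega>. 1 \<le> w x)"
      using W by (intro exI[of _ W]) (simp add: w_def)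
  qed
  from conf_cap_le[OF this] eb(2) ef show ?thesis by linarith
qed

text \<open>Return to ordinary reals: on a radius with line energy at most \<open>a * e / r\<close>
  the side length cancels, and a multiple of \<open>e\<close> remains.\<close>

lemma sq_le_of_good_radius:
  assumes "ennreal (x\<^sup>2) \<le> ennreal (16 * r) * Z + ennreal (C * e)" "Z \<le> ennreal (a * e / r)"
    "r > 0" "e > 0" "a \<ge> 0" "C \<ge> 0"
  shows "x\<^sup>2 \<le> (16 * a + C) * e"
proof -
  have "ennreal (x\<^sup>2) \<le> ennreal (16 * r) * ennreal (a * e / r) + ennreal (C * e)"
    using assms(1,2) by (meson add_right_mono mult_left_mono order_trans zero_le)
  also have "ennreal (16 * r) * ennreal (a * e / r) = ennreal (16 * a * e)"
    using assms by (simp add: ennreal_mult'[symmetric])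
  also have "ennreal (16 * a * e) + ennreal (C * e) = ennreal ((16 * a + C) * e)"
    using assms by (simp add: ennreal_plus[symmetric] distrib_right del: ennreal_plus)
  finally show ?thesis using assms by (simp add: ennreal_le_iff)
qed

text \<open>The bound \<open>\<delta>\<close> may depend on everything except the curve. It is
  \<open>sqrt e\<close> for an energy level \<open>e\<close> so low that competitors of energy below
  \<open>e\<close> for both capacities of one curve contradict each other.\<close>

lemma cap_sum_bounded_below:
  fixes \<Omega> F V :: "(real^2) set"
  assumes \<Omega>: "open \<Omega>" "connected \<Omega>"
    and K: "compact K" "K \<subseteq> \<Omega>" "conf_cap (frontier \<Omega>) K \<Omega> > 0"
    and F: "compact F" "connected F" "a \<in> F" "b \<in> F" "a \<noteq> b"
    and V: "open V" "F \<subseteq> V" "closure V \<subseteq> \<Omega>" "compact (closure V)"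
    and xy: "x \<in> \<Omega>" "x \<noteq> y"
  shows "\<exists>\<delta>>0. \<forall>l. path l \<and> path_image l \<subseteq> \<Omega> \<and> pathstart l = x \<and> pathfinish l = y \<longrightarrow>
    \<delta> \<le> sqrt (conf_cap F (path_image l - V) \<Omega>) + sqrt (conf_cap (frontier \<Omega>) (path_image l \<inter> V) \<Omega>)"
proof -
  define \<kappa> where "\<kappa> = conf_cap (frontier \<Omega>) K \<Omega>"
  have \<kappa>: "\<kappa> > 0" using K by (simp add: \<kappa>_def)
  obtain \<theta> W where \<theta>: "test_fun \<Omega> \<theta>" "\<And>x. 0 \<le> \<theta> x" "\<And>x. \<theta> x \<le> 1"
    "open W" "K \<subseteq> W" "\<And>x. x \<in> W \<Longrightarrow> \<theta> x = 1" using cutoff_exists[OF K(1) \<Omega>(1) K(2)] by metis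
  let ?S = "closure {x. \<theta> x \<noteq> 0}"
  have S: "compact ?S" "?S \<subseteq> \<Omega>" using \<theta>(1) by (auto simp: test_fun_def)
  have C1: "C_k 1 \<theta>" by (rule test_fun_C_k[OF \<theta>(1)])
  obtain M where M: "\<And>x. (norm (grad \<theta> x))\<^sup>2 \<le> M" "M \<ge> 0"
  proof -
    have "compact (grad \<theta> ` ?S)" by (intro compact_continuous_image continuous_on_grad C1 S)
    then obtain B where B: "\<forall>z\<in>grad \<theta> ` ?S. norm z \<le> B" using compact_imp_bounded bounded_iff by metis
    have "(norm (grad \<theta> x))\<^sup>2 \<le> B\<^sup>2" for x
      using B grad_outside_support[OF \<theta>(1), of x] by (cases "x \<in> ?S") (auto intro!: power_mono)
    then show ?thesis using that[of "B\<^sup>2"] by simp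
  qed
  have a\<Omega>: "a \<in> \<Omega>" using F(3) V(2,3) closure_subset by blast
  \<comment> \<open>As \<open>r\<close> does not exceed the distance to \<open>y\<close>, every
    curve from \<open>x\<close> to \<open>y\<close> meets each square boundary about
    \<open>x\<close> of radius at most \<open>r\<close>. The radius \<open>r'\<close> does the same
    for \<open>a\<close>, \<open>b\<close> and the connected set \<open>F\<close>.\<close>
  obtain r where r: "0 < r" "r \<le> supd x y" "square x r \<subseteq> \<Omega>"
    by (rule square_subset_open[OF \<Omega>(1) xy(1) supd_pos[OF xy(2)]])
  obtain r' where r': "0 < r'" "r' \<le> supd a b" "square a r' \<subseteq> \<Omega>"
    by (rule square_subset_open[OF \<Omega>(1) a\<Omega> supd_pos[OF F(5)]])
  have cT0: "compact (square x r \<union> square a r' \<union> ?S)" "square x r \<union> square a r' \<union> ?S \<subseteq> \<Omega>"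
    using compact_square S r r' by (auto intro!: compact_Un)
  \<comment> \<open>One Poincare set for all three places: the constant of \<open>v\<close> then
    serves both near \<open>x\<close> and near \<open>F\<close>, and the constant of
    \<open>w\<close> both near \<open>x\<close> and for pasting on the support of
    \<open>\<theta>\<close>.\<close>
  obtain T P where T: "poincare \<Omega> T P" "square x r \<union> square a r' \<union> ?S \<subseteq> T"
    using poincare_superset[OF \<Omega> cT0 a\<Omega>] by blast
  have T': "compact T" "T \<subseteq> \<Omega>" "P \<ge> 0" using T(1) by (auto simp: poincare_def)
  have Tsub: "square x r \<subseteq> T" "square a r' \<subseteq> T" "?S \<subseteq> T" using T(2) by auto
  obtain C where C: "C \<ge> 0" "\<And>v g e c. energy_le \<Omega> v g e \<Longrightarrow> e > 0 \<Longrightarrow>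
      (\<integral>\<^sup>+p\<in>T. ennreal ((v p - c)\<^sup>2) \<partial>lborel) \<le> ennreal (P * e) \<Longrightarrow>
      \<exists>Z. Z \<in> borel_measurable borel \<and> (\<integral>\<^sup>+\<rho>\<in>{0..r}. Z \<rho> \<partial>lborel) \<le> ennreal (4 * e) \<and>
      (\<forall>p\<in>square x r. ennreal ((v p - c)\<^sup>2) \<le> ennreal (16 * r) * Z (supd x p) + ennreal (C * e))"
    using square_estimate_common_const[OF \<Omega>(1) T'(1,2) r(1) Tsub(1) T'(3)] by blast
  obtain C' where C': "C' \<ge> 0" "\<And>v g e c. energy_le \<Omega> v g e \<Longrightarrow> e > 0 \<Longrightarrow>
      (\<integral>\<^sup>+p\<in>T. ennreal ((v p - c)\<^sup>2) \<partial>lborel) \<le> ennreal (P * e) \<Longrightarrow>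
      \<exists>Z. Z \<in> borel_measurable borel \<and> (\<integral>\<^sup>+\<rho>\<in>{0..r'}. Z \<rho> \<partial>lborel) \<le> ennreal (4 * e) \<and>
      (\<forall>p\<in>square a r'. ennreal ((v p - c)\<^sup>2) \<le> ennreal (16 * r') * Z (supd a p) + ennreal (C' * e))"
    using square_estimate_common_const[OF \<Omega>(1) T'(1,2) r'(1) Tsub(2) T'(3)] by blast
  \<comment> \<open>Dominates the constants returned by \<open>sq_le_of_good_radius\<close>:
    \<open>16 * 16 + C\<close> at \<open>x\<close>, where two functions share a radius, and
    \<open>16 * 8 + C'\<close> at \<open>a\<close>.\<close>
  define D where "D = 256 + C + C'"
  have D: "D > 0" "256 + C \<le> D" "128 + C' \<le> D" using C(1) C'(1) by (auto simp: D_def)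
  \<comment> \<open>The first entry makes squared deviations at most \<open>1 / 8\<close>, hence
    deviations below \<open>1 / 2\<close>; the second makes the capacity bound for \<open>K\<close>
    at most \<open>\<kappa> / 2\<close>.\<close>
  define e where "e = min (1 / (8 * D)) (\<kappa> / (16 * (1 + M * P)))"
  have MP: "1 + M * P > 0" using M(2) T'(3) by (simp add: add_pos_nonneg)
  have e: "e > 0" unfolding e_def using D(1) \<kappa> MP by simp
  have "e \<le> 1 / (8 * D)" by (simp add: e_def)
  then have De: "D * e \<le> 1 / 8" using D(1) by (simp add: field_simps)
  have "e \<le> \<kappa> / (16 * (1 + M * P))" by (simp add: e_def)
  then have "16 * (1 + M * P) * e \<le> \<kappa>" using MP by (simp add: pos_le_divide_eq mult.commute)
  moreover have "8 * (1 + M * P) * e < 16 * (1 + M * P) * e" using MP e by simp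
  ultimately have ke: "8 * (1 + M * P) * e < \<kappa>" by linarith
  have half: "\<bar>z\<bar> < 1 / 2" if "z\<^sup>2 \<le> E * e" "E \<le> D" for z E
  proof -
    have "z\<^sup>2 \<le> D * e" using that e by (meson mult_right_mono order_trans less_imp_le)
    also have "\<dots> < (1 / 2)\<^sup>2" using De by (simp add: power2_eq_square)
    finally have "\<bar>z\<bar>\<^sup>2 < (1 / 2)\<^sup>2" by simp
    then show ?thesis by (rule power_less_imp_less_base) simp
  qed
  show ?thesis
  proof (intro exI[of _ "sqrt e"] conjI allI impI; (elim conjE)?)
    show "sqrt e > 0" using e by simp
    fix l assume l: "path l" "path_image l \<subseteq> \<Omega>" "pathstart l = x" "pathfinish l = y"
    let ?A = "path_image l - V" and ?B = "path_image l \<inter> V"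
    have "?A \<inter> V = {}" by blast
    then obtain v0 g0 where A0: "cap_admissible F ?A \<Omega> v0 g0"
      using cap_admissible_outside_exists[OF \<Omega>(1) F(1) V(2,1)] by blast
    have "?B \<subseteq> closure V" using closure_subset by blast
    then obtain v0' g0' where B0: "cap_admissible (frontier \<Omega>) ?B \<Omega> v0' g0'"
      using cap_admissible_frontier_exists[OF \<Omega>(1) V(4,3)] by blast
    show "sqrt e \<le> sqrt (conf_cap F ?A \<Omega>) + sqrt (conf_cap (frontier \<Omega>) ?B \<Omega>)"
    proof (rule ccontr)
      assume "\<not> ?thesis"
      moreover have "0 \<le> sqrt (conf_cap F ?A \<Omega>)" "0 \<le> sqrt (conf_cap (frontier \<Omega>) ?B \<Omega>)"
        using conf_cap_nonneg[OF A0] conf_cap_nonneg[OF B0] by auto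
      ultimately have "sqrt (conf_cap F ?A \<Omega>) < sqrt e" "sqrt (conf_cap (frontier \<Omega>) ?B \<Omega>) < sqrt e" by linarith+
      then have less: "conf_cap F ?A \<Omega> < e" "conf_cap (frontier \<Omega>) ?B \<Omega> < e" by auto
      obtain v g where v: "cap_admissible F ?A \<Omega> v g" "(LINT x:\<Omega>|lborel. (norm (g x))\<^sup>2) < e"
        using conf_cap_lessD[OF A0 less(1)] by blast
      obtain w h where w: "cap_admissible (frontier \<Omega>) ?B \<Omega> w h" "(LINT x:\<Omega>|lborel. (norm (h x))\<^sup>2) < e"
        using conf_cap_lessD[OF B0 less(2)] by blast
      have ev: "energy_le \<Omega> v g e" and ew: "energy_le \<Omega> w h e"
        using v w by (auto intro!: cap_admissible_energy_le)
      obtain k where k: "(\<integral>\<^sup>+p\<in>T. ennreal ((v p - k)\<^sup>2) \<partial>lborel) \<le> ennreal (P * e)"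
        using T(1) ev e unfolding poincare_def by blast
      obtain m where m: "(\<integral>\<^sup>+p\<in>T. ennreal ((w p - m)\<^sup>2) \<partial>lborel) \<le> ennreal (P * e)"
        using T(1) ew e unfolding poincare_def by blast
      obtain Z1 where Z1 [measurable]: "Z1 \<in> borel_measurable borel" and iZ1: "(\<integral>\<^sup>+\<rho>\<in>{0..r}. Z1 \<rho> \<partial>lborel) \<le> ennreal (4 * e)"
        and p1: "\<And>p. p \<in> square x r \<Longrightarrow> ennreal ((v p - k)\<^sup>2) \<le> ennreal (16 * r) * Z1 (supd x p) + ennreal (C * e)"
        using C(2)[OF ev e k] by blast
      obtain Z2 where Z2 [measurable]: "Z2 \<in> borel_measurable borel" and iZ2: "(\<integral>\<^sup>+\<rho>\<in>{0..r}. Z2 \<rho> \<partial>lborel) \<le> ennreal (4 * e)"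
        and p2: "\<And>p. p \<in> square x r \<Longrightarrow> ennreal ((w p - m)\<^sup>2) \<le> ennreal (16 * r) * Z2 (supd x p) + ennreal (C * e)"
        using C(2)[OF ew e m] by blast
      obtain Z3 where Z3: "Z3 \<in> borel_measurable borel" "(\<integral>\<^sup>+\<rho>\<in>{0..r'}. Z3 \<rho> \<partial>lborel) \<le> ennreal (4 * e)"
        and p3: "\<And>p. p \<in> square a r' \<Longrightarrow> ennreal ((v p - k)\<^sup>2) \<le> ennreal (16 * r') * Z3 (supd a p) + ennreal (C' * e)"
        using C'(2)[OF ev e k] by blast
      \<comment> \<open>It is not known beforehand whether the crossing point lies in
        \<open>V\<close>, so \<open>v\<close> and \<open>w\<close> must be controlled at the same
        point: choose a radius good for the sum.\<close>
      have "(\<integral>\<^sup>+\<rho>\<in>{0..r}. (Z1 \<rho> + Z2 \<rho>) \<partial>lborel) = (\<integral>\<^sup>+\<rho>\<in>{0..r}. Z1 \<rho> \<partial>lborel) + (\<integral>\<^sup>+\<rho>\<in>{0..r}. Z2 \<rho> \<partial>lborel)"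
        unfolding distrib_right by (rule nn_integral_add) measurable
      also have "\<dots> \<le> ennreal (4 * e) + ennreal (4 * e)" using iZ1 iZ2 by (rule add_mono)
      also have "\<dots> = ennreal (8 * e)" using e ennreal_plus[of "4 * e" "4 * e"] by simp
      finally have iZ: "(\<integral>\<^sup>+\<rho>\<in>{0..r}. (Z1 \<rho> + Z2 \<rho>) \<partial>lborel) \<le> ennreal (8 * e)" .
      have mZ: "(\<lambda>\<rho>. Z1 \<rho> + Z2 \<rho>) \<in> borel_measurable borel" by measurable
      have e8: "8 * e > 0" "4 * e > 0" using e by auto
      obtain \<rho> where \<rho>: "\<rho> \<in> {0..r}" "Z1 \<rho> + Z2 \<rho> \<le> ennreal (2 * (8 * e) / (r - 0))"
        using good_point[OF mZ r(1) e8(1) iZ] by blast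
      then have Z\<rho>: "Z1 \<rho> \<le> ennreal (16 * e / r)" "Z2 \<rho> \<le> ennreal (16 * e / r)"
        using order_trans[of "Z1 \<rho>" "Z1 \<rho> + Z2 \<rho>"] order_trans[of "Z2 \<rho>" "Z1 \<rho> + Z2 \<rho>"] by auto
      obtain \<rho>' where \<rho>': "\<rho>' \<in> {0..r'}" "Z3 \<rho>' \<le> ennreal (2 * (4 * e) / (r' - 0))"
        using good_point[OF Z3(1) r'(1) e8(2) Z3(2)] by blast
      have "connected (path_image l)" using l(1) by (rule connected_path_image)
      moreover have "x \<in> path_image l" "y \<in> path_image l" using l by auto
      moreover have "0 \<le> \<rho>" "\<rho> \<le> supd x y" using \<rho>(1) r(2) by auto
      ultimately obtain p where p: "p \<in> path_image l" "supd x p = \<rho>" using connected_meets_supd_sphere by blast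
      have "0 \<le> \<rho>'" "\<rho>' \<le> supd a b" using \<rho>'(1) r'(2) by auto
      then obtain q where q: "q \<in> F" "supd a q = \<rho>'" using connected_meets_supd_sphere[OF F(2-4)] by blast
      have pQ: "p \<in> square x r" using p(2) \<rho>(1) by (simp add: square_def)
      have qQ: "q \<in> square a r'" using q(2) \<rho>'(1) by (simp add: square_def)
      have p\<Omega>: "p \<in> \<Omega>" "q \<in> \<Omega>" using pQ qQ r(3) r'(3) by auto
      have "v q = 0" using v(1) q(1) p\<Omega>(2) unfolding cap_admissible_def by blast
      have "(v q - k)\<^sup>2 \<le> (16 * 8 + C') * e"
        using \<rho>'(2) q(2) by (intro sq_le_of_good_radius[OF p3[OF qQ] _ r'(1) e _ C'(1)]) auto
      then have k2: "\<bar>v q - k\<bar> < 1 / 2" using D(3) by (intro half) auto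
      have "(v p - k)\<^sup>2 \<le> (16 * 16 + C) * e"
        using Z\<rho>(1) p(2) by (intro sq_le_of_good_radius[OF p1[OF pQ] _ r(1) e _ C(1)]) auto
      then have vp: "\<bar>v p - k\<bar> < 1 / 2" using D(2) by (intro half) auto
      have "(w p - m)\<^sup>2 \<le> (16 * 16 + C) * e"
        using Z\<rho>(2) p(2) by (intro sq_le_of_good_radius[OF p2[OF pQ] _ r(1) e _ C(1)]) auto
      then have wp: "\<bar>w p - m\<bar> < 1 / 2" using D(2) by (intro half) auto
      show False
      proof (cases "p \<in> V")
        case False
        \<comment> \<open>Yet \<open>v q = 0\<close> gives \<open>k < 1 / 2\<close>, and then
          \<open>v p < k + 1 / 2 < 1\<close>.\<close>
        then have "1 \<le> v p" using v(1) p(1) p\<Omega>(1) unfolding cap_admissible_def by blast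
        then show False using vp k2 \<open>v q = 0\<close> by linarith
      next
        case True
        then have "1 \<le> w p" using w(1) p(1) p\<Omega>(1) unfolding cap_admissible_def by blast
        then have "m > 1 / 2" using wp by linarith
        then have "\<kappa> \<le> 8 * (1 + M * P) * e" unfolding \<kappa>_def
          using conf_cap_le_near_const[OF \<Omega>(1) \<theta> M(1) w(1) less_imp_le[OF w(2)] T'(1,2) Tsub(3) m _ T'(3)] e by simp
        then show False using ke by linarith
      qed
    qed
  qed
qed

text \<open>\<open>nonpolar_boundary\<close> supplies the positive capacity against which positivity
  is tested. If all compact subsets of \<open>\<Omega>\<close> had capacity zero relative to
  \<open>frontier \<Omega>\<close>, as in the whole plane, any curve inside \<open>V\<close> would
  have value zero, and distinct points of \<open>V\<close> would be at distance zero.\<close>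

theorem theorem2p6:
  fixes \<Omega> F V :: "(real^2) set" and h :: "real^2 \<Rightarrow> real^2"
  assumes domain: "open \<Omega>" "connected \<Omega>"
    and nonpolar_boundary: "\<exists>K. compact K \<and> K \<subseteq> \<Omega> \<and> conf_cap (frontier \<Omega>) K \<Omega> > 0"
    and continuum: "compact F" "connected F" "\<exists>a\<in>F. \<exists>b\<in>F. a \<noteq> b"
    and V: "open V" "connected V" "F \<subseteq> V" "closure V \<subseteq> \<Omega>" "compact (closure V)"
    and quasicircle: "quasiconformal h" "frontier V = h ` sphere 0 1"
  shows "(\<forall>x\<in>\<Omega>. \<forall>y\<in>\<Omega>. 0 \<le> cap_dist F V \<Omega> x y) \<and>
         (\<forall>x\<in>\<Omega>. \<forall>y\<in>\<Omega>. cap_dist F V \<Omega> x y = 0 \<longleftrightarrow> x = y) \<and>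
         (\<forall>x\<in>\<Omega>. \<forall>y\<in>\<Omega>. cap_dist F V \<Omega> x y = cap_dist F V \<Omega> y x) \<and>
         (\<forall>x\<in>\<Omega>. \<forall>y\<in>\<Omega>. \<forall>z\<in>\<Omega>. cap_dist F V \<Omega> x z \<le> cap_dist F V \<Omega> x y + cap_dist F V \<Omega> y z)"
proof -
  obtain K where K: "compact K" "K \<subseteq> \<Omega>" "conf_cap (frontier \<Omega>) K \<Omega> > 0" using nonpolar_boundary by blast
  obtain a b where ab: "a \<in> F" "b \<in> F" "a \<noteq> b" using continuum(3) by blast
  define val where "val l = sqrt (conf_cap F (path_image l - V) \<Omega>) + sqrt (conf_cap (frontier \<Omega>) (path_image l \<inter> V) \<Omega>)"
    for l :: "real \<Rightarrow> real^2"
  define L where "L x y = {l. rectifiable_path l \<and> path_image l \<subseteq> \<Omega> \<and> pathstart l = x \<and> pathfinish l = y}" for x y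
  have dist: "cap_dist F V \<Omega> x y = Inf (val ` L x y)" for x y
    unfolding cap_dist_def by (intro arg_cong[where f = Inf]) (auto simp: val_def L_def)
  \<comment> \<open>Both capacities of every curve possess competitors, so all infima are over
    nonempty sets.\<close>
  have admA: "\<exists>v g. cap_admissible F (path_image l - V) \<Omega> v g" for l :: "real \<Rightarrow> real^2"
    by (rule cap_admissible_outside_exists[OF domain(1) continuum(1) V(3,1)]) blast
  have admB: "\<exists>v g. cap_admissible (frontier \<Omega>) (path_image l \<inter> V) \<Omega> v g" for l :: "real \<Rightarrow> real^2"
    using closure_subset[of V] by (intro cap_admissible_frontier_exists[OF domain(1) V(5,4)]) blast
  have val_nonneg: "0 \<le> val l" for l
    unfolding val_def using admA[of l] admB[of l] conf_cap_nonneg by (metis add_nonneg_nonneg real_sqrt_ge_zero)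
  have bdd: "bdd_below (val ` L x y)" for x y
    using val_nonneg by (intro bdd_belowI[of _ 0]) auto
  have ne: "val ` L x y \<noteq> {}" if "x \<in> \<Omega>" "y \<in> \<Omega>" for x y
    using rectifiably_connected[OF domain that] unfolding L_def by blast
  have nonneg: "0 \<le> cap_dist F V \<Omega> x y" if "x \<in> \<Omega>" "y \<in> \<Omega>" for x y
    unfolding dist using val_nonneg ne[OF that] by (intro cInf_greatest) auto
  have le_val: "cap_dist F V \<Omega> x y \<le> val l" if "l \<in> L x y" for x y l
    unfolding dist using that by (intro cInf_lower bdd) auto
  have refl: "cap_dist F V \<Omega> x x = 0" if x: "x \<in> \<Omega>" for x
  proof -
    have "linepath x x \<in> L x x" using x rectifiable_linepath by (simp add: L_def)
    \<comment> \<open>A constant curve lies in \<open>V\<close> or in its complement: one capacity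
      is that of the empty set, the other that of a point off \<open>frontier \<Omega>\<close> or
      off \<open>F\<close>.\<close>
    moreover have "val (linepath x x) = 0"
    proof (cases "x \<in> V")
      case True
      then have "path_image (linepath x x) - V = {}" "path_image (linepath x x) \<inter> V = {x}" by auto
      moreover have "conf_cap (frontier \<Omega>) {x} \<Omega> = 0"
        using domain(1) x by (intro conf_cap_point[of \<Omega> \<Omega>]) (auto simp: frontier_disjoint_eq)
      ultimately show ?thesis by (simp add: val_def conf_cap_empty[OF domain(1)])
    next
      case False
      then have "path_image (linepath x x) - V = {x}" "path_image (linepath x x) \<inter> V = {}" by auto
      moreover have "conf_cap F {x} \<Omega> = 0"
        using domain(1) False V(3) compact_imp_closed[OF continuum(1)]
        by (intro conf_cap_point[of \<Omega> "- F"]) auto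
      ultimately show ?thesis by (simp add: val_def conf_cap_empty[OF domain(1)])
    qed
    ultimately show ?thesis using le_val[of "linepath x x" x x] nonneg[OF x x] by simp
  qed
  have pos: "cap_dist F V \<Omega> x y \<noteq> 0" if x: "x \<in> \<Omega>" and y: "y \<in> \<Omega>" and "x \<noteq> y" for x y
  proof -
    obtain \<delta> where \<delta>: "\<delta> > 0" "\<And>l. path l \<Longrightarrow> path_image l \<subseteq> \<Omega> \<Longrightarrow> pathstart l = x \<Longrightarrow> pathfinish l = y \<Longrightarrow> \<delta> \<le> val l"
      using cap_sum_bounded_below[OF domain K continuum(1,2) ab V(1,3,4,5) x \<open>x \<noteq> y\<close>] unfolding val_def by blast
    have "\<delta> \<le> cap_dist F V \<Omega> x y" unfolding dist
      using ne[OF x y] \<delta>(2) by (intro cInf_greatest) (auto simp: L_def rectifiable_path_def)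
    then show ?thesis using \<delta>(1) by simp
  qed
  have val_sub: "val ` L x y \<subseteq> val ` L y x" for x y
  proof
    fix t assume "t \<in> val ` L x y"
    then obtain l where l: "l \<in> L x y" "t = val l" by blast
    then have "reversepath l \<in> L y x" by (auto simp: L_def rectifiable_reversepath)
    moreover have "val (reversepath l) = t" using l by (simp add: val_def)
    ultimately show "t \<in> val ` L y x" by blast
  qed
  have sym: "cap_dist F V \<Omega> x y = cap_dist F V \<Omega> y x" for x y
    unfolding dist using val_sub[of x y] val_sub[of y x] by simp
  have val_join: "val (l +++ m) \<le> val l + val m" if "pathfinish l = pathstart m" for l m
  proof -
    have "path_image (l +++ m) - V = (path_image l - V) \<union> (path_image m - V)"
      "path_image (l +++ m) \<inter> V = (path_image l \<inter> V) \<union> (path_image m \<inter> V)"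
      using that by (auto simp: path_image_join)
    moreover obtain v g v' g' where "cap_admissible F (path_image l - V) \<Omega> v g" "cap_admissible F (path_image m - V) \<Omega> v' g'"
      using admA[of l] admA[of m] by blast
    note sqrt_conf_cap_Un_le[OF domain(1) this]
    moreover obtain w h w' h' where "cap_admissible (frontier \<Omega>) (path_image l \<inter> V) \<Omega> w h"
        "cap_admissible (frontier \<Omega>) (path_image m \<inter> V) \<Omega> w' h'"
      using admB[of l] admB[of m] by blast
    note sqrt_conf_cap_Un_le[OF domain(1) this]
    ultimately show ?thesis unfolding val_def by simp
  qed
  have tri: "cap_dist F V \<Omega> x z \<le> cap_dist F V \<Omega> x y + cap_dist F V \<Omega> y z"
    if x: "x \<in> \<Omega>" and y: "y \<in> \<Omega>" and z: "z \<in> \<Omega>" for x y z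
  proof (rule field_le_epsilon)
    fix \<epsilon> :: real assume "\<epsilon> > 0"
    then have "Inf (val ` L x y) < cap_dist F V \<Omega> x y + \<epsilon> / 2" "Inf (val ` L y z) < cap_dist F V \<Omega> y z + \<epsilon> / 2"
      by (simp_all add: dist)
    then obtain l m where l: "l \<in> L x y" "val l < cap_dist F V \<Omega> x y + \<epsilon> / 2"
      and m: "m \<in> L y z" "val m < cap_dist F V \<Omega> y z + \<epsilon> / 2"
      using cInf_lessD[OF ne[OF x y]] cInf_lessD[OF ne[OF y z]] by blast
    have "l +++ m \<in> L x z" using l(1) m(1) by (auto simp: L_def path_image_join intro: rectifiable_joinpaths)
    then have "cap_dist F V \<Omega> x z \<le> val (l +++ m)" by (rule le_val)
    also have "\<dots> \<le> val l + val m" using l(1) m(1) by (intro val_join) (simp add: L_def)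
    finally show "cap_dist F V \<Omega> x z \<le> cap_dist F V \<Omega> x y + cap_dist F V \<Omega> y z + \<epsilon>" using l(2) m(2) by linarith
  qed
  show ?thesis using nonneg refl pos sym tri by blast
qed

end
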